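(* Let $\mathcal H$ be a finite-dimensional Hilbert space, let $\varrho,\sigma$ be density operators on $\mathcal H$, and let $\alpha\in(0,1)$. Then the limit $\lim_{n\to+\infty}\frac{1}{n}D_{\alpha}^{\mathrm{test}}(\varrho^{\otimes n}\|\sigma^{\otimes n})$ exists (in $[0,+\infty]$), and \[ \overline{D}_{\alpha}^{\mathrm{test}}(\varrho\|\sigma) =\lim_{n\to+\infty}\frac{1}{n}D_{\alpha}^{\mathrm{test}}(\varrho^{\otimes n}\|\sigma^{\otimes n}) =\sup_{r>0}\min\Big\{r,\frac{\alpha}{1-\alpha}H_r(\varrho\|\sigma)\Big\} =\sup\Big\{r\ge 0:\ H_r(\varrho\|\sigma)\ge \frac{1-\alpha}{\alpha}r\Big\}. \]
   Context: For a PSD operator $A=\sum_a aP_a$ (spectral decomposition) and $x\in\mathbb R$, $A^x:=\sum_{a>0}a^xP_a$; in particular $A^0$ is the support projection. For probability vectors $p,q$ on a finite set and $\alpha\in(0,1)$, the classical Rényi divergence is $D_\alpha(p\|q)=\frac{1}{\alpha-1}\log\sum_\omega p(\omega)^\alpha q(\omega)^{1-\alpha}$ (equal to $+\infty$ if the sum is $0$). A test on $\mathcal H$ is an operator $T$ with $0\le T\le I$; for a test $T$ and an operator $X$ put $\mathcal T(X):=(\operatorname{Tr}XT,\operatorname{Tr}X(I-T))$. The test-measured Rényi $\alpha$-divergence is $D_\alpha^{\mathrm{test}}(\varrho\|\sigma):=\max_{0\le T\le I}D_\alpha(\mathcal T(\varrho)\|\mathcal T(\sigma))$, and its regularization is $\overline{D}_\alpha^{\mathrm{test}}(\varrho\|\sigma):=\limsup_{n\to\infty}\frac1n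 D_\alpha^{\mathrm{test}}(\varrho^{\otimes n}\|\sigma^{\otimes n})$. The (Petz-type) Rényi divergence for $\alpha\in(0,1)$ is $D_\alpha(\varrho\|\sigma)=\frac{1}{\alpha-1}\log\operatorname{Tr}\varrho^\alpha\sigma^{1-\alpha}$, and the Hoeffding divergence is $H_r(\varrho\|\sigma):=\sup_{\beta\in(0,1)}\frac{\beta-1}{\beta}\big[r-D_\beta(\varrho\|\sigma)\big]$ for $r\in\mathbb R$. *)

theory Defs
  imports "Jordan_Normal_Form.Matrix" "HOL-Library.Extended_Real"
begin

text \<open>Operators on the d-dimensional Hilbert space C^d are d x d complex matrices
  (Jordan_Normal_Form matrices, carrier_mat d d).\<close>

definition mtrace :: "complex mat \<Rightarrow> complex" where
  "mtrace A = (\<Sum>i<dim_row A. A $$ (i, i))"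

definition hermitian_op :: "nat \<Rightarrow> complex mat \<Rightarrow> bool" where
  "hermitian_op d A \<longleftrightarrow> A \<in> carrier_mat d d \<and>
     (\<forall>i<d. \<forall>j<d. A $$ (i, j) = cnj (A $$ (j, i)))"

definition psd_op :: "nat \<Rightarrow> complex mat \<Rightarrow> bool" where
  "psd_op d A \<longleftrightarrow> hermitian_op d A \<and>
     (\<forall>v \<in> carrier_vec d. let q = (\<Sum>i<d. cnj (v $ i) * (A *\<^sub>v v) $ i) in
        Im q = 0 \<and> 0 \<le> Re q)"

definition density_op :: "nat \<Rightarrow> complex mat \<Rightarrow> bool" where
  "density_op d A \<longleftrightarrow> psd_op d A \<and> mtrace A = 1"

definition test_op :: "nat \<Rightarrow> complex mat \<Rightarrow> bool" where
  "test_op d T \<longleftrightarrow> psd_op d T \<and> psd_op d (1\<^sub>m d - T)"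

definition kron :: "complex mat \<Rightarrow> complex mat \<Rightarrow> complex mat" where
  "kron A B = mat (dim_row A * dim_row B) (dim_col A * dim_col B)
     (\<lambda>(i, j). A $$ (i div dim_row B, j div dim_col B) * B $$ (i mod dim_row B, j mod dim_col B))"

fun tensor_pow :: "complex mat \<Rightarrow> nat \<Rightarrow> complex mat" where
  "tensor_pow A 0 = 1\<^sub>m 1"
| "tensor_pow A (Suc n) = kron A (tensor_pow A n)"

definition spec_proj :: "complex mat \<Rightarrow> real \<Rightarrow> complex mat" where
  "spec_proj A a = (THE P. hermitian_op (dim_row A) P \<and> P * P = P \<and>
      {P *\<^sub>v v | v. v \<in> carrier_vec (dim_row A)} =
      {v \<in> carrier_vec (dim_row A). A *\<^sub>v v = complex_of_real a \<cdot>\<^sub>v v})"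

definition spec_vals :: "complex mat \<Rightarrow> real set" where
  "spec_vals A = {a. \<exists>v \<in> carrier_vec (dim_row A). v \<noteq> 0\<^sub>v (dim_row A) \<and>
      A *\<^sub>v v = complex_of_real a \<cdot>\<^sub>v v}"

definition op_pow :: "complex mat \<Rightarrow> real \<Rightarrow> complex mat" where
  "op_pow A x = mat (dim_row A) (dim_row A)
     (\<lambda>ij. \<Sum>a \<in> {a \<in> spec_vals A. 0 < a}. complex_of_real (a powr x) * spec_proj A a $$ ij)"

definition renyi_cl :: "real \<Rightarrow> 'w set \<Rightarrow> ('w \<Rightarrow> real) \<Rightarrow> ('w \<Rightarrow> real) \<Rightarrow> ereal" where
  "renyi_cl \<alpha> \<Omega> p q = (let s = (\<Sum>\<omega>\<in>\<Omega>. p \<omega> powr \<alpha> * q \<omega> powr (1 - \<alpha>)) in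
     if s = 0 then \<infinity> else ereal (ln s / (\<alpha> - 1)))"

definition test_distr :: "nat \<Rightarrow> complex mat \<Rightarrow> complex mat \<Rightarrow> bool \<Rightarrow> real" where
  "test_distr d T X b = (if b then Re (mtrace (X * T)) else Re (mtrace (X * (1\<^sub>m d - T))))"

definition renyi_test :: "nat \<Rightarrow> real \<Rightarrow> complex mat \<Rightarrow> complex mat \<Rightarrow> ereal" where
  "renyi_test d \<alpha> \<rho> \<sigma> = (SUP T \<in> {T. test_op d T}.
       renyi_cl \<alpha> UNIV (test_distr d T \<rho>) (test_distr d T \<sigma>))"

definition renyi_test_reg :: "nat \<Rightarrow> real \<Rightarrow> complex mat \<Rightarrow> complex mat \<Rightarrow> ereal" where
  "renyi_test_reg d \<alpha> \<rho> \<sigma> = limsup (\<lambda>n. renyi_test (d ^ n) \<alpha> (tensor_pow \<rho> n) (tensor_pow \<sigma> n) / ereal (real n))"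

definition renyi_petz :: "real \<Rightarrow> complex mat \<Rightarrow> complex mat \<Rightarrow> ereal" where
  "renyi_petz \<alpha> \<rho> \<sigma> = (let s = Re (mtrace (op_pow \<rho> \<alpha> * op_pow \<sigma> (1 - \<alpha>))) in
     if s = 0 then \<infinity> else ereal (ln s / (\<alpha> - 1)))"

definition hoeffding :: "real \<Rightarrow> complex mat \<Rightarrow> complex mat \<Rightarrow> ereal" where
  "hoeffding r \<rho> \<sigma> = (SUP \<beta> \<in> {0<..<1}. ereal ((\<beta> - 1) / \<beta>) * (ereal r - renyi_petz \<beta> \<rho> \<sigma>))"

end

theory Submission
  imports "HOL-Analysis.Convex" "Jordan_Normal_Form.Spectral_Radius" Defs
begin

text \<open>
  Write \<open>\<rho> = U diag(l) U\<^sup>*\<close>, \<open>\<sigma> = V diag(m) V\<^sup>*\<close>, \<open>W = U\<^sup>* V\<close>. The Nussbaum-Szkola distributions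
  \<open>p(i,j) = l\<^sub>i |W\<^sub>i\<^sub>j|\<^sup>2\<close> and \<open>q(i,j) = m\<^sub>j |W\<^sub>i\<^sub>j|\<^sup>2\<close> satisfy \<open>\<phi>(s) = Tr \<rho>\<^sup>s \<sigma>\<^sup>1\<^sup>-\<^sup>s = \<Sum> p\<^sup>s q\<^sup>1\<^sup>-\<^sup>s\<close> and
  are multiplicative under tensor powers. Eliminating \<open>r\<close> from the Hoeffding divergences shows that both
  suprema in the theorem equal \<open>sup\<^sub>s - ln \<phi>(s) / (s (1 - \<alpha>) / \<alpha> + 1 - s)\<close>.

  For achievability, the Holevo-Helstrom test for \<open>\<theta> \<rho>\<^sup>\<otimes>\<^sup>n\<close> against \<open>\<sigma>\<^sup>\<otimes>\<^sup>n\<close> has weighted error at most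
  \<open>\<theta>\<^sup>s \<phi>(s)\<^sup>n\<close> by Audenaert's inequality, which follows with Ozawa's argument from the operator
  monotonicity of \<open>t \<mapsto> t\<^sup>s\<close>; dyadic \<open>s\<close> suffice by continuity. The prior weight \<open>\<theta>\<close> is exponential in \<open>n\<close> and
  chosen to balance the two terms of the classical Renyi sum.

  Conversely the weighted error of every test is at least \<open>\<Sum> min(\<theta> p\<^sub>n, q\<^sub>n) / 2\<close>. Tilting at the minimiser of the
  Chernoff sum and comparing second moments shows that this sum has the same exponent.
\<close>

section \<open>Matrix algebra\<close>

text \<open>The convention \<open>0 powr x = 0\<close>, valid for x = 0 too, is used throughout:
  powers of operators live on supports, and Chernoff sums run over the common support for every
  exponent. Hence \<phi> is zero everywhere or positive everywhere, which is the split between an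
  infinite and a finitely parametrised rate. The weight is exp (n (x a - x)) with a = (1 - \<alpha>)
  / \<alpha>. A weighted error of order exp (- n x) then means errors exp (- n x a) and exp (- n x),
  and \<alpha> a = 1 - \<alpha> gives both summands of the Renyi sum the exponent (1 - \<alpha>) x.
  The same weight serves both directions. Two obstacles shape the converse. A small Renyi sum does
  not tell a test from its complement; once one error is known to be at most 1/2, both summands can
  be inverted at the cost of constants independent of n. And the minimiser of the weighted Chernoff
  sum may be an endpoint of [0, 1], where the mean log-likelihood ratio only has a sign; it is the
  favourable one, and the endpoint value is compared with the open interval by continuity.\<close>

declare index_mult_mat(1)[simp del] index_mult_mat_vec[simp del]

definition adj :: "complex mat \<Rightarrow> complex mat" where
  "adj A = mat (dim_col A) (dim_row A) (\<lambda>(i, j). cnj (A $$ (j, i)))"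

definition rdiag :: "nat \<Rightarrow> (nat \<Rightarrow> real) \<Rightarrow> complex mat" where
  "rdiag d l = mat d d (\<lambda>(i, j). if i = j then complex_of_real (l i) else 0)"

definition unitary_mat :: "nat \<Rightarrow> complex mat \<Rightarrow> bool" where
  "unitary_mat d U \<longleftrightarrow> U \<in> carrier_mat d d \<and> adj U * U = 1\<^sub>m d \<and> U * adj U = 1\<^sub>m d"

text \<open>For unitary \<open>U\<close> the eigenvalues are listed with multiplicity and in no
  order, so functional calculus is composition with \<open>l\<close>. The distinct eigenvalues and
  projections in \<open>op_pow\<close> are matched to this form in
  \<open>op_pow_spec\<close>.\<close>

definition spec_mat :: "nat \<Rightarrow> complex mat \<Rightarrow> (nat \<Rightarrow> real) \<Rightarrow> complex mat" where
  "spec_mat d U l = U * rdiag d l * adj U"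

lemma adj_carrier[simp]: "A \<in> carrier_mat n m \<Longrightarrow> adj A \<in> carrier_mat m n"
  by (auto simp: adj_def)

lemma adj_dim[simp]: "dim_row (adj A) = dim_col A" "dim_col (adj A) = dim_row A"
  by (auto simp: adj_def)

lemma adj_index[simp]: "i < dim_col A \<Longrightarrow> j < dim_row A \<Longrightarrow> adj A $$ (i, j) = cnj (A $$ (j, i))"
  by (auto simp: adj_def)

lemma adj_adj[simp]: "adj (adj A) = A"
  by (rule eq_matI) auto

lemma index_mult_sum: "A \<in> carrier_mat n m \<Longrightarrow> B \<in> carrier_mat m k \<Longrightarrow> i < n \<Longrightarrow> j < k \<Longrightarrow>
    (A * B) $$ (i, j) = (\<Sum>x<m. A $$ (i, x) * B $$ (x, j))"
  by (auto simp: index_mult_mat(1) scalar_prod_def lessThan_atLeast0 intro!: sum.cong)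

lemma index_mult_vec_sum: "A \<in> carrier_mat n m \<Longrightarrow> v \<in> carrier_vec m \<Longrightarrow> i < n \<Longrightarrow>
    (A *\<^sub>v v) $ i = (\<Sum>x<m. A $$ (i, x) * v $ x)"
  by (auto simp: index_mult_mat_vec scalar_prod_def lessThan_atLeast0 intro!: sum.cong)

lemma adj_mult: "A \<in> carrier_mat n m \<Longrightarrow> B \<in> carrier_mat m k \<Longrightarrow> adj (A * B) = adj B * adj A"
  apply (rule eq_matI)
  subgoal for i j
    by (simp add: index_mult_sum[where n = n and m = m and k = k]
        index_mult_sum[where n = k and m = m and k = n] mult.commute)
  by auto

lemma adj_add: "A \<in> carrier_mat n m \<Longrightarrow> B \<in> carrier_mat n m \<Longrightarrow> adj (A + B) = adj A + adj B"
  by (rule eq_matI) auto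

lemma adj_minus: "A \<in> carrier_mat n m \<Longrightarrow> B \<in> carrier_mat n m \<Longrightarrow> adj (A - B) = adj A - adj B"
  by (rule eq_matI) auto

lemma adj_one[simp]: "adj (1\<^sub>m n) = 1\<^sub>m n"
  by (rule eq_matI) auto

lemma rdiag_carrier[simp]: "rdiag d l \<in> carrier_mat d d"
  by (auto simp: rdiag_def)

lemma rdiag_dim[simp]: "dim_row (rdiag d l) = d" "dim_col (rdiag d l) = d"
  by (auto simp: rdiag_def)

lemma rdiag_index: "i < d \<Longrightarrow> j < d \<Longrightarrow> rdiag d l $$ (i, j) = (if i = j then complex_of_real (l i) else 0)"
  by (auto simp: rdiag_def)

lemma adj_rdiag[simp]: "adj (rdiag d l) = rdiag d l"
  by (rule eq_matI) (auto simp: rdiag_def)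

lemma index_mult_rdiag: "A \<in> carrier_mat n d \<Longrightarrow> i < n \<Longrightarrow> j < d \<Longrightarrow>
    (A * rdiag d l) $$ (i, j) = A $$ (i, j) * complex_of_real (l j)"
  by (subst index_mult_sum[where m = d and n = n and k = d])
     (auto simp: rdiag_index if_distrib[of "\<lambda>x. _ * x"] cong: if_cong)

lemma index_rdiag_mult: "A \<in> carrier_mat d n \<Longrightarrow> i < d \<Longrightarrow> j < n \<Longrightarrow>
    (rdiag d l * A) $$ (i, j) = complex_of_real (l i) * A $$ (i, j)"
  by (subst index_mult_sum[where m = d and n = d and k = n])
     (auto simp: rdiag_index if_distrib[of "\<lambda>x. x * _"] cong: if_cong)

lemma rdiag_mult: "rdiag d l * rdiag d m = rdiag d (\<lambda>i. l i * m i)"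
  apply (rule eq_matI)
  subgoal for i j by (simp add: index_rdiag_mult[where n = d] rdiag_index)
  by auto

lemma rdiag_minus: "rdiag d l - rdiag d m = rdiag d (\<lambda>i. l i - m i)"
  by (rule eq_matI) (auto simp: rdiag_index)

lemma rdiag_one: "rdiag d (\<lambda>i. 1) = 1\<^sub>m d"
  by (rule eq_matI) (auto simp: rdiag_index)

lemma rdiag_cong: "(\<And>i. i < d \<Longrightarrow> l i = m i) \<Longrightarrow> rdiag d l = rdiag d m"
  by (rule eq_matI) (auto simp: rdiag_index)

lemma spec_mat_cong: "(\<And>i. i < d \<Longrightarrow> l i = m i) \<Longrightarrow> spec_mat d U l = spec_mat d U m"
  unfolding spec_mat_def by (simp cong: rdiag_cong)

locale sqmat =
  fixes d :: nat
begin

abbreviation M :: "complex mat set" where "M \<equiv> carrier_mat d d"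
abbreviation "unitary \<equiv> unitary_mat d"
abbreviation "spec \<equiv> spec_mat d"
abbreviation "psd \<equiv> psd_op d"

lemma sq_closed[simp]:
  "A \<in> M \<Longrightarrow> B \<in> M \<Longrightarrow> A * B \<in> M" "A \<in> M \<Longrightarrow> B \<in> M \<Longrightarrow> A + B \<in> M"
  "A \<in> M \<Longrightarrow> B \<in> M \<Longrightarrow> A - B \<in> M" "A \<in> M \<Longrightarrow> adj A \<in> M" "A \<in> M \<Longrightarrow> c \<cdot>\<^sub>m A \<in> M"
  by auto

lemma sq_assoc: "A \<in> M \<Longrightarrow> B \<in> M \<Longrightarrow> C \<in> M \<Longrightarrow> (A * B) * C = A * (B * C)"
  by (rule assoc_mult_mat)

lemma sq_one: "A \<in> M \<Longrightarrow> A * 1\<^sub>m d = A" "A \<in> M \<Longrightarrow> 1\<^sub>m d * A = A"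
  by simp_all

lemma sq_distrib:
  "A \<in> M \<Longrightarrow> B \<in> M \<Longrightarrow> C \<in> M \<Longrightarrow> (A + B) * C = A * C + B * C"
  "A \<in> M \<Longrightarrow> B \<in> M \<Longrightarrow> C \<in> M \<Longrightarrow> C * (A + B) = C * A + C * B"
  "A \<in> M \<Longrightarrow> B \<in> M \<Longrightarrow> C \<in> M \<Longrightarrow> (A - B) * C = A * C - B * C"
  "A \<in> M \<Longrightarrow> B \<in> M \<Longrightarrow> C \<in> M \<Longrightarrow> C * (A - B) = C * A - C * B"
  by (rule add_mult_distrib_mat mult_add_distrib_mat minus_mult_distrib_mat mult_minus_distrib_mat; assumption)+

lemma sq_adj: "A \<in> M \<Longrightarrow> B \<in> M \<Longrightarrow> adj (A * B) = adj B * adj A"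
  by (rule adj_mult)

lemma unitaryD: assumes "unitary U"
  shows "U \<in> M" "adj U * U = 1\<^sub>m d" "U * adj U = 1\<^sub>m d" "adj U \<in> M"
  using assms by (auto simp: unitary_mat_def)

lemma unitary_cancel: assumes "unitary U" "A \<in> M"
  shows "adj U * (U * A) = A" "U * (adj U * A) = A"
  using unitaryD[OF assms(1)] assms(2) by (simp_all flip: sq_assoc)

lemma unitary_adj: "unitary U \<Longrightarrow> unitary (adj U)"
  by (auto simp: unitary_mat_def)

lemma unitary_mult: assumes "unitary U" "unitary V" shows "unitary (U * V)"
  using unitaryD[OF assms(1)] unitaryD[OF assms(2)] assms
  by (simp add: unitary_mat_def sq_adj sq_assoc unitary_cancel)

lemma unitary_one: "unitary (1\<^sub>m d)"
  by (auto simp: unitary_mat_def)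

lemma spec_carrier[simp]: "U \<in> M \<Longrightarrow> spec U l \<in> M"
  by (simp add: spec_mat_def)

lemma spec_adj: "U \<in> M \<Longrightarrow> adj (spec U l) = spec U l"
  by (simp add: spec_mat_def sq_adj sq_assoc)

lemma spec_mult: assumes "unitary U"
  shows "spec U l * spec U m = spec U (\<lambda>i. l i * m i)"
  using unitaryD[OF assms]
  by (simp add: spec_mat_def sq_assoc unitary_cancel[OF assms] rdiag_mult[symmetric])

lemma spec_minus: assumes "U \<in> M" shows "spec U l - spec U m = spec U (\<lambda>i. l i - m i)"
  using assms by (simp add: spec_mat_def sq_distrib flip: rdiag_minus)

lemma spec_one: assumes "unitary U" shows "spec U (\<lambda>i. 1) = 1\<^sub>m d"
  using unitaryD[OF assms] by (simp add: spec_mat_def rdiag_one)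

lemma spec_conj: assumes "U \<in> M" "X \<in> M" shows "X * spec U l * adj X = spec (X * U) l"
  using assms by (simp add: spec_mat_def sq_adj sq_assoc)

lemma adj_spec_conj: assumes "U \<in> M" "X \<in> M" shows "adj X * spec U l * X = spec (adj X * U) l"
  using spec_conj[of U "adj X" l] assms by simp

lemma spec_index: assumes "U \<in> M" "i < d" "j < d"
  shows "spec U l $$ (i, j) = (\<Sum>k<d. complex_of_real (l k) * (U $$ (i, k) * cnj (U $$ (j, k))))"
proof -
  have "spec U l $$ (i, j) = (\<Sum>k<d. (U * rdiag d l) $$ (i, k) * adj U $$ (k, j))"
    unfolding spec_mat_def by (rule index_mult_sum) (use assms in auto)
  then show ?thesis
    using assms by (simp add: index_mult_rdiag[where n = d] mult_ac)
qed

lemma spec_smult: assumes "U \<in> M" shows "complex_of_real c \<cdot>\<^sub>m spec U l = spec U (\<lambda>i. c * l i)"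
proof -
  have "dim_row (spec U m) = d" "dim_col (spec U m) = d" for m
    using spec_carrier[OF assms] by auto
  then show ?thesis
    by (intro eq_matI) (use assms in \<open>auto simp: spec_index sum_distrib_left mult_ac\<close>)
qed

definition qf :: "complex mat \<Rightarrow> complex vec \<Rightarrow> complex" where
  "qf A v = (\<Sum>i<d. cnj (v $ i) * (A *\<^sub>v v) $ i)"

lemma qf_eq: "A \<in> M \<Longrightarrow> v \<in> carrier_vec d \<Longrightarrow>
    qf A v = (\<Sum>i<d. \<Sum>j<d. cnj (v $ i) * A $$ (i, j) * v $ j)"
  unfolding qf_def by (simp add: index_mult_vec_sum[where n = d and m = d] sum_distrib_left mult.assoc)

lemma hermitian_iff: "hermitian_op d A \<longleftrightarrow> A \<in> M \<and> adj A = A"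
proof
  assume "hermitian_op d A"
  then show "A \<in> M \<and> adj A = A"
    unfolding hermitian_op_def by (metis adj_dim adj_index carrier_matD eq_matI)
next
  assume *: "A \<in> M \<and> adj A = A"
  then have "A $$ (i, j) = cnj (A $$ (j, i))" if "i < d" "j < d" for i j
    using that adj_index[of i A j] by (metis carrier_matD)
  with * show "hermitian_op d A"
    unfolding hermitian_op_def by blast
qed

text \<open>Conjugating the quadratic form of a self-adjoint matrix amounts to swapping the two
  summations, so its values are automatically real.\<close>

lemma psd_iff: "psd A \<longleftrightarrow> A \<in> M \<and> adj A = A \<and> (\<forall>v\<in>carrier_vec d. 0 \<le> Re (qf A v))"
proof -
  have "Im (qf A v) = 0" if "A \<in> M" "adj A = A" "v \<in> carrier_vec d" for v
  proof -
    have A: "cnj (A $$ (i, j)) = A $$ (j, i)" if "i < d" "j < d" for i j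
      using that \<open>A \<in> M\<close> \<open>adj A = A\<close> by (metis adj_index carrier_matD)
    have "cnj (qf A v) = (\<Sum>i<d. \<Sum>j<d. v $ i * A $$ (j, i) * cnj (v $ j))"
      using that by (simp add: qf_eq A)
    also have "\<dots> = qf A v"
      using that by (subst sum.swap) (simp add: qf_eq mult_ac)
    finally show ?thesis by (simp add: complex_eq_iff)
  qed
  then show ?thesis
    unfolding psd_op_def hermitian_iff by (auto simp: Let_def qf_def)
qed

lemma psdD: assumes "psd A" shows "A \<in> M" "adj A = A"
  using assms by (auto simp: psd_iff)

lemma psd_add: assumes "psd A" "psd B" shows "psd (A + B)"
proof -
  have "qf (A + B) v = qf A v + qf B v" if "v \<in> carrier_vec d" for v
    using that psdD(1)[OF assms(1)] psdD(1)[OF assms(2)]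
    by (simp add: qf_eq distrib_left distrib_right sum.distrib)
  then show ?thesis
    using assms by (auto simp: psd_iff adj_add[where n = d and m = d])
qed

text \<open>The quadratic form of \<open>X * A * adj X\<close> at a vector is that of
  \<open>A\<close> at its image under \<open>adj X\<close>.\<close>

lemma psd_conj: assumes "psd A" "X \<in> M" shows "psd (X * A * adj X)"
proof -
  have A: "A \<in> M" "adj A = A" using psdD[OF assms(1)] .
  have "qf (X * A * adj X) v = qf A (adj X *\<^sub>v v)" if v: "v \<in> carrier_vec d" for v
  proof -
    define w where "w = adj X *\<^sub>v v"
    have w': "w \<in> carrier_vec d"
      unfolding w_def by (rule mult_mat_vec_carrier[where n = d and nr = d]) (use v assms in auto)
    have w: "w $ i = (\<Sum>x<d. cnj (X $$ (x, i)) * v $ x)" if "i < d" for i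
      unfolding w_def using that v assms
      by (subst index_mult_vec_sum[where n = d and m = d]) auto
    have "(X * A * adj X) *\<^sub>v v = X *\<^sub>v (A *\<^sub>v w)"
      unfolding w_def using A v assms
      by (metis assoc_mult_mat_vec mult_mat_vec_carrier sq_closed(1,4))
    then have "qf (X * A * adj X) v = (\<Sum>i<d. cnj (v $ i) * (\<Sum>j<d. X $$ (i, j) * (A *\<^sub>v w) $ j))"
      unfolding qf_def using A assms w'
      by (simp add: index_mult_vec_sum[where n = d and m = d and A = X] mult_mat_vec_carrier[where n = d and nr = d])
    also have "\<dots> = (\<Sum>j<d. \<Sum>i<d. cnj (v $ i) * (X $$ (i, j) * (A *\<^sub>v w) $ j))"
      by (simp add: sum_distrib_left) (rule sum.swap)
    also have "\<dots> = qf A w"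
      unfolding qf_def by (rule sum.cong) (auto simp: w sum_distrib_left sum_distrib_right mult_ac)
    finally show ?thesis by (simp add: w_def)
  qed
  moreover have "adj X *\<^sub>v v \<in> carrier_vec d" if "v \<in> carrier_vec d" for v
    by (rule mult_mat_vec_carrier[where n = d and nr = d]) (use that assms in auto)
  moreover have "adj (X * A * adj X) = X * A * adj X"
    using A assms by (simp add: sq_adj sq_assoc)
  ultimately show ?thesis
    using assms by (auto simp: psd_iff)
qed

lemma psd_adj_conj: "psd A \<Longrightarrow> X \<in> M \<Longrightarrow> psd (adj X * A * X)"
  using psd_conj[of A "adj X"] by simp

lemma psd_rdiag: assumes "\<And>i. i < d \<Longrightarrow> 0 \<le> l i" shows "psd (rdiag d l)"
proof -
  have "qf (rdiag d l) v = (\<Sum>i<d. complex_of_real (l i * (cmod (v $ i))\<^sup>2))" if "v \<in> carrier_vec d" for v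
  proof -
    have "qf (rdiag d l) v = (\<Sum>i<d. \<Sum>j<d. if i = j then cnj (v $ i) * complex_of_real (l i) * v $ j else 0)"
      unfolding qf_eq[OF rdiag_carrier that] by (intro sum.cong) (auto simp: rdiag_index)
    then show ?thesis
      by (simp add: complex_norm_square mult_ac del: of_real_power)
  qed
  then show ?thesis
    using assms by (auto simp: psd_iff intro!: sum_nonneg)
qed

lemma psd_diag: assumes "psd A" "i < d" shows "0 \<le> Re (A $$ (i, i))" "Im (A $$ (i, i)) = 0"
proof -
  have "qf A (unit_vec d i) = (\<Sum>k<d. if k = i then (\<Sum>j<d. if j = i then A $$ (i, i) else 0) else 0)"
    unfolding qf_eq[OF psdD(1)[OF assms(1)] unit_vec_carrier]
    by (intro sum.cong refl) (use assms(2) in \<open>auto intro!: sum.neutral sum.cong simp: if_distrib[of "\<lambda>x. _ * x"] cong: if_cong\<close>)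
  also have "\<dots> = A $$ (i, i)" using assms by simp
  finally show "0 \<le> Re (A $$ (i, i))" using assms by (metis psd_iff unit_vec_carrier)
  show "Im (A $$ (i, i)) = 0"
    using psdD[OF assms(1)] assms(2) adj_index[of i A i] by (auto simp: complex_eq_iff)
qed

lemma psd_spec: assumes "U \<in> M" "\<And>i. i < d \<Longrightarrow> 0 \<le> l i" shows "psd (spec U l)"
  unfolding spec_mat_def by (intro psd_conj psd_rdiag assms)

lemma spec_psd_nonneg: assumes "unitary U" "psd (spec U l)" "i < d" shows "0 \<le> l i"
proof -
  have "adj U * spec U l * U = rdiag d l"
    using unitaryD[OF assms(1)] by (simp add: spec_mat_def sq_assoc unitary_cancel[OF assms(1)])
  with psd_diag(1)[OF psd_adj_conj[OF assms(2)], of U i] show ?thesis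
    using unitaryD[OF assms(1)] assms(3) by (simp add: rdiag_index)
qed

lemma psd_gram: "X \<in> M \<Longrightarrow> psd (adj X * X)"
  using psd_adj_conj[OF psd_rdiag[of "\<lambda>i. 1"], of X] by (simp add: rdiag_one)

section \<open>Trace\<close>

lemma mtrace_eq: "A \<in> M \<Longrightarrow> mtrace A = (\<Sum>i<d. A $$ (i, i))"
  by (simp add: mtrace_def)

lemma mtrace_comm: assumes "A \<in> M" "B \<in> M" shows "mtrace (A * B) = mtrace (B * A)"
  using assms by (simp add: mtrace_eq index_mult_sum[where n = d and m = d and k = d] mult.commute)
     (subst sum.swap, simp add: mult.commute)

lemma mtrace_add: "A \<in> M \<Longrightarrow> B \<in> M \<Longrightarrow> mtrace (A + B) = mtrace A + mtrace B"
  by (simp add: mtrace_eq sum.distrib)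

lemma mtrace_minus: "A \<in> M \<Longrightarrow> B \<in> M \<Longrightarrow> mtrace (A - B) = mtrace A - mtrace B"
  by (simp add: mtrace_eq sum_subtractf)

lemma mtrace_smult: "A \<in> M \<Longrightarrow> mtrace (c \<cdot>\<^sub>m A) = c * mtrace A"
  by (simp add: mtrace_eq sum_distrib_left)

lemma mtrace_spec_mult: assumes "U \<in> M" "A \<in> M"
  shows "mtrace (spec U l * A) = (\<Sum>i<d. complex_of_real (l i) * (adj U * A * U) $$ (i, i))"
proof -
  have "mtrace (spec U l * A) = mtrace (U * (rdiag d l * adj U * A))"
    using assms by (simp add: spec_mat_def sq_assoc)
  also have "\<dots> = mtrace (rdiag d l * (adj U * A * U))"
    using assms by (subst mtrace_comm) (auto simp: sq_assoc)
  finally show ?thesis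
    using assms by (simp add: mtrace_eq index_rdiag_mult[where n = d])
qed

lemma mtrace_spec_spec: assumes "U \<in> M" "V \<in> M"
  shows "mtrace (spec U l * spec V m) =
    complex_of_real (\<Sum>i<d. \<Sum>j<d. l i * m j * (cmod ((adj U * V) $$ (i, j)))\<^sup>2)"
  using assms by (simp add: mtrace_spec_mult adj_spec_conj spec_index sum_distrib_left mult_ac
      complex_norm_square[symmetric] del: of_real_power)

lemma mtrace_spec: assumes "unitary U" shows "mtrace (spec U l) = complex_of_real (\<Sum>i<d. l i)"
proof -
  have "mtrace (spec U l) = mtrace (spec U l * 1\<^sub>m d)" using unitaryD[OF assms] by (simp add: sq_one)
  also have "\<dots> = (\<Sum>i<d. complex_of_real (l i))"
    by (subst mtrace_spec_mult) (use unitaryD[OF assms] in \<open>simp_all add: sq_one\<close>)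
  finally show ?thesis by simp
qed

end

section \<open>Spectral theorem\<close>

text \<open>The reflection along w = e_0 - v exchanges the unit vectors e_0 and v. Over the complex
  numbers this works because \<open>v $ 0\<close> is real: the squared length of w is then exactly
  twice its coordinate \<open>w 0\<close>.\<close>

lemma householder:
  fixes v :: "complex vec"
  assumes v: "v \<in> carrier_vec (Suc n)" and norm: "(\<Sum>i<Suc n. (cmod (v $ i))\<^sup>2) = 1"
    and v0: "Im (v $ 0) = 0"
  shows "\<exists>U. unitary_mat (Suc n) U \<and> col U 0 = v"
proof -
  let ?d = "Suc n"
  define w where "w i = (if i = 0 then 1 else 0) - v $ i" for i
  define s where "s = (\<Sum>i<?d. w i * cnj (w i))"
  \<comment> \<open>If v is e_0 itself, then s = 0 and \<open>2 / 0 = 0\<close> makes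
    \<open>U\<close> the identity.\<close>
  define c where "c = 2 / s"
  have cs: "c * s * x = 2 * x \<or> s = 0" for x by (simp add: c_def)
  have s_real: "s = complex_of_real (\<Sum>i<?d. (cmod (w i))\<^sup>2)"
    unfolding s_def by (simp add: complex_norm_square del: of_real_power)
  have s_eq: "s = 2 * w 0"
  proof -
    have "s = (\<Sum>i<?d. (if i = 0 then 1 - v $ 0 - cnj (v $ 0) else 0) + complex_of_real ((cmod (v $ i))\<^sup>2))"
      unfolding s_def by (rule sum.cong)
        (auto simp: w_def complex_norm_square algebra_simps simp del: of_real_power)
    also have "\<dots> = 1 - v $ 0 - cnj (v $ 0) + complex_of_real (\<Sum>i<?d. (cmod (v $ i))\<^sup>2)"
      unfolding of_real_sum sum.distrib by (subst sum.delta) auto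
    also have "\<dots> = 2 * w 0" using v0 unfolding norm by (simp add: w_def complex_eq_iff)
    finally show ?thesis .
  qed
  have w0: "cnj (w 0) = w 0" using v0 by (simp add: w_def complex_eq_iff)
  define U where "U = mat ?d ?d (\<lambda>(i, j). (if i = j then 1 else 0) - c * w i * cnj (w j))"
  have U: "U \<in> carrier_mat ?d ?d" by (simp add: U_def)
  have c_real: "cnj c = c" by (simp add: c_def s_real)
  have adjU: "adj U = U"
    by (rule eq_matI) (auto simp: U_def c_real)
  have UU: "U * U = 1\<^sub>m ?d"
  proof (rule eq_matI)
    fix i j assume "i < dim_row (1\<^sub>m ?d)" "j < dim_col (1\<^sub>m ?d)"
    then have ij: "i < ?d" "j < ?d" by auto
    have "(U * U) $$ (i, j) = (\<Sum>k<?d. U $$ (i, k) * U $$ (k, j))"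
      using U ij by (simp add: index_mult_sum[where n = ?d and m = ?d and k = ?d] del: sum.lessThan_Suc)
    also have "\<dots> = (\<Sum>k<?d. (if k = i then (if i = j then 1 else 0) - c * w i * cnj (w j) else 0)
        + (if k = j then - c * w i * cnj (w j) else 0) + c * c * w i * cnj (w j) * (w k * cnj (w k)))"
      using ij by (intro sum.cong) (auto simp: U_def algebra_simps)
    also have "\<dots> = (if i = j then 1 else 0) - 2 * c * w i * cnj (w j) + c * c * s * w i * cnj (w j)"
      using ij unfolding sum.distrib s_def sum_distrib_left[symmetric]
      by (simp add: algebra_simps del: sum.lessThan_Suc)
    also have "c * c * s * w i * cnj (w j) = 2 * c * w i * cnj (w j)"
      by (simp add: c_def)
    finally show "(U * U) $$ (i, j) = 1\<^sub>m ?d $$ (i, j)" using ij by simp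
  qed (use U in auto)
  have "col U 0 = v"
  proof (rule eq_vecI)
    fix i assume "i < dim_vec v"
    then have i: "i < ?d" using v by simp
    have "c * w i * w 0 = w i"
    proof (cases "s = 0")
      case True
      then have "(\<Sum>i<?d. (cmod (w i))\<^sup>2) = 0" unfolding s_real by (simp only: of_real_eq_0_iff)
      then have "(cmod (w i))\<^sup>2 = 0"
        using i by (subst (asm) sum_nonneg_eq_0_iff) auto
      then show ?thesis by simp
    next
      case False
      then show ?thesis using s_eq by (simp add: c_def)
    qed
    then have "U $$ (i, 0) = (if i = 0 then 1 else 0) - w i"
      using i by (simp add: U_def w0)
    then show "col U 0 $ i = v $ i"
      using i U by (simp add: w_def)
  qed (use U v in auto)
  with U adjU UU show ?thesis unfolding unitary_mat_def by metis
qed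

text \<open>Besides normalising, the eigenvector is multiplied by a phase that makes its first
  coordinate real, as the Householder reflection requires.\<close>

lemma unit_eigenvector:
  assumes A: "A \<in> carrier_mat (Suc n) (Suc n)"
  obtains v :: "complex vec" and k where "v \<in> carrier_vec (Suc n)" "(\<Sum>i<Suc n. (cmod (v $ i))\<^sup>2) = 1"
    "Im (v $ 0) = 0" "A *\<^sub>v v = k \<cdot>\<^sub>v v"
proof -
  obtain k where "k \<in> spectrum A" using spectrum_non_empty[OF A] by auto
  then obtain x where x: "x \<in> carrier_vec (Suc n)" "x \<noteq> 0\<^sub>v (Suc n)" "A *\<^sub>v x = k \<cdot>\<^sub>v x"
    using A by (auto simp: spectrum_def eigenvalue_def eigenvector_def)
  define N where "N = (\<Sum>i<Suc n. (cmod (x $ i))\<^sup>2)"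
  have "N > 0"
  proof -
    obtain i where i: "i < Suc n" "x $ i \<noteq> 0" using x(1,2) by (metis carrier_vecD eq_vecI index_zero_vec(1) index_zero_vec(2))
    have "0 < (cmod (x $ i))\<^sup>2" using i by simp
    also have "\<dots> \<le> N" unfolding N_def using i by (intro member_le_sum) auto
    finally show ?thesis .
  qed
  define g where "g = (if x $ 0 = 0 then 1 else cnj (x $ 0) / complex_of_real (cmod (x $ 0)))"
  have g: "cmod g = 1" by (simp add: g_def norm_divide)
  define c where "c = g / complex_of_real (sqrt N)"
  show ?thesis
  proof (rule that[of "c \<cdot>\<^sub>v x" k])
    show "c \<cdot>\<^sub>v x \<in> carrier_vec (Suc n)" using x by simp
    have "(\<Sum>i<Suc n. (cmod ((c \<cdot>\<^sub>v x) $ i))\<^sup>2) = (\<Sum>i<Suc n. (cmod (x $ i))\<^sup>2 / N)"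
      using x(1) g \<open>N > 0\<close>
      by (intro sum.cong) (auto simp: c_def norm_mult norm_divide power_mult_distrib power_divide)
    also have "\<dots> = 1" using \<open>N > 0\<close> unfolding N_def sum_divide_distrib[symmetric] by simp
    finally show "(\<Sum>i<Suc n. (cmod ((c \<cdot>\<^sub>v x) $ i))\<^sup>2) = 1" .
    have "g * x $ 0 = complex_of_real (cmod (x $ 0))"
      by (auto simp: g_def complex_norm_square[symmetric] power2_eq_square mult.commute)
    then have "(c \<cdot>\<^sub>v x) $ 0 = complex_of_real (cmod (x $ 0) / sqrt N)"
      using x(1) by (simp add: c_def)
    then show "Im ((c \<cdot>\<^sub>v x) $ 0) = 0" by simp
    show "A *\<^sub>v (c \<cdot>\<^sub>v x) = k \<cdot>\<^sub>v (c \<cdot>\<^sub>v x)"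
      using x A by (simp add: mult_mat_vec smult_smult_assoc mult.commute)
  qed
qed

text \<open>Deflation: in a basis that starts with a unit eigenvector the first column is cleared,
  self-adjointness clears the first row and makes the eigenvalue real, and the remaining block is
  self-adjoint and smaller.\<close>

theorem spectral_theorem:
  assumes "A \<in> carrier_mat n n" "adj A = A"
  shows "\<exists>U l. unitary_mat n U \<and> A = spec_mat n U l"
  using assms
proof (induction n arbitrary: A)
  case 0
  interpret sqmat 0 .
  have "A = spec_mat 0 (1\<^sub>m 0) (\<lambda>_. 0)"
    using 0 by (intro eq_matI) (auto simp: spec_mat_def)
  with unitary_one show ?case by blast
next
  case (Suc n)
  interpret sqmat "Suc n" .
  interpret n: sqmat n .
  obtain v k where v: "v \<in> carrier_vec (Suc n)" "(\<Sum>i<Suc n. (cmod (v $ i))\<^sup>2) = 1"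
    "Im (v $ 0) = 0" "A *\<^sub>v v = k \<cdot>\<^sub>v v"
    using unit_eigenvector[OF Suc.prems(1)] .
  obtain U where U: "unitary_mat (Suc n) U" "col U 0 = v"
    using householder[OF v(1-3)] by blast
  note U' = unitaryD[OF U(1)]
  define B where "B = adj U * A * U"
  have B: "B \<in> M" "adj B = B"
    using U' Suc.prems by (simp_all add: B_def sq_adj sq_assoc)
  have A_eq: "A = U * B * adj U"
    using U' Suc.prems by (simp add: B_def sq_assoc unitary_cancel[OF U(1)] sq_one)
  have col0: "B $$ (i, 0) = (if i = 0 then k else 0)" if "i < Suc n" for i
  proof -
    have "col (A * U) 0 = k \<cdot>\<^sub>v col U 0"
      by (subst col_mult2[OF Suc.prems(1) U'(1)]) (use U(2) v(4) in auto)
    then have AU: "(A * U) $$ (j, 0) = k * U $$ (j, 0)" if "j < Suc n" for j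
      using that U' Suc.prems(1) arg_cong[of _ _ "\<lambda>x. x $ j"]
      by (metis carrier_matD col_def dim_col index_col index_smult_vec(1) sq_closed(1) zero_less_Suc)
    have "B $$ (i, 0) = (\<Sum>j<Suc n. adj U $$ (i, j) * (A * U) $$ (j, 0))"
      unfolding B_def using U' Suc.prems that
      by (simp add: sq_assoc index_mult_sum[where n = "Suc n" and m = "Suc n" and k = "Suc n"] del: sum.lessThan_Suc)
    also have "\<dots> = k * (\<Sum>j<Suc n. adj U $$ (i, j) * U $$ (j, 0))"
      unfolding sum_distrib_left by (rule sum.cong) (auto simp: AU)
    also have "\<dots> = k * (adj U * U) $$ (i, 0)"
      using U' that by (subst index_mult_sum[where n = "Suc n" and m = "Suc n" and k = "Suc n"]) auto
    finally show ?thesis using U' that by simp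
  qed
  have B_cnj: "B $$ (i, j) = cnj (B $$ (j, i))" if "i < Suc n" "j < Suc n" for i j
    using that B adj_index[of i B j] by (metis carrier_matD)
  have row0: "B $$ (0, j) = (if j = 0 then k else 0)" if "j < Suc n" for j
    using B_cnj[of 0 j] col0[OF that] B_cnj[of 0 0] col0[of 0] that by auto
  have k: "k = complex_of_real (Re k)"
    using B_cnj[of 0 0] col0[of 0] by (simp add: complex_eq_iff)
  define B' where "B' = mat n n (\<lambda>(i, j). B $$ (Suc i, Suc j))"
  have B': "B' \<in> carrier_mat n n" "adj B' = B'"
    unfolding B'_def by (simp, intro eq_matI) (auto intro: B_cnj[symmetric])
  from Suc.IH[OF B'] obtain V l where V: "unitary_mat n V" "B' = spec_mat n V l" by blast
  note V' = n.unitaryD[OF V(1)]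
  \<comment> \<open>Bordered matrices \<open>b x X\<close> multiply and take adjoints blockwise, so
    the unitary diagonalising the smaller block extends by a leading 1.\<close>
  define b where "b x X = four_block_mat (mat 1 1 (\<lambda>_. x)) (0\<^sub>m 1 n) (0\<^sub>m n 1) X"
    for x :: complex and X
  have b_mult: "b x X * b y Y = b (x * y) (X * Y)"
    if "X \<in> carrier_mat n n" "Y \<in> carrier_mat n n" for x y X Y
  proof -
    have "mat 1 1 (\<lambda>_. x) * mat 1 1 (\<lambda>_. y) = mat 1 1 (\<lambda>_. x * y)"
      by (rule eq_matI) (auto simp: index_mult_mat(1) scalar_prod_def)
    then show ?thesis
      using that unfolding b_def by (subst mult_four_block_mat[of _ 1 1 _ n _ n _ _ 1 _ n]) auto
  qed
  have b_one: "b 1 (1\<^sub>m n) = 1\<^sub>m (Suc n)"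
    unfolding b_def by (rule eq_matI) auto
  have b_carr: "b x X \<in> M" if "X \<in> carrier_mat n n" for x X
    using that by (auto simp: b_def)
  have b_adj: "adj (b x X) = b (cnj x) (adj X)" if "X \<in> carrier_mat n n" for x X
    using that unfolding b_def by (intro eq_matI) auto
  define W where "W = b 1 V"
  have W: "unitary_mat (Suc n) W"
    using V' by (auto simp: unitary_mat_def W_def b_adj b_mult b_one intro!: b_carr)
  have "rdiag (Suc n) (case_nat (Re k) l) = b k (rdiag n l)"
    using k unfolding b_def by (intro eq_matI) (auto simp: rdiag_index split: nat.split)
  then have "spec W (case_nat (Re k) l) = b k B'"
    using V' unfolding spec_mat_def V(2) W_def by (simp add: b_adj b_mult)
  also have "\<dots> = B"
    using B(1) by (intro eq_matI) (auto simp: b_def B'_def row0 col0)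
  finally have "A = spec (U * W) (case_nat (Re k) l)"
    using A_eq by (metis spec_conj[OF unitaryD(1)[OF W] U'(1)])
  with unitary_mult[OF U(1) W] show ?case by blast
qed

context sqmat
begin

lemma psd_spec_ex: assumes "psd A"
  shows "\<exists>U l. unitary U \<and> A = spec U l \<and> (\<forall>i<d. 0 \<le> l i)"
proof -
  obtain U l where "unitary U" "A = spec U l"
    using spectral_theorem psdD[OF assms] by blast
  then show ?thesis using spec_psd_nonneg assms by blast
qed

text \<open>In the eigenbasis of \<open>A\<close> the trace is a sum of nonnegative eigenvalues
  times diagonal entries of a conjugate of \<open>B\<close>.\<close>

lemma psd_trace_mult: assumes "psd A" "psd B" shows "0 \<le> Re (mtrace (A * B))"
proof -
  obtain U l where U: "unitary U" "A = spec U l" "\<forall>i<d. 0 \<le> l i"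
    using psd_spec_ex[OF assms(1)] by blast
  note P = psd_adj_conj[OF assms(2) unitaryD(1)[OF U(1)]]
  show ?thesis
    unfolding U(2) mtrace_spec_mult[OF unitaryD(1)[OF U(1)] psdD(1)[OF assms(2)]] Re_sum
  proof (intro sum_nonneg)
    fix i assume "i \<in> {..<d}"
    then have "0 \<le> l i * Re ((adj U * B * U) $$ (i, i))"
      using U(3) psd_diag(1)[OF P] by simp
    then show "0 \<le> Re (complex_of_real (l i) * (adj U * B * U) $$ (i, i))" by simp
  qed
qed

text \<open>Zero eigenvalues cause no exception because \<open>0 powr x = 0\<close> for all x. The
  exponent 0 therefore yields the support projection, not the identity.\<close>

lemma spec_powr_mult: assumes "unitary U"
  shows "spec U (\<lambda>i. l i powr x) * spec U (\<lambda>i. l i powr y) = spec U (\<lambda>i. l i powr (x + y))"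
  using assms by (simp add: spec_mult powr_add)

lemma unitary_row_nonzero: assumes "unitary X" "i < d" shows "\<exists>k<d. X $$ (i, k) \<noteq> 0"
proof (rule ccontr)
  assume "\<not> ?thesis"
  then have "(X * adj X) $$ (i, i) = 0"
    using unitaryD[OF assms(1)] assms(2) by (subst index_mult_sum[where n = d and m = d and k = d]) auto
  then show False using unitaryD[OF assms(1)] assms(2) by simp
qed

lemma spec_diag: assumes "X \<in> M" "i < d"
  shows "spec X l $$ (i, i) = complex_of_real (\<Sum>k<d. l k * (cmod (X $$ (i, k)))\<^sup>2)"
  using assms by (simp add: spec_index complex_norm_square[symmetric] del: of_real_power)

lemma spec_diag_pos: assumes "unitary X" "i < d" "\<And>k. k < d \<Longrightarrow> 0 < l k"
  shows "0 < Re (spec X l $$ (i, i))"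
proof -
  obtain k where k: "k < d" "X $$ (i, k) \<noteq> 0" using unitary_row_nonzero[OF assms(1,2)] by blast
  have "0 < l k * (cmod (X $$ (i, k)))\<^sup>2" using k assms(3) by simp
  also have "\<dots> \<le> (\<Sum>k<d. l k * (cmod (X $$ (i, k)))\<^sup>2)"
    using k assms(3) by (intro member_le_sum) (auto simp: less_imp_le)
  finally show ?thesis using unitaryD[OF assms(1)] assms(2) by (simp add: spec_diag)
qed

section \<open>Operator monotonicity of powers\<close>

text \<open>
  Expanding \<open>Z\<^sup>* Z \<ge> 0\<close> for \<open>Z = A\<^sup>a B\<^sup>r - A\<^sup>b\<close> gives \<open>B\<^sup>r A\<^sup>u + A\<^sup>u B\<^sup>r \<le> 2 B\<^sup>2\<^sup>b\<close> with \<open>r = b - a\<close> and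
  \<open>u = a + b\<close>. If \<open>\<kappa>\<close> is an eigenvalue of \<open>B\<^sup>-\<^sup>u\<^sup>/\<^sup>2 A\<^sup>u B\<^sup>-\<^sup>u\<^sup>/\<^sup>2\<close>, the corresponding diagonal entry of this
  inequality reads \<open>2 \<kappa> x \<le> 2 x\<close> with \<open>x > 0\<close>.\<close>

lemma loewner_heinz_midpoint:
  assumes U: "unitary U" and V: "unitary V"
    and m: "\<And>i. i < d \<Longrightarrow> 0 < m i" and ab: "a \<le> b"
    and ha: "psd (spec V (\<lambda>i. m i powr (a + a)) - spec U (\<lambda>i. l i powr (a + a)))"
    and hb: "psd (spec V (\<lambda>i. m i powr (b + b)) - spec U (\<lambda>i. l i powr (b + b)))"
  shows "psd (spec V (\<lambda>i. m i powr (a + b)) - spec U (\<lambda>i. l i powr (a + b)))"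
proof -
  define A where "A x = spec U (\<lambda>i. l i powr x)" for x
  define B where "B x = spec V (\<lambda>i. m i powr x)" for x
  have cA[simp]: "A x \<in> M" and cB[simp]: "B x \<in> M" for x
    using unitaryD[OF U] unitaryD[OF V] by (simp_all add: A_def B_def)
  have aA[simp]: "adj (A x) = A x" and aB[simp]: "adj (B x) = B x" for x
    using unitaryD[OF U] unitaryD[OF V] by (simp_all add: A_def B_def spec_adj)
  have AA: "A x * A y = A (x + y)" and BB: "B x * B y = B (x + y)" for x y
    using U V by (simp_all add: A_def B_def spec_powr_mult)
  have AA': "A x * (A y * C) = A (x + y) * C" if "C \<in> M" for x y C
    using that by (simp add: AA flip: sq_assoc)
  have BB': "B x * (B y * C) = B (x + y) * C" if "C \<in> M" for x y C
    using that by (simp add: BB flip: sq_assoc)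
  \<comment> \<open>Strict positivity of \<open>m\<close> is what makes the zeroth power the
    identity, so that \<open>B (- h)\<close> inverts \<open>B h\<close>.\<close>
  have B0: "B 0 = 1\<^sub>m d"
    using spec_mat_cong[of d "\<lambda>i. m i powr 0" "\<lambda>_. 1" V] m spec_one[OF V] by (force simp: B_def)
  define r where "r = b - a"
  define D where "D = (B (b + b) + B (b + b)) - (B r * A (a + b) + A (a + b) * B r)"
  have D: "D \<in> M" by (simp add: D_def)
  have "psd D"
  proof -
    define Z where "Z = A a * B r - A b"
    have 1: "psd (adj Z * Z)" by (rule psd_gram) (simp add: Z_def)
    have 2: "psd (B r * (B (a + a) - A (a + a)) * adj (B r))"
      by (rule psd_conj) (use ha in \<open>simp_all add: A_def[symmetric] B_def[symmetric]\<close>)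
    have 3: "psd (B (b + b) - A (b + b))" using hb by (simp add: A_def B_def)
    have e1: "adj Z * Z = (B r * (A (a + a) * B r) - A (a + b) * B r) - (B r * A (a + b) - A (b + b))"
      by (simp add: Z_def adj_minus[where n = d and m = d] sq_adj sq_distrib sq_assoc AA AA' add.commute)
    have e2: "B r * (B (a + a) - A (a + a)) * adj (B r) = B (b + b) - B r * (A (a + a) * B r)"
      by (simp add: sq_distrib sq_assoc BB BB') (simp add: r_def)
    \<comment> \<open>The three positive pieces are chosen so that the unwanted terms
      \<open>B r * (A (a + a) * B r)\<close> and \<open>A (b + b)\<close> cancel; this is where both
      endpoint hypotheses enter.\<close>
    have "D = (adj Z * Z + B r * (B (a + a) - A (a + a)) * adj (B r)) + (B (b + b) - A (b + b))"
      unfolding e1 e2 D_def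
      by (rule eq_matI) (simp_all add: carrier_matD[OF cA] carrier_matD[OF cB])
    with psd_add[OF psd_add[OF 1 2] 3] show ?thesis by simp
  qed
  define h where "h = (a + b) / 2"
  define N where "N = B (- h) * A (a + b) * B (- h)"
  have N: "N \<in> M" "adj N = N" by (simp_all add: N_def sq_adj sq_assoc)
  obtain W \<kappa> where W: "unitary W" "N = spec W \<kappa>" using spectral_theorem[OF N] by blast
  note W' = unitaryD[OF W(1)]
  define K where "K = adj W * B r * W"
  have K_eq: "K = spec (adj W * V) (\<lambda>i. m i powr r)"
    unfolding K_def B_def using W' unitaryD[OF V] by (simp add: adj_spec_conj)
  have K: "K \<in> M" "adj K = K" using W' by (simp_all add: K_def sq_adj sq_assoc)
  have NW: "N * W = W * rdiag d \<kappa>"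
    unfolding W(2) spec_mat_def using W' by (simp add: sq_assoc sq_one)
  \<comment> \<open>Since 2 b - 2 h = r, conjugation by \<open>G\<close> turns every term of
    \<open>D\<close> into \<open>K\<close>, with or without a factor
    \<open>rdiag d \<kappa>\<close>.\<close>
  define G where "G = B (- h) * W"
  have G: "G \<in> M" "adj G = adj W * B (- h)" using W' by (simp_all add: G_def sq_adj)
  have g1: "adj G * B (b + b) * G = K"
  proof -
    have "- h + (b + b) + - h = r" by (simp add: h_def r_def field_simps)
    moreover have "adj G * B (b + b) * G = adj W * (B (- h + (b + b) + - h) * W)"
      unfolding G(2) unfolding G_def using W' by (simp add: sq_assoc BB')
    ultimately show ?thesis using W' by (simp add: K_def sq_assoc)
  qed
  have g2: "adj G * (B r * A (a + b)) * G = K * rdiag d \<kappa>"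
  proof -
    have "adj G * (B r * A (a + b)) * G = adj W * (B r * (B (- h) * A (a + b) * B (- h) * W))"
      unfolding G(2) unfolding G_def using W' by (simp add: sq_assoc BB' add.commute)
    also have "\<dots> = adj W * (B r * (W * rdiag d \<kappa>))"
      unfolding N_def[symmetric] NW ..
    finally show ?thesis using W' by (simp add: K_def sq_assoc)
  qed
  have g3: "adj G * (A (a + b) * B r) * G = rdiag d \<kappa> * K"
  proof -
    have "adj G * (A (a + b) * B r) * G = adj (adj G * (B r * A (a + b)) * G)"
      using G(1) by (simp add: sq_adj sq_assoc)
    then show ?thesis unfolding g2 using K by (simp add: sq_adj)
  qed
  have GDG: "adj G * D * G = (K + K) - (K * rdiag d \<kappa> + rdiag d \<kappa> * K)"
  proof -
    have "adj G * D * G = (adj G * B (b + b) * G + adj G * B (b + b) * G) -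
        (adj G * (B r * A (a + b)) * G + adj G * (A (a + b) * B r) * G)"
      using G(1) unfolding D_def by (simp add: sq_distrib sq_assoc)
    then show ?thesis unfolding g1 g2 g3 .
  qed
  have \<kappa>: "\<kappa> i \<le> 1" if i: "i < d" for i
  proof -
    have "0 \<le> Re ((adj G * D * G) $$ (i, i))"
      using psd_diag[OF psd_adj_conj[OF \<open>psd D\<close> G(1)] i] by simp
    also have "(adj G * D * G) $$ (i, i) = 2 * K $$ (i, i) - 2 * complex_of_real (\<kappa> i) * K $$ (i, i)"
      unfolding GDG using K(1) i
      by (simp add: index_mult_rdiag[where n = d] index_rdiag_mult[where n = d] carrier_matD[OF K(1)])
    finally have "\<kappa> i * Re (K $$ (i, i)) \<le> 1 * Re (K $$ (i, i))" by simp
    moreover have "0 < Re (K $$ (i, i))"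
      unfolding K_eq using m i by (intro spec_diag_pos unitary_mult unitary_adj W V) force+
    ultimately show ?thesis by (metis mult_le_cancel_right_pos)
  qed
  have "psd (1\<^sub>m d - N)"
    unfolding W(2) spec_one[OF W(1), symmetric] using W' \<kappa> by (simp add: spec_minus psd_spec)
  then have "psd (B h * (1\<^sub>m d - N) * adj (B h))" by (rule psd_conj) simp
  also have "B h * (1\<^sub>m d - N) * adj (B h) = B (a + b) - A (a + b)"
    by (simp add: N_def sq_distrib sq_assoc sq_one BB BB' B0) (simp add: h_def add_divide_distrib)
  finally show ?thesis by (simp add: A_def B_def)
qed

text \<open>An odd numerator at level k + 1 is the midpoint of two neighbouring exponents of level
  k, and an even one already occurs there. The induction thus reaches all dyadic exponents from 0
  and 1.\<close>

lemma loewner_heinz_dyadic: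
  assumes U: "unitary U" and V: "unitary V"
    and l: "\<And>i. i < d \<Longrightarrow> 0 \<le> l i" and m: "\<And>i. i < d \<Longrightarrow> 0 < m i"
    and h: "psd (spec V m - spec U l)" and "j \<le> 2 ^ k"
  shows "psd (spec V (\<lambda>i. m i powr (real j / 2 ^ k)) - spec U (\<lambda>i. l i powr (real j / 2 ^ k)))"
  using \<open>j \<le> 2 ^ k\<close>
proof (induction k arbitrary: j)
  case 0
  then consider "j = 0" | "j = 1" by force
  then show ?case
  proof cases
    case 1
    \<comment> \<open>At exponent 0 the \<open>V\<close> side is the identity while the
      \<open>U\<close> side is only a support projection; the difference is still positive.\<close>
    have "spec V (\<lambda>i. m i powr (real j / 2 ^ 0)) = spec U (\<lambda>_. 1)"
      using spec_mat_cong[of d "\<lambda>i. m i powr (real j / 2 ^ 0)" "\<lambda>_. 1" V] m 1 spec_one[OF V] spec_one[OF U]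
      by force
    then show ?thesis using unitaryD[OF U] 1 by (simp add: spec_minus psd_spec)
  next
    case 2
    have "spec V (\<lambda>i. m i powr (real j / 2 ^ 0)) = spec V m"
      using m 2 by (intro spec_mat_cong) (auto simp: powr_one less_imp_le)
    moreover have "spec U (\<lambda>i. l i powr (real j / 2 ^ 0)) = spec U l"
      using l 2 by (intro spec_mat_cong) (auto simp: powr_one)
    ultimately show ?thesis using h by simp
  qed
next
  case (Suc k)
  show ?case
  proof (cases "even j")
    case True
    then obtain i where i: "j = 2 * i" by blast
    then show ?thesis using Suc.IH[of i] Suc.prems by simp
  next
    case False
    then obtain i where i: "j = 2 * i + 1" by (auto elim: oddE)
    define a where "a = real i / 2 ^ k / 2"
    define b where "b = real (Suc i) / 2 ^ k / 2"
    have *: "a + a = real i / 2 ^ k" "b + b = real (Suc i) / 2 ^ k" "a + b = real j / 2 ^ Suc k" "a \<le> b"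
      by (simp_all add: a_def b_def i field_simps)
    have "psd (spec V (\<lambda>x. m x powr (a + b)) - spec U (\<lambda>x. l x powr (a + b)))"
      by (rule loewner_heinz_midpoint[OF U V m]) (use Suc.IH[of i] Suc.IH[of "Suc i"] Suc.prems i * in auto)
    then show ?thesis by (simp only: *)
  qed
qed

section \<open>Audenaert's trace inequality\<close>

text \<open>With A, B <= C, monotonicity of powers gives Tr A <= Tr A^s C^(1-s) and Tr B <= Tr C^s
  B^(1-s). Expanding 0 <= Tr (C^s - A^s) (C^(1-s) - B^(1-s)) bounds the sum of these two right-hand
  sides by Tr C + Tr A^s B^(1-s).\<close>

lemma ozawa_dyadic:
  assumes U: "unitary U" and V: "unitary V" and Y: "unitary Y"
    and l: "\<And>i. i < d \<Longrightarrow> 0 \<le> l i" and m: "\<And>i. i < d \<Longrightarrow> 0 \<le> m i" and c: "\<And>i. i < d \<Longrightarrow> 0 < c i"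
    and CA: "psd (spec Y c - spec U l)" and CB: "psd (spec Y c - spec V m)" and j: "j \<le> 2 ^ k"
  defines "s \<equiv> real j / 2 ^ k"
  shows "Re (mtrace (spec U l)) + Re (mtrace (spec V m)) \<le> Re (mtrace (spec Y c)) +
    Re (mtrace (spec U (\<lambda>i. l i powr s) * spec V (\<lambda>i. m i powr (1 - s))))"
proof -
  define A where "A x = spec U (\<lambda>i. l i powr x)" for x
  define B where "B x = spec V (\<lambda>i. m i powr x)" for x
  define C where "C x = spec Y (\<lambda>i. c i powr x)" for x
  note U' = unitaryD[OF U] and V' = unitaryD[OF V] and Y' = unitaryD[OF Y]
  have [simp]: "A x \<in> M" "B x \<in> M" "C x \<in> M" for x
    using U' V' Y' by (simp_all add: A_def B_def C_def)
  have s': "1 - s = real (2 ^ k - j) / 2 ^ k" using j by (simp add: s_def of_nat_diff field_simps)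
  have CAs: "psd (C s - A s)" "psd (C (1 - s) - A (1 - s))"
    unfolding A_def C_def s' unfolding s_def
    by (intro loewner_heinz_dyadic U Y l c CA j diff_le_self; assumption)+
  have CBs: "psd (C s - B s)" "psd (C (1 - s) - B (1 - s))"
    unfolding B_def C_def s' unfolding s_def
    by (intro loewner_heinz_dyadic V Y m c CB j diff_le_self; assumption)+
  have pA: "psd (A x)" and pB: "psd (B x)" for x
    using U' V' by (simp_all add: A_def B_def psd_spec)
  have one: "A s * A (1 - s) = spec U l" "B s * B (1 - s) = spec V m" "C s * C (1 - s) = spec Y c"
    using l m c unfolding A_def B_def C_def
    by (simp_all add: spec_powr_mult U V Y) (intro spec_mat_cong; force simp: less_imp_le)+
  have "0 \<le> Re (mtrace (A s * (C (1 - s) - A (1 - s))))"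
    by (rule psd_trace_mult[OF pA CAs(2)])
  then have 1: "Re (mtrace (spec U l)) \<le> Re (mtrace (A s * C (1 - s)))"
    using U'(1) V'(1) Y'(1) by (simp add: sq_distrib mtrace_minus one)
  have "0 \<le> Re (mtrace ((C s - B s) * B (1 - s)))"
    by (rule psd_trace_mult[OF CBs(1) pB])
  then have 2: "Re (mtrace (spec V m)) \<le> Re (mtrace (C s * B (1 - s)))"
    using U'(1) V'(1) Y'(1) by (simp add: sq_distrib mtrace_minus one)
  have "0 \<le> Re (mtrace ((C s - A s) * (C (1 - s) - B (1 - s))))"
    by (rule psd_trace_mult[OF CAs(1) CBs(2)])
  then have 3: "Re (mtrace (C s * B (1 - s))) + Re (mtrace (A s * C (1 - s)))
      \<le> Re (mtrace (spec Y c)) + Re (mtrace (A s * B (1 - s)))"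
    using U'(1) V'(1) Y'(1) by (simp add: sq_distrib mtrace_minus one)
  show ?thesis using 1 2 3 by (simp add: A_def B_def)
qed

text \<open>The common upper bound C = B + (A - B)_+ has trace Tr B + Tr (A - B)_+, which turns
  Ozawa's inequality into the claim. A multiple \<epsilon> of the identity is added to make C
  strictly positive, and is removed at the end.\<close>

lemma helstrom_dyadic:
  assumes U: "unitary U" and V: "unitary V" and X: "unitary X"
    and l: "\<And>i. i < d \<Longrightarrow> 0 \<le> l i" and m: "\<And>i. i < d \<Longrightarrow> 0 \<le> m i"
    and AB: "spec U l - spec V m = spec X h" and j: "j \<le> 2 ^ k"
  defines "s \<equiv> real j / 2 ^ k"
  shows "Re (mtrace (spec U l)) - (\<Sum>i<d. max (h i) 0) \<le>
    Re (mtrace (spec U (\<lambda>i. l i powr s) * spec V (\<lambda>i. m i powr (1 - s))))"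
proof (rule field_le_epsilon)
  fix e :: real assume "0 < e"
  \<comment> \<open>Adding \<epsilon> to every eigenvalue changes the trace by \<epsilon> d, which
    has to stay below e; the denominator d + 1 also covers d = 0.\<close>
  define \<epsilon> where "\<epsilon> = e / (real d + 1)"
  have \<epsilon>: "0 < \<epsilon>" "\<epsilon> * real d \<le> e" using \<open>0 < e\<close> by (auto simp: \<epsilon>_def field_simps)
  note U' = unitaryD[OF U] and V' = unitaryD[OF V] and X' = unitaryD[OF X]
  define g where "g i = max (h i) 0 + \<epsilon>" for i
  define C where "C = spec V m + spec X g"
  have "psd C" unfolding C_def using \<epsilon> V' X' m by (intro psd_add psd_spec) (auto simp: g_def)
  then obtain Y c where Y: "unitary Y" "C = spec Y c" using psd_spec_ex by blast
  note Y' = unitaryD[OF Y(1)]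
  have CB: "C - spec V m = spec X g"
    unfolding C_def using carrier_matD[OF spec_carrier[OF V'(1), of m]] carrier_matD[OF spec_carrier[OF X'(1), of g]]
    by (intro eq_matI) simp_all
  have "C - spec U l = spec X g - (spec U l - spec V m)"
    unfolding C_def using carrier_matD[OF spec_carrier[OF V'(1), of m]] carrier_matD[OF spec_carrier[OF X'(1), of g]]
      carrier_matD[OF spec_carrier[OF U'(1), of l]]
    by (intro eq_matI) simp_all
  then have CA: "C - spec U l = spec X (\<lambda>i. g i - h i)"
    unfolding AB using X' by (simp add: spec_minus)
  \<comment> \<open>Subtracting \<epsilon> from C leaves a positive semidefinite operator, and
    \<epsilon> times the identity is diagonal in the basis of \<open>Y\<close> as well as in that of
    \<open>X\<close>.\<close>
  have c: "0 < c i" if "i < d" for i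
  proof -
    have "spec Y (\<lambda>i. c i - \<epsilon>) = C - spec X (\<lambda>_. \<epsilon>)"
    proof -
      have "spec X (\<lambda>_. \<epsilon>) = complex_of_real \<epsilon> \<cdot>\<^sub>m spec X (\<lambda>_. 1)" using X' by (simp add: spec_smult)
      also have "\<dots> = spec Y (\<lambda>_. \<epsilon>)" using Y' unfolding spec_one[OF X] spec_one[OF Y(1), symmetric] by (simp add: spec_smult)
      finally show ?thesis using Y' by (simp add: Y(2) spec_minus)
    qed
    also have "\<dots> = spec V m + spec X (\<lambda>i. g i - \<epsilon>)"
      unfolding C_def spec_minus[OF X'(1), symmetric]
      using carrier_matD[OF spec_carrier[OF V'(1), of m]] carrier_matD[OF spec_carrier[OF X'(1)]]
      by (intro eq_matI) simp_all
    also have "psd \<dots>" using V' X' m by (intro psd_add psd_spec) (auto simp: g_def)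
    finally have "0 \<le> c i - \<epsilon>" using spec_psd_nonneg[OF Y(1)] that by blast
    then show ?thesis using \<epsilon> by simp
  qed
  have "psd (spec Y c - spec U l)" "psd (spec Y c - spec V m)"
    unfolding Y(2)[symmetric] CA CB using X' \<epsilon> by (auto intro!: psd_spec simp: g_def)
  from ozawa_dyadic[OF U V Y(1) l m c this j]
  have "Re (mtrace (spec U l)) + Re (mtrace (spec V m)) \<le> Re (mtrace C) +
    Re (mtrace (spec U (\<lambda>i. l i powr s) * spec V (\<lambda>i. m i powr (1 - s))))"
    by (simp add: s_def Y(2))
  moreover have "Re (mtrace C) = Re (mtrace (spec V m)) + (\<Sum>i<d. max (h i) 0) + \<epsilon> * real d"
    unfolding C_def using V' X' by (simp add: mtrace_add mtrace_spec[OF X] g_def sum.distrib mult.commute)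
  ultimately show "Re (mtrace (spec U l)) - (\<Sum>i<d. max (h i) 0) \<le>
    Re (mtrace (spec U (\<lambda>i. l i powr s) * spec V (\<lambda>i. m i powr (1 - s)))) + e"
    using \<epsilon> by linarith
qed

lemma dyadic_floor_limit:
  fixes s :: real assumes "0 \<le> s" "s \<le> 1"
  shows "nat \<lfloor>s * 2 ^ k\<rfloor> \<le> 2 ^ k" "(\<lambda>k. real (nat \<lfloor>s * 2 ^ k\<rfloor>) / 2 ^ k) \<longlonglongrightarrow> s"
proof -
  have "s * 2 ^ k \<le> real (2 ^ k)" using assms by (simp add: mult_left_le_one_le)
  then show "nat \<lfloor>s * 2 ^ k\<rfloor> \<le> 2 ^ k" by linarith
  show "(\<lambda>k. real (nat \<lfloor>s * 2 ^ k\<rfloor>) / 2 ^ k) \<longlonglongrightarrow> s"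
  proof (rule tendsto_sandwich[of "\<lambda>k. s - (1 / 2) ^ k" _ _ "\<lambda>_. s"])
    have *: "s * 2 ^ k - 1 \<le> real (nat \<lfloor>s * 2 ^ k\<rfloor>)" "real (nat \<lfloor>s * 2 ^ k\<rfloor>) \<le> s * 2 ^ k" for k
      using assms by (linarith, simp add: mult_nonneg_nonneg)
    show "\<forall>\<^sub>F k in sequentially. s - (1 / 2) ^ k \<le> real (nat \<lfloor>s * 2 ^ k\<rfloor>) / 2 ^ k"
    proof (intro always_eventually allI)
      fix k :: nat
      have "s - (1 / 2) ^ k = (s * 2 ^ k - 1) / 2 ^ k" by (simp add: field_simps power_one_over)
      also have "\<dots> \<le> real (nat \<lfloor>s * 2 ^ k\<rfloor>) / 2 ^ k" using *(1) by (intro divide_right_mono) auto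
      finally show "s - (1 / 2) ^ k \<le> real (nat \<lfloor>s * 2 ^ k\<rfloor>) / 2 ^ k" .
    qed
    show "\<forall>\<^sub>F k in sequentially. real (nat \<lfloor>s * 2 ^ k\<rfloor>) / 2 ^ k \<le> s"
      using *(2) by (intro always_eventually allI) (simp add: field_simps)
    have "(\<lambda>k. s - (1 / 2) ^ k) \<longlonglongrightarrow> s - 0"
      by (intro tendsto_intros LIMSEQ_realpow_zero) auto
    then show "(\<lambda>k. s - (1 / 2) ^ k) \<longlonglongrightarrow> s" by simp
  qed auto
qed

text \<open>The test is the spectral projection of A - B onto its positive part, with error Tr A -
  Tr (A - B)_+. Neither depends on s, so the bound for dyadic exponents passes to the limit.\<close>

theorem audenaert:
  assumes U: "unitary U" and V: "unitary V"
    and l: "\<And>i. i < d \<Longrightarrow> 0 \<le> l i" and m: "\<And>i. i < d \<Longrightarrow> 0 \<le> m i" and s: "0 < s" "s < 1"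
  shows "\<exists>T. test_op d T \<and>
    Re (mtrace (spec U l * (1\<^sub>m d - T))) + Re (mtrace (spec V m * T)) \<le>
    (\<Sum>i<d. \<Sum>j<d. l i powr s * m j powr (1 - s) * (cmod ((adj U * V) $$ (i, j)))\<^sup>2)"
proof -
  note U' = unitaryD[OF U] and V' = unitaryD[OF V]
  have "spec U l - spec V m \<in> M" "adj (spec U l - spec V m) = spec U l - spec V m"
    using U' V' by (simp_all add: adj_minus[where n = d and m = d] spec_adj)
  then obtain X h where X: "unitary X" "spec U l - spec V m = spec X h" using spectral_theorem by blast
  note X' = unitaryD[OF X(1)]
  define p where "p i = (if h i > 0 then 1 else 0 :: real)" for i
  define T where "T = spec X p"
  have T: "T \<in> M" using X' by (simp add: T_def)
  have "test_op d T"
    unfolding test_op_def T_def spec_one[OF X(1), symmetric] using X'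
    by (auto simp: spec_minus p_def intro!: psd_spec)
  have "mtrace (spec U l * (1\<^sub>m d - T)) + mtrace (spec V m * T) =
    mtrace (spec U l) - mtrace ((spec U l - spec V m) * T)"
    using T U' V' by (simp add: sq_distrib mtrace_minus sq_one)
  also have "(spec U l - spec V m) * T = spec X (\<lambda>i. max (h i) 0)"
    unfolding X(2) T_def spec_mult[OF X(1)] by (rule spec_mat_cong) (simp add: p_def)
  finally have err: "Re (mtrace (spec U l * (1\<^sub>m d - T))) + Re (mtrace (spec V m * T)) =
    Re (mtrace (spec U l)) - (\<Sum>i<d. max (h i) 0)"
    by (simp add: mtrace_spec[OF X(1)] complex_eq_iff)
  define f where "f s = (\<Sum>i<d. \<Sum>j<d. l i powr s * m j powr (1 - s) * (cmod ((adj U * V) $$ (i, j)))\<^sup>2)" for s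
  define r where "r k = real (nat \<lfloor>s * 2 ^ k\<rfloor>) / 2 ^ k" for k :: nat
  have "r \<longlonglongrightarrow> s" using dyadic_floor_limit(2)[of s] s unfolding r_def by simp
  then have lim: "(\<lambda>k. f (r k)) \<longlonglongrightarrow> f s"
  proof -
    \<comment> \<open>Continuity in the exponent holds at base 0 too, where the power is constantly
      0.\<close>
    have pw: "(\<lambda>k. x powr g k) \<longlonglongrightarrow> x powr y" if "g \<longlonglongrightarrow> y" for x y :: real and g
      using that by (cases "x = 0") (auto intro: tendsto_powr)
    show ?thesis unfolding f_def by (intro tendsto_intros pw \<open>r \<longlonglongrightarrow> s\<close>)
  qed
  have "Re (mtrace (spec U l)) - (\<Sum>i<d. max (h i) 0) \<le> f (r k)" for k
    using helstrom_dyadic[OF U V X(1) l m X(2) dyadic_floor_limit(1)[of s k]] s U' V'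
    by (simp add: mtrace_spec_spec f_def r_def)
  then have "Re (mtrace (spec U l)) - (\<Sum>i<d. max (h i) 0) \<le> f s"
    using lim by (intro LIMSEQ_le_const) auto
  with err \<open>test_op d T\<close> show ?thesis unfolding f_def by auto
qed

end

section \<open>A lower bound for classical product distributions\<close>

definition sum2 :: "nat \<Rightarrow> (nat \<Rightarrow> nat \<Rightarrow> real) \<Rightarrow> real" where
  "sum2 d f = (\<Sum>i<d. \<Sum>j<d. f i j)"

lemma sum2_cong: "(\<And>i j. i < d \<Longrightarrow> j < d \<Longrightarrow> f i j = g i j) \<Longrightarrow> sum2 d f = sum2 d g"
  by (simp add: sum2_def)

lemma sum2_zero[simp]: "sum2 d (\<lambda>i j. 0) = 0"
  by (simp add: sum2_def)

lemma sum2_add: "sum2 d (\<lambda>i j. f i j + g i j) = sum2 d f + sum2 d g"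
  by (simp add: sum2_def sum.distrib)

lemma sum2_diff: "sum2 d (\<lambda>i j. f i j - g i j) = sum2 d f - sum2 d g"
  by (simp add: sum2_def sum_subtractf)

lemma sum2_cmult: "sum2 d (\<lambda>i j. c * f i j) = c * sum2 d f"
  by (simp add: sum2_def sum_distrib_left)

lemma sum2_multc: "sum2 d (\<lambda>i j. f i j * c) = sum2 d f * c"
  by (simp add: sum2_def sum_distrib_right)

lemma sum2_divide: "sum2 d (\<lambda>i j. f i j / c) = sum2 d f / c"
  by (simp add: sum2_def sum_divide_distrib)

lemma sum2_mono: "(\<And>i j. i < d \<Longrightarrow> j < d \<Longrightarrow> f i j \<le> g i j) \<Longrightarrow> sum2 d f \<le> sum2 d g"
  unfolding sum2_def by (intro sum_mono) auto

lemma sum2_nonneg: "(\<And>i j. i < d \<Longrightarrow> j < d \<Longrightarrow> 0 \<le> f i j) \<Longrightarrow> 0 \<le> sum2 d f"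
  unfolding sum2_def by (intro sum_nonneg) auto

lemma sum2_ge_term: assumes "\<And>i j. i < d \<Longrightarrow> j < d \<Longrightarrow> 0 \<le> f i j" "i < d" "j < d"
  shows "f i j \<le> sum2 d f"
proof -
  have "f i j \<le> (\<Sum>j<d. f i j)" using assms by (intro member_le_sum) auto
  also have "\<dots> \<le> (\<Sum>i<d. \<Sum>j<d. f i j)"
    using assms by (intro member_le_sum[of i _ "\<lambda>i. \<Sum>j<d. f i j"] sum_nonneg) auto
  finally show ?thesis by (simp add: sum2_def)
qed

text \<open>Quotient and remainder form the index encoding of \<open>kron\<close>; this lemma turns
  sums over a tensor product into iterated sums.\<close>

lemma sum_div_mod: fixes f :: "nat \<Rightarrow> nat \<Rightarrow> 'a :: comm_monoid_add"
  shows "(\<Sum>k<a * b. f (k div b) (k mod b)) = (\<Sum>i<a. \<Sum>j<b. f i j)"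
proof -
  have "(\<Sum>i<a. \<Sum>j<b. f i j) = (\<Sum>(i, j)\<in>{..<a} \<times> {..<b}. f i j)"
    by (rule sum.cartesian_product)
  also have "\<dots> = (\<Sum>k<a * b. f (k div b) (k mod b))"
  proof (rule sum.reindex_bij_witness[where i = "\<lambda>k. (k div b, k mod b)" and j = "\<lambda>(i, j). i * b + j"])
    fix p assume "p \<in> {..<a} \<times> {..<b}"
    then obtain i j where p: "p = (i, j)" "i < a" "j < b" by auto
    have "i * b + j < Suc i * b" using p by simp
    also have "\<dots> \<le> a * b" using p by (intro mult_le_mono1) simp
    finally show "(case p of (i, j) \<Rightarrow> i * b + j) \<in> {..<a * b}" using p by simp
  next
    fix k assume "k \<in> {..<a * b}"
    then have "k < a * b" "0 < b" by (auto intro: Nat.gr0I)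
    then show "(k div b, k mod b) \<in> {..<a} \<times> {..<b}" by (auto simp: less_mult_imp_div_less)
  qed auto
  finally show ?thesis ..
qed

lemma sum2_div_mod:
  "sum2 (d * e) (\<lambda>i j. F (i div e) (j div e) (i mod e) (j mod e)) =
    sum2 d (\<lambda>a b. sum2 e (\<lambda>x y. F a b x y))"
proof -
  have "sum2 (d * e) (\<lambda>i j. F (i div e) (j div e) (i mod e) (j mod e)) =
    (\<Sum>i<d * e. \<Sum>b<d. \<Sum>y<e. F (i div e) b (i mod e) y)"
    unfolding sum2_def
  proof (rule sum.cong[OF refl])
    fix i
    show "(\<Sum>j<d * e. F (i div e) (j div e) (i mod e) (j mod e)) = (\<Sum>b<d. \<Sum>y<e. F (i div e) b (i mod e) y)"
      by (rule sum_div_mod)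
  qed
  also have "\<dots> = (\<Sum>a<d. \<Sum>x<e. \<Sum>b<d. \<Sum>y<e. F a b x y)"
    by (rule sum_div_mod)
  also have "\<dots> = sum2 d (\<lambda>a b. sum2 e (\<lambda>x y. F a b x y))"
    unfolding sum2_def by (rule sum.cong[OF refl], rule sum.swap)
  finally show ?thesis .
qed

text \<open>The n-fold product of \<open>f\<close> over the base-d digits of both indices, leading
  digit first, which is the order used by \<open>tensor_pow\<close>.\<close>

fun prodfun :: "nat \<Rightarrow> (nat \<Rightarrow> nat \<Rightarrow> real) \<Rightarrow> nat \<Rightarrow> nat \<Rightarrow> nat \<Rightarrow> real" where
  "prodfun d f 0 i j = 1"
| "prodfun d f (Suc n) i j = f (i div d ^ n) (j div d ^ n) * prodfun d f n (i mod d ^ n) (j mod d ^ n)"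

text \<open>The sum of n independent copies of \<open>g\<close> in the same digit encoding; below it
  is the log-likelihood ratio of n samples.\<close>

fun sumfun :: "nat \<Rightarrow> (nat \<Rightarrow> nat \<Rightarrow> real) \<Rightarrow> nat \<Rightarrow> nat \<Rightarrow> nat \<Rightarrow> real" where
  "sumfun d g 0 i j = 0"
| "sumfun d g (Suc n) i j = g (i div d ^ n) (j div d ^ n) + sumfun d g n (i mod d ^ n) (j mod d ^ n)"

lemma digit_less: "i < d ^ Suc n \<Longrightarrow> i div d ^ n < d" "i < d ^ Suc n \<Longrightarrow> i mod d ^ n < d ^ n" for d :: nat
  by (simp_all add: less_mult_imp_div_less) (metis less_nat_zero_code mod_less_divisor mult_0_right neq0_conv)

lemma prodfun_nonneg:
  "(\<And>i j. i < d \<Longrightarrow> j < d \<Longrightarrow> 0 \<le> f i j) \<Longrightarrow> i < d ^ n \<Longrightarrow> j < d ^ n \<Longrightarrow> 0 \<le> prodfun d f n i j"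
proof (induction n arbitrary: i j)
  case (Suc n)
  from Suc.IH[of "i mod d ^ n" "j mod d ^ n"] Suc.prems digit_less[of i d n] digit_less[of j d n]
  show ?case by simp
qed simp

lemma prodfun_cmult: "prodfun d (\<lambda>i j. c * f i j) n i j = c ^ n * prodfun d f n i j"
  by (induction n arbitrary: i j) auto

lemma prodfun_mult: "prodfun d (\<lambda>i j. f i j * g i j) n i j = prodfun d f n i j * prodfun d g n i j"
  by (induction n arbitrary: i j) auto

lemma prodfun_powr:
  "(\<And>i j. i < d \<Longrightarrow> j < d \<Longrightarrow> 0 \<le> f i j) \<Longrightarrow> i < d ^ n \<Longrightarrow> j < d ^ n \<Longrightarrow>
    prodfun d (\<lambda>i j. f i j powr s) n i j = prodfun d f n i j powr s"
proof (induction n arbitrary: i j)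
  case (Suc n)
  from Suc.IH[of "i mod d ^ n" "j mod d ^ n"] Suc.prems digit_less[of i d n] digit_less[of j d n]
  show ?case by (simp add: powr_mult prodfun_nonneg)
qed simp

lemma sum2_prodfun: "sum2 (d ^ n) (prodfun d f n) = sum2 d f ^ n"
proof (induction n)
  case 0
  show ?case by (simp add: sum2_def)
next
  case (Suc n)
  have "sum2 (d ^ Suc n) (prodfun d f (Suc n)) = sum2 d (\<lambda>a b. sum2 (d ^ n) (\<lambda>x y. f a b * prodfun d f n x y))"
    unfolding power_Suc sum2_div_mod[symmetric] by (rule sum2_cong) simp
  then show ?case using Suc by (simp add: sum2_cmult sum2_multc del: prodfun.simps)
qed

text \<open>Variances of independent centred variables add. Both moments go through one induction
  because the cross term of the square vanishes by the first.\<close>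

lemma sum2_moments:
  assumes t: "sum2 d t = 1" and mean: "sum2 d (\<lambda>i j. t i j * g i j) = 0"
  defines "v \<equiv> sum2 d (\<lambda>i j. t i j * (g i j)\<^sup>2)"
  shows "sum2 (d ^ n) (\<lambda>i j. prodfun d t n i j * sumfun d g n i j) = 0"
    and "sum2 (d ^ n) (\<lambda>i j. prodfun d t n i j * (sumfun d g n i j)\<^sup>2) = real n * v"
proof (induction n)
  case 0
  { case 1 show ?case by (simp add: sum2_def) }
  { case 2 show ?case by (simp add: sum2_def) }
next
  case (Suc n)
  let ?T = "prodfun d t n" and ?G = "sumfun d g n"
  have T: "sum2 (d ^ n) (\<lambda>x y. ?T x y) = 1" using sum2_prodfun[of d n t] t by simp
  { case 1
    have "sum2 (d ^ Suc n) (\<lambda>i j. prodfun d t (Suc n) i j * sumfun d g (Suc n) i j) =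
      sum2 d (\<lambda>a b. sum2 (d ^ n) (\<lambda>x y. (t a b * g a b) * ?T x y + t a b * (?T x y * ?G x y)))"
      unfolding power_Suc sum2_div_mod[symmetric] by (intro sum2_cong) (simp add: algebra_simps)
    then show ?case by (simp only: sum2_add sum2_cmult Suc.IH T) (simp add: mean) }
  { case 2
    have "sum2 (d ^ Suc n) (\<lambda>i j. prodfun d t (Suc n) i j * (sumfun d g (Suc n) i j)\<^sup>2) =
      sum2 d (\<lambda>a b. sum2 (d ^ n) (\<lambda>x y. (t a b * (g a b)\<^sup>2) * ?T x y +
        ((2 * (t a b * g a b)) * (?T x y * ?G x y) + t a b * (?T x y * (?G x y)\<^sup>2))))"
      unfolding power_Suc sum2_div_mod[symmetric] by (intro sum2_cong) (simp add: algebra_simps power2_eq_square)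
    then show ?case
      by (simp only: sum2_add sum2_cmult Suc.IH T) (simp add: v_def[symmetric] sum2_add sum2_multc t distrib_right) }
qed

lemma sumfun_diff_const: "sumfun d (\<lambda>i j. g i j - c) n i j = sumfun d g n i j - real n * c"
  by (induction n arbitrary: i j) (auto simp: algebra_simps)

text \<open>A Jensen-type bound: the absolute value of a centred sum with variance at most c^2 is
  typically at most c. A second moment suffices, so no limit theorem enters.\<close>

lemma sum2_exp_abs_lower:
  assumes t: "sum2 d t = 1" and pos: "\<And>i j. i < d \<Longrightarrow> j < d \<Longrightarrow> 0 \<le> t i j"
    and mean: "sum2 d (\<lambda>i j. t i j * g i j) = 0"
    and c: "0 < c" "real n * sum2 d (\<lambda>i j. t i j * (g i j)\<^sup>2) \<le> c\<^sup>2"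
  shows "exp (- c) \<le> sum2 (d ^ n) (\<lambda>i j. prodfun d t n i j * exp (- \<bar>sumfun d g n i j\<bar>))"
proof -
  let ?T = "prodfun d t n" and ?G = "sumfun d g n"
  \<comment> \<open>The tangent of exp (- y) at y = c, combined with the quadratic bound on the
    absolute value that touches it at c. The resulting minorant of exp (- abs x) depends on x only
    through x^2.\<close>
  have tangent: "exp (- c) * (1 + c / 2) - exp (- c) / (2 * c) * x\<^sup>2 \<le> exp (- \<bar>x\<bar>)" for x
  proof -
    have "\<bar>x\<bar> \<le> (x\<^sup>2 / c + c) / 2"
      using zero_le_power2[of "\<bar>x\<bar> - c"] c by (simp add: power2_diff field_simps power2_eq_square)
    then have "1 + c / 2 - x\<^sup>2 / (2 * c) \<le> 1 + (c - \<bar>x\<bar>)" by (simp add: field_simps)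
    also have "\<dots> \<le> exp (c - \<bar>x\<bar>)" by (rule exp_ge_add_one_self)
    finally have "exp (- c) * (1 + c / 2 - x\<^sup>2 / (2 * c)) \<le> exp (- c) * exp (c - \<bar>x\<bar>)"
      by (rule mult_left_mono) simp
    then show ?thesis by (simp add: exp_add[symmetric] algebra_simps)
  qed
  have "exp (- c) / (2 * c) * (real n * sum2 d (\<lambda>i j. t i j * (g i j)\<^sup>2)) \<le> exp (- c) / (2 * c) * c\<^sup>2"
    using c by (intro mult_left_mono) auto
  also have "\<dots> = exp (- c) * (c / 2)" using c by (simp add: power2_eq_square)
  finally have "exp (- c) \<le> exp (- c) * (1 + c / 2) -
      exp (- c) / (2 * c) * (real n * sum2 d (\<lambda>i j. t i j * (g i j)\<^sup>2))"
    by (simp add: algebra_simps)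
  also have "\<dots> = sum2 (d ^ n) (\<lambda>i j. ?T i j * (exp (- c) * (1 + c / 2)) - exp (- c) / (2 * c) * (?T i j * (?G i j)\<^sup>2))"
    unfolding sum2_diff sum2_multc sum2_cmult sum2_moments(2)[OF t mean] using sum2_prodfun[of d n t] t by simp
  also have "\<dots> \<le> sum2 (d ^ n) (\<lambda>i j. ?T i j * exp (- \<bar>?G i j\<bar>))"
  proof (rule sum2_mono)
    fix i j assume "i < d ^ n" "j < d ^ n"
    then have "?T i j * (exp (- c) * (1 + c / 2) - exp (- c) / (2 * c) * (?G i j)\<^sup>2) \<le> ?T i j * exp (- \<bar>?G i j\<bar>)"
      by (intro mult_left_mono tangent prodfun_nonneg pos)
    then show "?T i j * (exp (- c) * (1 + c / 2)) - exp (- c) / (2 * c) * (?T i j * (?G i j)\<^sup>2)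
      \<le> ?T i j * exp (- \<bar>?G i j\<bar>)" by (simp add: algebra_simps)
  qed
  finally show ?thesis .
qed

lemma prodfun_exp_le:
  assumes "\<And>i j. i < d \<Longrightarrow> j < d \<Longrightarrow> 0 \<le> t i j" "\<And>i j. i < d \<Longrightarrow> j < d \<Longrightarrow> t i j * exp (a * L i j) \<le> P i j"
  shows "i < d ^ n \<Longrightarrow> j < d ^ n \<Longrightarrow> prodfun d t n i j * exp (a * sumfun d L n i j) \<le> prodfun d P n i j"
proof (induction n arbitrary: i j)
  case (Suc n)
  note dl = digit_less[OF Suc.prems(1)] digit_less[OF Suc.prems(2)]
  have "(t (i div d ^ n) (j div d ^ n) * exp (a * L (i div d ^ n) (j div d ^ n))) *
      (prodfun d t n (i mod d ^ n) (j mod d ^ n) * exp (a * sumfun d L n (i mod d ^ n) (j mod d ^ n)))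
    \<le> P (i div d ^ n) (j div d ^ n) * prodfun d P n (i mod d ^ n) (j mod d ^ n)"
    using dl assms Suc.IH
    by (intro mult_mono mult_nonneg_nonneg prodfun_nonneg)
       (auto intro: order_trans[OF mult_nonneg_nonneg[OF assms(1) exp_ge_zero] assms(2)])
  then show ?case by (simp add: algebra_simps exp_add)
qed simp

text \<open>Only points of the common support contribute, at s = 0 and s = 1 too, so for nonnegative
  arguments the sum is smooth in s on the whole line and the closed interval causes no
  jumps.\<close>

definition chsum :: "nat \<Rightarrow> (nat \<Rightarrow> nat \<Rightarrow> real) \<Rightarrow> (nat \<Rightarrow> nat \<Rightarrow> real) \<Rightarrow> real \<Rightarrow> real" where
  "chsum d P q s = sum2 d (\<lambda>i j. P i j powr s * q i j powr (1 - s))"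

lemma chsum_deriv:
  assumes "\<And>i j. i < d \<Longrightarrow> j < d \<Longrightarrow> 0 \<le> P i j" "\<And>i j. i < d \<Longrightarrow> j < d \<Longrightarrow> 0 \<le> q i j"
  shows "(chsum d P q has_real_derivative
    sum2 d (\<lambda>i j. P i j powr s * q i j powr (1 - s) * ln (P i j / q i j))) (at s)"
proof -
  have "((\<lambda>s. P i j powr s * q i j powr (1 - s)) has_real_derivative
      P i j powr s * q i j powr (1 - s) * ln (P i j / q i j)) (at s)" if "i < d" "j < d" for i j
  proof (cases "P i j = 0 \<or> q i j = 0")
    case True
    then show ?thesis by auto
  next
    case False
    with assms that have "0 < P i j" "0 < q i j" by (auto simp: less_le)
    then show ?thesis by (auto intro!: derivative_eq_intros simp: ln_div algebra_simps)
  qed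
  then show ?thesis
    unfolding chsum_def[abs_def] sum2_def by (intro DERIV_sum) auto
qed

text \<open>Under the tilted distribution t = P^s q^(1-s) / Z, both P and q are Z t times an
  exponential of the log-likelihood ratio L on the common support. At the minimising s neither
  exponent falls below minus the absolute centred sum, so the minimum of the products costs only a
  factor controlled by the variance \<open>v\<close>, which is the same for all n.\<close>

theorem chernoff_lower_bound:
  assumes P: "\<And>i j. i < d \<Longrightarrow> j < d \<Longrightarrow> 0 \<le> P i j" and q: "\<And>i j. i < d \<Longrightarrow> j < d \<Longrightarrow> 0 \<le> q i j"
    and ov: "i0 < d" "j0 < d" "0 < P i0 j0" "0 < q i0 j0"
  shows "\<exists>s v. 0 \<le> s \<and> s \<le> 1 \<and> 0 < chsum d P q s \<and> (\<forall>n c. 0 < c \<longrightarrow> real n * v \<le> c\<^sup>2 \<longrightarrow>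
    chsum d P q s ^ n * exp (- c) \<le> sum2 (d ^ n) (\<lambda>i j. min (prodfun d P n i j) (prodfun d q n i j)))"
proof -
  let ?Z = "chsum d P q"
  define L where "L i j = ln (P i j / q i j)" for i j
  define D where "D s = sum2 d (\<lambda>i j. P i j powr s * q i j powr (1 - s) * L i j)" for s
  have deriv: "(?Z has_real_derivative D s) (at s)" for s
    unfolding D_def L_def by (rule chsum_deriv[OF P q])
  have "continuous_on {0..1} ?Z"
    using deriv by (intro continuous_at_imp_continuous_on ballI) (blast intro: DERIV_isCont)
  then obtain s where s: "s \<in> {0..1}" "\<And>x. x \<in> {0..1} \<Longrightarrow> ?Z s \<le> ?Z x"
    using continuous_attains_inf[of "{0..1::real}" ?Z] by auto
  \<comment> \<open>A minimum over the closed interval gives one-sided information: s can move right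
    when s < 1 and left when 0 < s. The step \<open>h\<close> is cut off so that the moved point
    stays in the interval.\<close>
  have D_ge: "0 \<le> D s" if "s < 1"
  proof (rule ccontr)
    assume "\<not> 0 \<le> D s"
    then obtain e where e: "0 < e" "\<And>h. 0 < h \<Longrightarrow> h < e \<Longrightarrow> ?Z (s + h) < ?Z s"
      using DERIV_neg_dec_right[OF deriv[of s]] by auto
    define h where "h = min (e / 2) (1 - s)"
    have "0 < h" "h < e" "h \<le> 1 - s" using e that by (auto simp: h_def min_less_iff_disj)
    then show False using e(2)[of h] s(2)[of "s + h"] s(1) by auto
  qed
  have D_le: "D s \<le> 0" if "0 < s"
  proof (rule ccontr)
    assume "\<not> D s \<le> 0"
    then obtain e where e: "0 < e" "\<And>h. 0 < h \<Longrightarrow> h < e \<Longrightarrow> ?Z (s - h) < ?Z s"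
      using DERIV_pos_inc_left[OF deriv[of s]] by auto
    define h where "h = min (e / 2) s"
    have "0 < h" "h < e" "h \<le> s" using e that by (auto simp: h_def min_less_iff_disj)
    then show False using e(2)[of h] s(2)[of "s - h"] s(1) by auto
  qed
  define Z where "Z = ?Z s"
  have "0 < P i0 j0 powr s * q i0 j0 powr (1 - s)" using ov by simp
  also have "\<dots> \<le> Z" unfolding Z_def chsum_def by (rule sum2_ge_term) (use ov in auto)
  finally have Z: "0 < Z" .
  define t where "t i j = P i j powr s * q i j powr (1 - s) / Z" for i j
  have t_nonneg: "0 \<le> t i j" for i j using Z by (simp add: t_def)
  have t: "sum2 d t = 1" using Z unfolding t_def sum2_divide by (simp add: Z_def chsum_def)
  define \<mu> where "\<mu> = sum2 d (\<lambda>i j. t i j * L i j)"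
  have \<mu>: "\<mu> = D s / Z"
    unfolding \<mu>_def D_def t_def sum2_divide[symmetric] by simp
  define g where "g i j = L i j - \<mu>" for i j
  have mean: "sum2 d (\<lambda>i j. t i j * g i j) = 0"
    unfolding g_def right_diff_distrib sum2_diff sum2_multc t by (simp add: \<mu>_def)
  define v where "v = sum2 d (\<lambda>i j. t i j * (g i j)\<^sup>2)"
  \<comment> \<open>Equalities on the common support; elsewhere \<open>t\<close> vanishes and only
    the inequalities survive.\<close>
  have tP: "Z * t i j * exp ((1 - s) * L i j) \<le> P i j" and tq: "Z * t i j * exp (- s * L i j) \<le> q i j"
    if ij: "i < d" "j < d" for i j
  proof -
    consider "P i j = 0 \<or> q i j = 0" | "0 < P i j" "0 < q i j"
      using P[OF ij] q[OF ij] by linarith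
    then have "Z * t i j * exp ((1 - s) * L i j) \<le> P i j \<and> Z * t i j * exp (- s * L i j) \<le> q i j"
    proof cases
      case 1
      then show ?thesis using P[OF ij] q[OF ij] by (auto simp: t_def)
    next
      case 2
      have "P i j powr s * q i j powr (1 - s) * exp (x * L i j)
          = exp (ln (P i j) * (s + x) + ln (q i j) * (1 - s - x))" for x
        using 2 by (simp add: powr_def L_def ln_div exp_add[symmetric] algebra_simps)
      from this[of "1 - s"] this[of "- s"] show ?thesis using 2 Z by (simp add: t_def)
    qed
    then show "Z * t i j * exp ((1 - s) * L i j) \<le> P i j" "Z * t i j * exp (- s * L i j) \<le> q i j" by auto
  qed
  have "?Z s ^ n * exp (- c) \<le> sum2 (d ^ n) (\<lambda>i j. min (prodfun d P n i j) (prodfun d q n i j))"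
    if c: "0 < c" "real n * v \<le> c\<^sup>2" for n c
  proof -
    have "Z ^ n * exp (- c) \<le> Z ^ n * sum2 (d ^ n) (\<lambda>i j. prodfun d t n i j * exp (- \<bar>sumfun d g n i j\<bar>))"
      using Z c by (intro mult_left_mono sum2_exp_abs_lower t t_nonneg mean) (auto simp: v_def)
    also have "\<dots> = sum2 (d ^ n) (\<lambda>i j. prodfun d (\<lambda>i j. Z * t i j) n i j * exp (- \<bar>sumfun d g n i j\<bar>))"
      by (simp add: sum2_cmult[symmetric] prodfun_cmult mult.assoc)
    also have "\<dots> \<le> sum2 (d ^ n) (\<lambda>i j. min (prodfun d P n i j) (prodfun d q n i j))"
    proof (rule sum2_mono)
      fix i j assume ij: "i < d ^ n" "j < d ^ n"
      define S where "S = sumfun d L n i j"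
      define x where "x = sumfun d g n i j"
      define T where "T = prodfun d (\<lambda>i j. Z * t i j) n i j"
      have T: "0 \<le> T" unfolding T_def using Z t_nonneg ij by (intro prodfun_nonneg) auto
      have S: "S = x + real n * \<mu>" by (simp add: S_def x_def g_def[abs_def] sumfun_diff_const)
      \<comment> \<open>For s < 1 the drift \<mu> is nonnegative and helps. At s = 1 its sign may be
        wrong, but the factor 1 - s removes it. The bound for \<open>- s * S\<close> is the mirror
        image.\<close>
      have "- \<bar>x\<bar> \<le> (1 - s) * S"
      proof (cases "s < 1")
        case True
        then have "0 \<le> real n * \<mu>" using D_ge Z by (simp add: \<mu>)
        then have "(1 - s) * x \<le> (1 - s) * S" using True by (simp add: S)
        moreover have "- \<bar>x\<bar> \<le> - ((1 - s) * \<bar>x\<bar>)" using s(1) by (simp add: mult_left_le_one_le)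
        moreover have "(1 - s) * (- \<bar>x\<bar>) \<le> (1 - s) * x" using True by (intro mult_left_mono) auto
        ultimately show ?thesis by linarith
      qed (use s(1) in auto)
      moreover have "- \<bar>x\<bar> \<le> - s * S"
      proof (cases "0 < s")
        case True
        then have "real n * \<mu> \<le> 0" using D_le Z by (simp add: \<mu> mult_nonneg_nonpos divide_nonpos_pos)
        then have "s * S \<le> s * x" using True by (simp add: S)
        moreover have "s * x \<le> s * \<bar>x\<bar>" using True by (intro mult_left_mono) auto
        moreover have "s * \<bar>x\<bar> \<le> \<bar>x\<bar>" using s(1) by (simp add: mult_left_le_one_le)
        ultimately show ?thesis by linarith
      qed (use s(1) in auto)
      ultimately have "T * exp (- \<bar>x\<bar>) \<le> T * exp ((1 - s) * S)" "T * exp (- \<bar>x\<bar>) \<le> T * exp (- s * S)"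
        using T by (auto intro!: mult_left_mono)
      moreover have "T * exp ((1 - s) * S) \<le> prodfun d P n i j"
        unfolding T_def S_def using Z t_nonneg ij tP by (intro prodfun_exp_le) auto
      moreover have "T * exp (- s * S) \<le> prodfun d q n i j"
        unfolding T_def S_def using Z t_nonneg ij tq by (intro prodfun_exp_le) auto
      ultimately show "prodfun d (\<lambda>i j. Z * t i j) n i j * exp (- \<bar>sumfun d g n i j\<bar>)
        \<le> min (prodfun d P n i j) (prodfun d q n i j)"
        by (simp add: T_def x_def)
    qed
    finally show ?thesis by (simp add: Z_def)
  qed
  then show ?thesis using s(1) Z unfolding Z_def by (intro exI[of _ s] exI[of _ v]) auto
qed

section \<open>Tensor powers\<close>

lemma kron_dim[simp]: "dim_row (kron A B) = dim_row A * dim_row B" "dim_col (kron A B) = dim_col A * dim_col B"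
  by (simp_all add: kron_def)

lemma kron_carrier[simp]: "A \<in> carrier_mat n n \<Longrightarrow> B \<in> carrier_mat m m \<Longrightarrow> kron A B \<in> carrier_mat (n * m) (n * m)"
  by auto

lemma kron_index: "A \<in> carrier_mat n n \<Longrightarrow> B \<in> carrier_mat m m \<Longrightarrow> i < n * m \<Longrightarrow> j < n * m \<Longrightarrow>
    kron A B $$ (i, j) = A $$ (i div m, j div m) * B $$ (i mod m, j mod m)"
  by (auto simp: kron_def)

lemma div_mod_less: assumes "i < n * (m :: nat)" shows "i div m < n" "i mod m < m"
proof -
  have "0 < m" using assms by (auto intro: Nat.gr0I)
  then show "i div m < n" "i mod m < m" using assms by (auto simp: less_mult_imp_div_less)
qed

lemma kron_mult:
  assumes "A \<in> carrier_mat n n" "C \<in> carrier_mat n n" "B \<in> carrier_mat m m" "D \<in> carrier_mat m m"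
  shows "kron A B * kron C D = kron (A * C) (B * D)"
proof (rule eq_matI)
  fix i j assume "i < dim_row (kron (A * C) (B * D))" "j < dim_col (kron (A * C) (B * D))"
  then have ij: "i < n * m" "j < n * m" using assms by auto
  note dm = div_mod_less[OF ij(1)] div_mod_less[OF ij(2)]
  have "(kron A B * kron C D) $$ (i, j) = (\<Sum>k<n * m. kron A B $$ (i, k) * kron C D $$ (k, j))"
    using assms ij by (intro index_mult_sum) auto
  also have "\<dots> = (\<Sum>k<n * m. (A $$ (i div m, k div m) * C $$ (k div m, j div m)) *
      (B $$ (i mod m, k mod m) * D $$ (k mod m, j mod m)))"
    using assms ij by (intro sum.cong) (auto simp: kron_index)
  also have "\<dots> = (\<Sum>x<n. \<Sum>y<m. (A $$ (i div m, x) * C $$ (x, j div m)) * (B $$ (i mod m, y) * D $$ (y, j mod m)))"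
    by (rule sum_div_mod)
  also have "\<dots> = (A * C) $$ (i div m, j div m) * (B * D) $$ (i mod m, j mod m)"
    using assms dm by (simp add: index_mult_sum[where n = n and m = n and k = n]
        index_mult_sum[where n = m and m = m and k = m] sum_product)
  also have "\<dots> = kron (A * C) (B * D) $$ (i, j)"
    using assms ij by (intro kron_index[symmetric]) auto
  finally show "(kron A B * kron C D) $$ (i, j) = kron (A * C) (B * D) $$ (i, j)" .
qed (use assms in auto)

lemma kron_adj: assumes "A \<in> carrier_mat n n" "B \<in> carrier_mat m m"
  shows "adj (kron A B) = kron (adj A) (adj B)"
proof (rule eq_matI)
  fix i j assume "i < dim_row (kron (adj A) (adj B))" "j < dim_col (kron (adj A) (adj B))"
  then have ij: "i < n * m" "j < n * m" using assms by auto
  show "adj (kron A B) $$ (i, j) = kron (adj A) (adj B) $$ (i, j)"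
    using assms ij div_mod_less[OF ij(1)] div_mod_less[OF ij(2)]
    by (simp add: kron_index[where n = n and m = m])
qed (use assms in auto)

lemma kron_rdiag: "kron (rdiag n l) (rdiag m k) = rdiag (n * m) (\<lambda>i. l (i div m) * k (i mod m))"
proof (rule eq_matI)
  fix i j assume "i < dim_row (rdiag (n * m) (\<lambda>i. l (i div m) * k (i mod m)))"
    "j < dim_col (rdiag (n * m) (\<lambda>i. l (i div m) * k (i mod m)))"
  then have ij: "i < n * m" "j < n * m" by auto
  have "i = j \<longleftrightarrow> i div m = j div m \<and> i mod m = j mod m" by (metis div_mult_mod_eq)
  then show "kron (rdiag n l) (rdiag m k) $$ (i, j) = rdiag (n * m) (\<lambda>i. l (i div m) * k (i mod m)) $$ (i, j)"
    using ij div_mod_less[OF ij(1)] div_mod_less[OF ij(2)]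
    by (auto simp: kron_index[where n = n and m = m] rdiag_index)
qed auto

lemma kron_one: "kron (1\<^sub>m n) (1\<^sub>m m) = 1\<^sub>m (n * m)"
  using kron_rdiag[of n "\<lambda>_. 1" m "\<lambda>_. 1"] by (simp add: rdiag_one)

lemma tensor_pow_carrier[simp]: "A \<in> carrier_mat d d \<Longrightarrow> tensor_pow A n \<in> carrier_mat (d ^ n) (d ^ n)"
  by (induction n) auto

lemma tensor_pow_mult: "A \<in> carrier_mat d d \<Longrightarrow> B \<in> carrier_mat d d \<Longrightarrow>
    tensor_pow A n * tensor_pow B n = tensor_pow (A * B) n"
proof (induction n)
  case (Suc n)
  then show ?case by (simp add: kron_mult[where n = d and m = "d ^ n"])
qed simp

lemma tensor_pow_adj: "A \<in> carrier_mat d d \<Longrightarrow> adj (tensor_pow A n) = tensor_pow (adj A) n"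
proof (induction n)
  case (Suc n)
  then show ?case by (simp add: kron_adj[where n = d and m = "d ^ n"])
qed simp

lemma tensor_pow_one: "tensor_pow (1\<^sub>m d) n = 1\<^sub>m (d ^ n)"
  by (induction n) (simp_all add: kron_one)

text \<open>A product over a single index is encoded by \<open>prodfun\<close> with a dummy second
  index, set here to i; \<open>prodfun_fst\<close> allows it to be changed.\<close>

lemma tensor_pow_rdiag: "tensor_pow (rdiag d l) n = rdiag (d ^ n) (\<lambda>i. prodfun d (\<lambda>i j. l i) n i i)"
  by (induction n) (simp_all add: kron_rdiag rdiag_one)

lemma tensor_pow_spec: assumes "U \<in> carrier_mat d d"
  shows "tensor_pow (spec_mat d U l) n = spec_mat (d ^ n) (tensor_pow U n) (\<lambda>i. prodfun d (\<lambda>i j. l i) n i i)"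
proof -
  interpret sqmat d .
  show ?thesis
    using assms unfolding spec_mat_def
    by (simp add: tensor_pow_mult[where d = d, symmetric] tensor_pow_adj[where d = d] tensor_pow_rdiag)
qed

lemma unitary_tensor_pow: "unitary_mat d U \<Longrightarrow> unitary_mat (d ^ n) (tensor_pow U n)"
  unfolding unitary_mat_def
  by (simp add: tensor_pow_adj[where d = d] tensor_pow_mult[where d = d] tensor_pow_one)

lemma tensor_pow_norm: assumes "W \<in> carrier_mat d d"
  shows "i < d ^ n \<Longrightarrow> j < d ^ n \<Longrightarrow>
    (cmod (tensor_pow W n $$ (i, j)))\<^sup>2 = prodfun d (\<lambda>i j. (cmod (W $$ (i, j)))\<^sup>2) n i j"
proof (induction n arbitrary: i j)
  case (Suc n)
  then show ?case
    using assms Suc.IH[of "i mod d ^ n" "j mod d ^ n"] digit_less[of i d n] digit_less[of j d n]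
    by (simp add: kron_index[where n = d and m = "d ^ n"] norm_mult power_mult_distrib)
qed simp

lemma prodfun_fst: "prodfun d (\<lambda>i j. l i) n i j = prodfun d (\<lambda>i j. l i) n i k"
proof (induction n arbitrary: i j k)
  case (Suc n)
  from Suc.IH[of "i mod d ^ n" "j mod d ^ n" "k mod d ^ n"] show ?case by simp
qed simp

lemma prodfun_snd: "prodfun d (\<lambda>i j. l j) n i j = prodfun d (\<lambda>i j. l i) n j j"
  by (induction n arbitrary: i j) simp_all

section \<open>Measurement errors\<close>

context sqmat
begin

text \<open>The eigenvalues of a test lie in [0, 1], where squaring decreases.\<close>

lemma test_sq_le: assumes "psd T" "psd (1\<^sub>m d - T)" shows "psd (T - T * T)"
proof -
  note T = psdD[OF assms(1)]
  obtain X h where X: "unitary X" "T = spec X h" "\<forall>i<d. 0 \<le> h i" using psd_spec_ex[OF assms(1)] by blast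
  note X' = unitaryD[OF X(1)]
  have "psd (spec X (\<lambda>i. 1 - h i))"
    using assms(2) unfolding X(2) spec_one[OF X(1), symmetric] using X' by (simp add: spec_minus)
  then have "h i \<le> 1" if "i < d" for i using spec_psd_nonneg[OF X(1) _ that] by fastforce
  then show ?thesis
    unfolding X(2) spec_mult[OF X(1)] using X' X(3)
    by (auto simp: spec_minus intro!: psd_spec mult_left_le)
qed

text \<open>The Nussbaum--Szkola lower bound: by completeness of the eigenbasis \<open>y\<^sub>j\<close>,
  \<open>\<parallel>(1 - T) x\<^sub>i\<parallel>\<^sup>2 = \<Sum>\<^sub>j |\<langle>y\<^sub>j, (1 - T) x\<^sub>i\<rangle>|\<^sup>2\<close>, and the two amplitudes for \<open>T\<close> and \<open>1 - T\<close>
  add up to \<open>\<langle>y\<^sub>j, x\<^sub>i\<rangle>\<close>.\<close>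

lemma trace_test_lower:
  assumes U: "unitary U" and V: "unitary V" and l: "\<And>i. i < d \<Longrightarrow> 0 \<le> l i"
    and T: "psd T" "psd (1\<^sub>m d - T)"
  shows "(\<Sum>i<d. \<Sum>j<d. l i * (cmod ((adj U * T * V) $$ (i, j)))\<^sup>2) \<le> Re (mtrace (spec U l * T))"
proof -
  note U' = unitaryD[OF U] and V' = unitaryD[OF V] and T' = psdD[OF T(1)]
  have "0 \<le> Re (mtrace (spec U l * (T - T * T)))"
    by (intro psd_trace_mult psd_spec test_sq_le T l) (use U' in auto)
  then have *: "Re (mtrace (spec U l * (T * T))) \<le> Re (mtrace (spec U l * T))"
    using U' T' by (simp add: sq_distrib mtrace_minus)
  define R where "R = adj U * T * V"
  have R: "R \<in> M" using U' V' T' by (simp add: R_def)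
  have RR: "adj U * (T * T) * U = R * adj R"
    using U' V' T' by (simp add: R_def sq_adj sq_assoc unitary_cancel[OF V])
  have "(R * adj R) $$ (i, i) = complex_of_real (\<Sum>j<d. (cmod (R $$ (i, j)))\<^sup>2)" if "i < d" for i
    using R that by (subst index_mult_sum[where n = d and m = d and k = d])
      (auto simp: complex_norm_square simp del: of_real_power)
  then have "mtrace (spec U l * (T * T)) = complex_of_real (\<Sum>i<d. l i * (\<Sum>j<d. (cmod (R $$ (i, j)))\<^sup>2))"
    using U' T' RR by (subst mtrace_spec_mult) auto
  with * show ?thesis by (simp add: R_def sum_distrib_left)
qed

text \<open>The factor 2 is the price of splitting the squared modulus of the sum of the two
  amplitudes. The smaller of \<open>l i\<close> and \<open>m j\<close> can stand before both
  squares, after which each is raised to the eigenvalue of its own state.\<close>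

theorem nussbaum_szkola:
  assumes U: "unitary U" and V: "unitary V"
    and l: "\<And>i. i < d \<Longrightarrow> 0 \<le> l i" and m: "\<And>i. i < d \<Longrightarrow> 0 \<le> m i" and T: "test_op d T"
  shows "(\<Sum>i<d. \<Sum>j<d. min (l i * (cmod ((adj U * V) $$ (i, j)))\<^sup>2) (m j * (cmod ((adj U * V) $$ (i, j)))\<^sup>2)) \<le>
    2 * (Re (mtrace (spec U l * (1\<^sub>m d - T))) + Re (mtrace (spec V m * T)))"
proof -
  note U' = unitaryD[OF U] and V' = unitaryD[OF V]
  have psdT: "psd T" "psd (1\<^sub>m d - T)" using T by (auto simp: test_op_def)
  note T' = psdD[OF psdT(1)] and T'' = psdD[OF psdT(2)]
  have "1\<^sub>m d - (1\<^sub>m d - T) = T" using T'(1) by (intro eq_matI) auto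
  then have psdT': "psd (1\<^sub>m d - (1\<^sub>m d - T))" using psdT by simp
  let ?a = "\<lambda>i j. (adj U * (1\<^sub>m d - T) * V) $$ (i, j)" and ?b = "\<lambda>i j. (adj U * T * V) $$ (i, j)"
  let ?w = "\<lambda>i j. (adj U * V) $$ (i, j)"
  have 1: "(\<Sum>i<d. \<Sum>j<d. l i * (cmod (?a i j))\<^sup>2) \<le> Re (mtrace (spec U l * (1\<^sub>m d - T)))"
    by (rule trace_test_lower[OF U V l psdT(2) psdT'])
  \<comment> \<open>Applying the trace bound to the second state exchanges the two bases, which
    transposes and conjugates the amplitudes and so keeps their moduli.\<close>
  have "(adj V * T * U) $$ (j, i) = cnj (?b i j)" if "i < d" "j < d" for i j
  proof -
    have "adj V * T * U = adj (adj U * T * V)" using U' V' T' by (simp add: sq_adj sq_assoc)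
    moreover have "adj U * T * V \<in> M" using U' V' T' by simp
    ultimately show ?thesis using that adj_index by (metis carrier_matD)
  qed
  then have "(\<Sum>j<d. \<Sum>i<d. m j * (cmod ((adj V * T * U) $$ (j, i)))\<^sup>2) = (\<Sum>j<d. \<Sum>i<d. m j * (cmod (?b i j))\<^sup>2)"
    by (intro sum.cong refl) simp
  then have 2: "(\<Sum>i<d. \<Sum>j<d. m j * (cmod (?b i j))\<^sup>2) \<le> Re (mtrace (spec V m * T))"
    using trace_test_lower[of V U m T, OF V U m psdT] by (subst sum.swap) simp
  have "(\<Sum>i<d. \<Sum>j<d. min (l i * (cmod (?w i j))\<^sup>2) (m j * (cmod (?w i j))\<^sup>2)) \<le>
    (\<Sum>i<d. \<Sum>j<d. 2 * (l i * (cmod (?a i j))\<^sup>2 + m j * (cmod (?b i j))\<^sup>2))"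
  proof (intro sum_mono)
    fix i j assume "i \<in> {..<d}" "j \<in> {..<d}"
    then have ij: "i < d" "j < d" by auto
    have "adj U * (1\<^sub>m d - T) * V + adj U * T * V = adj U * V"
    proof -
      have "adj U * (1\<^sub>m d - T) * V + adj U * T * V = adj U * ((1\<^sub>m d - T) + T) * V"
        using U' V' T' T'' by (simp only: sq_distrib sq_closed)
      also have "(1\<^sub>m d - T) + T = 1\<^sub>m d" using T'(1) by (intro eq_matI) auto
      finally show ?thesis using U' V' by (simp add: sq_one)
    qed
    moreover have "adj U * T * V \<in> M" using U' V' T' by simp
    ultimately have w: "?w i j = ?a i j + ?b i j" using ij by (metis carrier_matD index_add_mat(1))
    have "(cmod (?w i j))\<^sup>2 \<le> (cmod (?a i j) + cmod (?b i j))\<^sup>2"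
      unfolding w by (intro power_mono norm_triangle_ineq) auto
    also have "\<dots> \<le> 2 * ((cmod (?a i j))\<^sup>2 + (cmod (?b i j))\<^sup>2)"
      using zero_le_power2[of "cmod (?a i j) - cmod (?b i j)"] by (simp add: power2_diff power2_sum)
    finally have *: "(cmod (?w i j))\<^sup>2 \<le> 2 * ((cmod (?a i j))\<^sup>2 + (cmod (?b i j))\<^sup>2)" .
    define c where "c = min (l i) (m j)"
    have c: "0 \<le> c" "c \<le> l i" "c \<le> m j" using l[OF ij(1)] m[OF ij(2)] by (auto simp: c_def)
    have "min (l i * (cmod (?w i j))\<^sup>2) (m j * (cmod (?w i j))\<^sup>2) = c * (cmod (?w i j))\<^sup>2"
      by (simp add: c_def min_mult_distrib_right)
    also have "\<dots> \<le> c * (2 * ((cmod (?a i j))\<^sup>2 + (cmod (?b i j))\<^sup>2))"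
      using c(1) * by (rule mult_left_mono[rotated])
    also have "\<dots> = 2 * (c * (cmod (?a i j))\<^sup>2 + c * (cmod (?b i j))\<^sup>2)" by (simp add: algebra_simps)
    also have "\<dots> \<le> 2 * (l i * (cmod (?a i j))\<^sup>2 + m j * (cmod (?b i j))\<^sup>2)"
      using c by (intro mult_left_mono add_mono mult_right_mono) auto
    finally show "min (l i * (cmod (?w i j))\<^sup>2) (m j * (cmod (?w i j))\<^sup>2) \<le>
      2 * (l i * (cmod (?a i j))\<^sup>2 + m j * (cmod (?b i j))\<^sup>2)" .
  qed
  also have "\<dots> = 2 * ((\<Sum>i<d. \<Sum>j<d. l i * (cmod (?a i j))\<^sup>2) + (\<Sum>i<d. \<Sum>j<d. m j * (cmod (?b i j))\<^sup>2))"
    by (simp add: sum_distrib_left sum.distrib distrib_left)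
  finally show ?thesis using 1 2 by argo
qed

end

section \<open>Powers of positive operators\<close>

context sqmat
begin

lemma mat_eq_vecI: assumes "A \<in> M" "B \<in> M" "\<And>v. v \<in> carrier_vec d \<Longrightarrow> A *\<^sub>v v = B *\<^sub>v v" shows "A = B"
proof (rule eq_matI)
  fix i j assume "i < dim_row B" "j < dim_col B"
  then have ij: "i < d" "j < d" using assms by auto
  have "C $$ (i, j) = (C *\<^sub>v unit_vec d j) $ i" if "C \<in> M" for C
  proof -
    have "(C *\<^sub>v unit_vec d j) $ i = (\<Sum>x<d. C $$ (i, x) * unit_vec d j $ x)"
      using that ij by (intro index_mult_vec_sum) auto
    also have "\<dots> = (\<Sum>x<d. if x = j then C $$ (i, j) else 0)" using ij by (intro sum.cong) auto
    finally show ?thesis using ij by simp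
  qed
  with assms show "A $$ (i, j) = B $$ (i, j)" by simp
qed (use assms in auto)

text \<open>An eigenvector equation decouples in the coordinates of the eigenbasis. With c = 1 it
  also describes the fixed vectors of a projection.\<close>

lemma spec_eigenvector_iff:
  assumes U: "unitary U" and v: "v \<in> carrier_vec d"
  shows "spec U f *\<^sub>v v = c \<cdot>\<^sub>v v \<longleftrightarrow> (\<forall>i<d. complex_of_real (f i) * (adj U *\<^sub>v v) $ i = c * (adj U *\<^sub>v v) $ i)"
proof -
  note U' = unitaryD[OF U]
  define w where "w = adj U *\<^sub>v v"
  have w: "w \<in> carrier_vec d" unfolding w_def by (rule mult_mat_vec_carrier[OF U'(4) v])
  have v_eq: "v = U *\<^sub>v w"
    unfolding w_def using U' v by (metis assoc_mult_mat_vec one_mult_mat_vec)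
  have Dw: "rdiag d f *\<^sub>v w \<in> carrier_vec d" by (rule mult_mat_vec_carrier[OF rdiag_carrier w])
  have "spec U f *\<^sub>v v = (U * rdiag d f) *\<^sub>v w"
    unfolding spec_mat_def w_def by (rule assoc_mult_mat_vec[OF _ U'(4) v]) (use U' in auto)
  also have "\<dots> = U *\<^sub>v (rdiag d f *\<^sub>v w)"
    by (rule assoc_mult_mat_vec[OF U'(1) rdiag_carrier w])
  finally have sv: "spec U f *\<^sub>v v = U *\<^sub>v (rdiag d f *\<^sub>v w)" .
  have cv: "c \<cdot>\<^sub>v v = U *\<^sub>v (c \<cdot>\<^sub>v w)"
    by (subst v_eq, rule mult_mat_vec[OF U'(1) w, symmetric])
  have inj: "x = y" if "U *\<^sub>v x = U *\<^sub>v y" "x \<in> carrier_vec d" "y \<in> carrier_vec d" for x y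
  proof -
    have canc: "adj U *\<^sub>v (U *\<^sub>v z) = z" if "z \<in> carrier_vec d" for z
      using assoc_mult_mat_vec[OF U'(4) U'(1) that] unfolding U'(2) one_mult_mat_vec[OF that] by (rule sym)
    show ?thesis using canc[OF that(2)] canc[OF that(3)] that(1) by metis
  qed
  have "spec U f *\<^sub>v v = c \<cdot>\<^sub>v v \<longleftrightarrow> rdiag d f *\<^sub>v w = c \<cdot>\<^sub>v w"
    unfolding sv cv
  proof
    assume "U *\<^sub>v (rdiag d f *\<^sub>v w) = U *\<^sub>v (c \<cdot>\<^sub>v w)"
    then show "rdiag d f *\<^sub>v w = c \<cdot>\<^sub>v w" by (rule inj[OF _ Dw]) (use w in simp)
  qed (rule arg_cong)
  also have "\<dots> \<longleftrightarrow> (\<forall>i<d. (rdiag d f *\<^sub>v w) $ i = (c \<cdot>\<^sub>v w) $ i)"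
  proof
    assume *: "\<forall>i<d. (rdiag d f *\<^sub>v w) $ i = (c \<cdot>\<^sub>v w) $ i"
    show "rdiag d f *\<^sub>v w = c \<cdot>\<^sub>v w"
    proof (rule eq_vecI)
      fix i assume "i < dim_vec (c \<cdot>\<^sub>v w)"
      with w have "i < d" by simp
      with * show "(rdiag d f *\<^sub>v w) $ i = (c \<cdot>\<^sub>v w) $ i" by blast
    qed (use Dw w in simp)
  qed simp
  also have "\<dots> \<longleftrightarrow> (\<forall>i<d. complex_of_real (f i) * w $ i = c * w $ i)"
  proof -
    have "(rdiag d f *\<^sub>v w) $ i = complex_of_real (f i) * w $ i" if "i < d" for i
    proof -
      have "(rdiag d f *\<^sub>v w) $ i = (\<Sum>x<d. rdiag d f $$ (i, x) * w $ x)"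
        using w that by (intro index_mult_vec_sum) auto
      also have "\<dots> = (\<Sum>x<d. if x = i then complex_of_real (f i) * w $ i else 0)"
        using that by (intro sum.cong) (auto simp: rdiag_index)
      finally show ?thesis using that by simp
    qed
    then show ?thesis using w by simp
  qed
  finally show ?thesis unfolding w_def .
qed

text \<open>Resolves the definite description in \<open>spec_proj\<close>: the candidate has the
  eigenspace as its range, and an orthogonal projection is determined by its range.\<close>

lemma spec_proj_spec: assumes U: "unitary U"
  shows "spec_proj (spec U l) a = spec U (\<lambda>i. if l i = a then 1 else 0)"
proof -
  note U' = unitaryD[OF U]
  define Q where "Q = spec U (\<lambda>i. if l i = a then 1 else 0)"
  have Q: "Q \<in> M" "adj Q = Q" using U' by (simp_all add: Q_def spec_adj)
  have QQ: "Q * Q = Q" unfolding Q_def spec_mult[OF U] by (rule spec_mat_cong) simp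
  have dim: "dim_row (spec U l) = d" using spec_carrier[OF U'(1)] by auto
  have eig: "spec U l *\<^sub>v v = complex_of_real a \<cdot>\<^sub>v v \<longleftrightarrow> Q *\<^sub>v v = v" if v: "v \<in> carrier_vec d" for v
  proof -
    have "Q *\<^sub>v v = v \<longleftrightarrow> Q *\<^sub>v v = 1 \<cdot>\<^sub>v v" by simp
    then show ?thesis
      unfolding Q_def spec_eigenvector_iff[OF U v] by auto
  qed
  have clos: "X *\<^sub>v v \<in> carrier_vec d" if "X \<in> M" "v \<in> carrier_vec d" for X and v :: "complex vec"
    using that by (rule mult_mat_vec_carrier)
  have asc: "X *\<^sub>v (Y *\<^sub>v v) = (X * Y) *\<^sub>v v" if "X \<in> M" "Y \<in> M" "v \<in> carrier_vec d" for X Y and v :: "complex vec"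
    using that by simp
  have range_Q: "{Q *\<^sub>v v | v. v \<in> carrier_vec d} =
      {v \<in> carrier_vec d. spec U l *\<^sub>v v = complex_of_real a \<cdot>\<^sub>v v}"
  proof (intro equalityI subsetI)
    fix x assume "x \<in> {Q *\<^sub>v v | v. v \<in> carrier_vec d}"
    then obtain v where v: "v \<in> carrier_vec d" "x = Q *\<^sub>v v" by auto
    have "Q *\<^sub>v x = x" unfolding v asc[OF Q(1) Q(1) v(1)] QQ ..
    then show "x \<in> {v \<in> carrier_vec d. spec U l *\<^sub>v v = complex_of_real a \<cdot>\<^sub>v v}"
      using clos[OF Q(1) v(1)] v(2) eig by auto
  next
    fix x assume "x \<in> {v \<in> carrier_vec d. spec U l *\<^sub>v v = complex_of_real a \<cdot>\<^sub>v v}"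
    then have "x \<in> carrier_vec d" "Q *\<^sub>v x = x" using eig by auto
    then show "x \<in> {Q *\<^sub>v v | v. v \<in> carrier_vec d}" by (metis (mono_tags, lifting) mem_Collect_eq)
  qed
  show ?thesis
    unfolding spec_proj_def dim Q_def[symmetric]
  proof (rule the_equality)
    show "hermitian_op d Q \<and> Q * Q = Q \<and> {Q *\<^sub>v v |v. v \<in> carrier_vec d} =
      {v \<in> carrier_vec d. spec U l *\<^sub>v v = complex_of_real a \<cdot>\<^sub>v v}"
      using Q QQ range_Q by (simp add: hermitian_iff)
  next
    fix P assume "hermitian_op d P \<and> P * P = P \<and> {P *\<^sub>v v |v. v \<in> carrier_vec d} =
      {v \<in> carrier_vec d. spec U l *\<^sub>v v = complex_of_real a \<cdot>\<^sub>v v}"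
    then have P: "P \<in> M" "adj P = P" "P * P = P"
      and range: "{P *\<^sub>v v |v. v \<in> carrier_vec d} = {Q *\<^sub>v v |v. v \<in> carrier_vec d}"
      using range_Q by (auto simp: hermitian_iff)
    \<comment> \<open>An idempotent fixes its range pointwise. Used both ways with self-adjointness,
      this gives \<open>P = adj (Q * P)\<close>, then \<open>P * Q\<close>, then
      \<open>Q\<close>.\<close>
    have absorb: "X * Y = Y"
      if X: "X \<in> M" "X * X = X" and Y: "Y \<in> M"
        and sub: "{Y *\<^sub>v v |v. v \<in> carrier_vec d} \<subseteq> {X *\<^sub>v v |v. v \<in> carrier_vec d}" for X Y
    proof (rule mat_eq_vecI)
      fix v :: "complex vec" assume v: "v \<in> carrier_vec d"
      then obtain u where u: "u \<in> carrier_vec d" "Y *\<^sub>v v = X *\<^sub>v u" using sub by auto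
      have "(X * Y) *\<^sub>v v = X *\<^sub>v (X *\<^sub>v u)" using asc[OF X(1) Y v] u by simp
      also have "\<dots> = Y *\<^sub>v v" unfolding asc[OF X(1) X(1) u(1)] X(2) u(2) ..
      finally show "(X * Y) *\<^sub>v v = Y *\<^sub>v v" .
    qed (use X Y in auto)
    have "P = adj (Q * P)" using absorb[OF Q(1) QQ P(1)] range P by simp
    also have "\<dots> = P * Q" using P Q by (simp add: sq_adj)
    also have "\<dots> = Q" using absorb[OF P(1,3) Q(1)] range by simp
    finally show "P = Q" .
  qed
qed

lemma spec_vals_spec: assumes U: "unitary U"
  shows "spec_vals (spec U l) = l ` {..<d}"
proof (intro equalityI subsetI)
  note U' = unitaryD[OF U]
  have dim: "dim_row (spec U l) = d" using spec_carrier[OF U'(1)] by auto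
  fix a
  {
    assume "a \<in> spec_vals (spec U l)"
    then obtain v where v: "v \<in> carrier_vec d" "v \<noteq> 0\<^sub>v d" "spec U l *\<^sub>v v = complex_of_real a \<cdot>\<^sub>v v"
      unfolding spec_vals_def dim by auto
    define w where "w = adj U *\<^sub>v v"
    have "v = U *\<^sub>v w"
      unfolding w_def using U' v by (metis assoc_mult_mat_vec one_mult_mat_vec)
    moreover have "w \<in> carrier_vec d" unfolding w_def by (rule mult_mat_vec_carrier[OF U'(4) v(1)])
    moreover have "U *\<^sub>v 0\<^sub>v d = 0\<^sub>v d"
      using U' by (intro eq_vecI) (auto simp: index_mult_mat_vec)
    ultimately obtain i where i: "i < d" "w $ i \<noteq> 0"
      using v(2) by (metis carrier_vecD eq_vecI index_zero_vec)
    then have "complex_of_real (l i) = complex_of_real a"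
      using v(3) unfolding spec_eigenvector_iff[OF U v(1)] w_def by auto
    then show "a \<in> l ` {..<d}" using i by auto
  next
    assume "a \<in> l ` {..<d}"
    then obtain k where k: "k < d" "a = l k" by auto
    define v where "v = U *\<^sub>v unit_vec d k"
    have v: "v \<in> carrier_vec d" unfolding v_def by (rule mult_mat_vec_carrier[OF U'(1)]) simp
    have w: "adj U *\<^sub>v v = unit_vec d k"
      unfolding v_def using U' by (metis assoc_mult_mat_vec one_mult_mat_vec unit_vec_carrier)
    have "v \<noteq> 0\<^sub>v d"
    proof
      assume "v = 0\<^sub>v d"
      then have "adj U *\<^sub>v v = 0\<^sub>v d" using U' by (intro eq_vecI) (auto simp: index_mult_mat_vec)
      then have "unit_vec d k $ k = (0\<^sub>v d $ k :: complex)" using w by simp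
      then show False using k by simp
    qed
    moreover have "spec U l *\<^sub>v v = complex_of_real a \<cdot>\<^sub>v v"
      unfolding spec_eigenvector_iff[OF U v] w k(2) using k(1) by (simp add: unit_vec_def)
    ultimately show "a \<in> spec_vals (spec U l)"
      unfolding spec_vals_def dim using v by auto
  }
qed

text \<open>After the sums are swapped, each index with positive eigenvalue meets exactly one
  element of the set of distinct eigenvalues. An index with eigenvalue 0 meets none, in agreement
  with \<open>0 powr x = 0\<close>.\<close>

lemma op_pow_spec: assumes U: "unitary U" and l: "\<And>i. i < d \<Longrightarrow> 0 \<le> l i"
  shows "op_pow (spec U l) x = spec U (\<lambda>i. l i powr x)"
proof -
  note U' = unitaryD[OF U]
  have dim: "dim_row (spec U l) = d" using spec_carrier[OF U'(1)] by auto
  show ?thesis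
  proof (rule eq_matI)
    fix i j assume "i < dim_row (spec U (\<lambda>i. l i powr x))" "j < dim_col (spec U (\<lambda>i. l i powr x))"
    then have ij: "i < d" "j < d" using carrier_matD[OF spec_carrier[OF U'(1)]] by metis+
    define F where "F k = U $$ (i, k) * cnj (U $$ (j, k))" for k
    let ?S = "{a \<in> l ` {..<d}. 0 < a}"
    have "op_pow (spec U l) x $$ (i, j) =
      (\<Sum>a\<in>?S. complex_of_real (a powr x) * (\<Sum>k<d. (if l k = a then 1 else 0) * F k))"
      unfolding op_pow_def dim spec_vals_spec[OF U] spec_proj_spec[OF U] using ij U'
      by (simp add: spec_index F_def if_distrib[of complex_of_real] cong: if_cong)
    also have "\<dots> = (\<Sum>a\<in>?S. \<Sum>k<d. (if a = l k then complex_of_real (l k powr x) * F k else 0))"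
      unfolding sum_distrib_left by (intro sum.cong refl) auto
    also have "\<dots> = (\<Sum>k<d. \<Sum>a\<in>?S. (if a = l k then complex_of_real (l k powr x) * F k else 0))"
      by (rule sum.swap)
    also have "\<dots> = (\<Sum>k<d. complex_of_real (l k powr x) * F k)"
      using l by (intro sum.cong refl) (force simp: less_le)
    also have "\<dots> = spec U (\<lambda>i. l i powr x) $$ (i, j)"
      using ij U' by (simp add: spec_index F_def)
    finally show "op_pow (spec U l) x $$ (i, j) = spec U (\<lambda>i. l i powr x) $$ (i, j)" .
  qed (use U' carrier_matD[OF spec_carrier[OF U'(1)]] in \<open>auto simp: op_pow_def\<close>)
qed

end

section \<open>Traces of tensor powers\<close>

lemma mtrace_kron: assumes "A \<in> carrier_mat n n" "B \<in> carrier_mat m m"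
  shows "mtrace (kron A B) = mtrace A * mtrace B"
proof -
  have "mtrace (kron A B) = (\<Sum>k<n * m. A $$ (k div m, k div m) * B $$ (k mod m, k mod m))"
    unfolding mtrace_def using assms by (intro sum.cong) (auto simp: kron_index[where n = n and m = m])
  also have "\<dots> = (\<Sum>i<n. \<Sum>j<m. A $$ (i, i) * B $$ (j, j))" by (rule sum_div_mod)
  finally show ?thesis using assms by (simp add: mtrace_def sum_product)
qed

lemma mtrace_tensor_pow: assumes "A \<in> carrier_mat d d" shows "mtrace (tensor_pow A n) = mtrace A ^ n"
proof (induction n)
  case (Suc n)
  then show ?case using assms by (simp add: mtrace_kron[where n = d and m = "d ^ n"])
qed (simp add: mtrace_def)

section \<open>The Hoeffding divergence as a supremum\<close>

text \<open>The supremum in \<open>h\<close> need not be attained, so upper bounds on levels are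
  proved for every strictly smaller x, while lower bounds come from the explicit level belonging to
  each s.\<close>

lemma hoeffding_level_sup:
  fixes \<phi> :: "real \<Rightarrow> real" and a b :: real and h :: "real \<Rightarrow> ereal"
  assumes \<phi>: "\<And>s. 0 < s \<Longrightarrow> s < 1 \<Longrightarrow> 0 < \<phi> s \<and> \<phi> s \<le> 1" and ab: "0 < a" "a * b = 1"
    and h: "\<And>r. h r = (SUP s\<in>{0<..<1}. ereal (((s - 1) * r - ln (\<phi> s)) / s))"
  defines "R \<equiv> SUP s\<in>{0<..<1}. ereal (- ln (\<phi> s) / (s * a + 1 - s))"
  shows "(SUP r\<in>{0<..}. min (ereal r) (ereal b * h r)) = R"
    and "Sup {ereal r | r. 0 \<le> r \<and> ereal (a * r) \<le> h r} = R"
proof -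
  have b: "0 < b" using ab zero_less_mult_pos[of a b] by simp
  have k: "0 < s * a + 1 - s" if "0 < s" "s < 1" for s
    using that ab mult_pos_pos[of s a] by linarith
  \<comment> \<open>The strict inequality selects one s; since its term decreases in r, replacing r
    by the smaller x leaves a linear inequality that can be solved for x.\<close>
  have key: "ereal x \<le> R" if "x < r" "ereal (a * x) < h r" for x r
  proof -
    from that(2) obtain s where s: "0 < s" "s < 1" "a * x < ((s - 1) * r - ln (\<phi> s)) / s"
      unfolding h less_SUP_iff by auto
    have "a * x * s < (s - 1) * r - ln (\<phi> s)" using s by (simp add: pos_less_divide_eq)
    moreover have "(1 - s) * x \<le> (1 - s) * r" using s that(1) by (intro mult_left_mono) auto
    ultimately have "x * (s * a + 1 - s) \<le> - ln (\<phi> s)" by (simp add: algebra_simps)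
    then have "x \<le> - ln (\<phi> s) / (s * a + 1 - s)" by (subst pos_le_divide_eq[OF k[OF s(1,2)]])
    then show ?thesis unfolding R_def using s by (intro SUP_upper2[of s]) auto
  qed
  \<comment> \<open>This x makes the term of \<open>h x\<close> at s equal to
    \<open>a * x\<close>.\<close>
  have level: "ereal (a * x) \<le> h x" "0 \<le> x"
    if s: "0 < s" "s < 1" and x: "x = - ln (\<phi> s) / (s * a + 1 - s)" for s x
  proof -
    have "x * (s * a + 1 - s) = - ln (\<phi> s)" using x k[OF s] by simp
    then have "((s - 1) * x - ln (\<phi> s)) / s = a * x" using s by (simp add: field_simps)
    then show "ereal (a * x) \<le> h x" unfolding h using s by (intro SUP_upper2[of s]) auto
    show "0 \<le> x" using \<phi>[OF s] k[OF s] unfolding x by (intro divide_nonneg_pos) auto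
  qed
  let ?S1 = "SUP r\<in>{0<..}. min (ereal r) (ereal b * h r)"
  have scale: "ereal (a * x) < h r" if "ereal x < ereal b * h r" for x r
  proof (cases "h r")
    case (real y)
    then have "a * x < a * (b * y)" using that ab by simp
    then show ?thesis using real ab by (simp flip: mult.assoc)
  qed (use that b in auto)
  have S1_ge: "ereal x \<le> ?S1" if "0 < x" "ereal (a * x) \<le> h x" for x
  proof -
    have "ereal x = ereal b * ereal (a * x)" using ab by (simp add: mult.commute flip: mult.assoc)
    also have "\<dots> \<le> ereal b * h x" using that b by (intro ereal_mult_left_mono) auto
    finally show ?thesis using that by (intro SUP_upper2[of x]) auto
  qed
  \<comment> \<open>The level 0 is excluded from the range r > 0, so it is approached by small r:
    the term at s = 1/2 together with \<phi> <= 1 gives h r >= - r.\<close>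
  have S1_nonneg: "0 \<le> ?S1"
  proof (rule ccontr)
    assume "\<not> 0 \<le> ?S1"
    then have "?S1 < 0" by (simp only: not_le)
    from ereal_dense2[OF this] obtain y where y: "?S1 < ereal y" "ereal y < 0" by blast
    define r where "r = - y / b"
    have r: "0 < r" "b * r = - y" using y b by (auto simp: r_def divide_neg_pos)
    have "- r \<le> ((1 / 2 - 1) * r - ln (\<phi> (1 / 2))) / (1 / 2)" using \<phi>[of "1 / 2"] by simp
    then have "ereal (- r) \<le> h r" unfolding h by (intro SUP_upper2[of "1 / 2"]) auto
    then have "ereal b * ereal (- r) \<le> ereal b * h r" using b by (intro ereal_mult_left_mono) auto
    then have "ereal y \<le> ereal b * h r" using r by simp
    moreover have "ereal y \<le> ereal r" using y r by simp
    ultimately have "ereal y \<le> ?S1" using r by (intro SUP_upper2[of r]) auto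
    then show False using y by simp
  qed
  show "?S1 = R"
  proof (rule antisym)
    show "?S1 \<le> R"
    proof (rule SUP_least, rule dense_le)
      fix r x assume "x < min (ereal r) (ereal b * h r)"
      then have x: "x < ereal r" "x < ereal b * h r" by auto
      then show "x \<le> R" using key[OF _ scale] by (cases x) auto
    qed
    show "R \<le> ?S1"
      unfolding R_def
    proof (rule SUP_least)
      fix s :: real assume "s \<in> {0<..<1}"
      then have s: "0 < s" "s < 1" by auto
      define x where "x = - ln (\<phi> s) / (s * a + 1 - s)"
      have "ereal x \<le> ?S1"
      proof (cases "x = 0")
        case True
        then show ?thesis using S1_nonneg by (simp only: zero_ereal_def)
      next
        case False
        then show ?thesis using level[OF s x_def] by (intro S1_ge) linarith+
      qed
      then show "ereal (- ln (\<phi> s) / (s * a + 1 - s)) \<le> ?S1" by (simp only: x_def)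
    qed
  qed
  show "Sup {ereal r | r. 0 \<le> r \<and> ereal (a * r) \<le> h r} = R"
  proof (rule antisym)
    show "Sup {ereal r | r. 0 \<le> r \<and> ereal (a * r) \<le> h r} \<le> R"
    proof (rule Sup_least)
      fix z assume "z \<in> {ereal r | r. 0 \<le> r \<and> ereal (a * r) \<le> h r}"
      then obtain r where r: "z = ereal r" "ereal (a * r) \<le> h r" by auto
      show "z \<le> R"
      proof (rule dense_le)
        fix x assume "x < z"
        then show "x \<le> R"
        proof (cases x)
          case (real y)
          then have "ereal (a * y) < ereal (a * r)" using \<open>x < z\<close> r ab by simp
          with r(2) have "ereal (a * y) < h r" by (rule less_le_trans[rotated])
          then show ?thesis using real \<open>x < z\<close> r key by simp
        qed (use \<open>x < z\<close> r in auto)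
      qed
    qed
    show "R \<le> Sup {ereal r | r. 0 \<le> r \<and> ereal (a * r) \<le> h r}"
      unfolding R_def
    proof (rule SUP_least, rule Sup_upper)
      fix s :: real assume "s \<in> {0<..<1}"
      then have s: "0 < s" "s < 1" by auto
      define x where "x = - ln (\<phi> s) / (s * a + 1 - s)"
      have "ereal x \<in> {ereal r | r. 0 \<le> r \<and> ereal (a * r) \<le> h r}"
        using level[OF s x_def] by (intro CollectI exI[of _ x] conjI refl)
      then show "ereal (- ln (\<phi> s) / (s * a + 1 - s)) \<in> {ereal r | r. 0 \<le> r \<and> ereal (a * r) \<le> h r}"
        by (simp only: x_def)
    qed
  qed
qed

section \<open>The exponent of the test-measured divergence\<close>

text \<open>A factor that stays above 1/2 costs at most 2, so a small product forces the other
  factor to be small; taking the root turns 2 into \<open>2 powr (1 / t)\<close>.\<close>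

lemma le_of_powr_product_le:
  fixes u y s t z :: real
  assumes "1 / 2 \<le> u" "0 \<le> s" "s \<le> 1" "0 < t" "0 \<le> y" "u powr s * y powr t \<le> exp (- z)"
  shows "y \<le> 2 powr (1 / t) * exp (- z / t)"
proof -
  have "1 / 2 = (1 / 2) powr (1 :: real)" by simp
  also have "\<dots> \<le> (1 / 2) powr s" using assms by (intro powr_mono') auto
  also have "\<dots> \<le> u powr s" using assms by (intro powr_mono2) auto
  finally have "1 / 2 * y powr t \<le> u powr s * y powr t" by (intro mult_right_mono) auto
  with assms(6) have "y powr t \<le> 2 * exp (- z)" by linarith
  then have "(y powr t) powr (1 / t) \<le> (2 * exp (- z)) powr (1 / t)"
    using assms by (intro powr_mono2) auto
  also have "\<dots> = 2 powr (1 / t) * exp (- z / t)"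
    by (simp add: powr_mult exp_powr_real)
  finally show ?thesis using assms by (simp add: powr_powr)
qed

lemma eventually_real_gt: "\<forall>\<^sub>F n in sequentially. X < real n"
  using filterlim_real_sequentially by (simp add: filterlim_at_top_dense)

locale state_pair = sqmat +
  fixes U V :: "complex mat" and l m :: "nat \<Rightarrow> real" and \<alpha> :: real
  assumes U: "unitary U" and V: "unitary V"
    and l: "\<And>i. i < d \<Longrightarrow> 0 \<le> l i" and m: "\<And>i. i < d \<Longrightarrow> 0 \<le> m i"
    and tr_rho: "mtrace (spec U l) = 1" and tr_sigma: "mtrace (spec V m) = 1"
    and \<alpha>: "0 < \<alpha>" "\<alpha> < 1"
begin

abbreviation "\<rho> \<equiv> spec U l"
abbreviation "\<sigma> \<equiv> spec V m"

definition w :: "nat \<Rightarrow> nat \<Rightarrow> real" where "w i j = (cmod ((adj U * V) $$ (i, j)))\<^sup>2"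
definition p :: "nat \<Rightarrow> nat \<Rightarrow> real" where "p i j = l i * w i j"
definition q :: "nat \<Rightarrow> nat \<Rightarrow> real" where "q i j = m j * w i j"
definition \<phi> :: "real \<Rightarrow> real" where "\<phi> = chsum d p q"

text \<open>\<open>k s = s a + 1 - s\<close> below with \<open>a = (1 - \<alpha>) / \<alpha>\<close> comes from eliminating \<open>r\<close>:
  \<open>((s - 1) r - ln (\<phi> s)) / s \<ge> a r\<close> holds iff \<open>r \<le> - ln (\<phi> s) / k s\<close>.\<close>

definition a :: real where "a = (1 - \<alpha>) / \<alpha>"
definition k :: "real \<Rightarrow> real" where "k s = s * a + 1 - s"

lemma a_pos: "0 < a" using \<alpha> by (simp add: a_def)

lemma k_pos: "0 < s \<Longrightarrow> s < 1 \<Longrightarrow> 0 < k s"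
  using a_pos mult_pos_pos[of s a] unfolding k_def by linarith

text \<open>\<open>k s\<close> is a convex combination of a and 1. The bound, uniform in s, provides
  the exponential gap of the converse.\<close>

lemma k_ge: assumes "0 < s" "s < 1" shows "min 1 a \<le> k s"
proof -
  have "s * min 1 a + (1 - s) * min 1 a \<le> s * a + (1 - s) * 1"
    using assms by (intro add_mono mult_left_mono) auto
  then show ?thesis by (simp add: k_def algebra_simps)
qed

lemma w_nonneg: "0 \<le> w i j" by (simp add: w_def)

lemma p_nonneg: "i < d \<Longrightarrow> j < d \<Longrightarrow> 0 \<le> p i j" and q_nonneg: "i < d \<Longrightarrow> j < d \<Longrightarrow> 0 \<le> q i j"
  using l m w_nonneg by (simp_all add: p_def q_def)

lemma pq_powr: assumes "i < d" "j < d"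
  shows "p i j powr s * q i j powr (1 - s) = l i powr s * m j powr (1 - s) * w i j"
proof -
  have "w i j powr s * w i j powr (1 - s) = w i j"
    using w_nonneg[of i j] by (simp flip: powr_add)
  then show ?thesis
    using l[OF assms(1)] m[OF assms(2)] w_nonneg[of i j]
    unfolding p_def q_def by (simp add: powr_mult mult_ac)
qed

lemma \<phi>_eq: "\<phi> s = sum2 d (\<lambda>i j. l i powr s * m j powr (1 - s) * w i j)"
  unfolding \<phi>_def chsum_def by (rule sum2_cong) (rule pq_powr)

lemma petz_eq: "renyi_petz s \<rho> \<sigma> = (if \<phi> s = 0 then \<infinity> else ereal (ln (\<phi> s) / (s - 1)))"
proof -
  have 1: "op_pow \<rho> s = spec U (\<lambda>i. l i powr s)" by (rule op_pow_spec[OF U l])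
  have 2: "op_pow \<sigma> (1 - s) = spec V (\<lambda>i. m i powr (1 - s))" by (rule op_pow_spec[OF V m])
  have "Re (mtrace (op_pow \<rho> s * op_pow \<sigma> (1 - s))) = \<phi> s"
    unfolding 1 2 mtrace_spec_spec[OF unitaryD(1)[OF U] unitaryD(1)[OF V]]
    by (simp add: \<phi>_eq sum2_def w_def)
  then show ?thesis by (simp add: renyi_petz_def Let_def)
qed

text \<open>The rows and columns of \<open>w\<close> sum to 1; this is obtained by writing the
  identity as a spectral matrix in the other basis.\<close>

lemma sum_p: "sum2 d p = 1" and sum_q: "sum2 d q = 1"
proof -
  note c = unitaryD[OF U] unitaryD[OF V]
  have "complex_of_real (sum2 d p) = mtrace (\<rho> * spec V (\<lambda>_. 1))"
    unfolding mtrace_spec_spec[OF c(1) c(5)] by (simp add: sum2_def p_def[abs_def] w_def)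
  also have "\<dots> = 1" unfolding spec_one[OF V] using c tr_rho by (simp add: sq_one)
  finally show "sum2 d p = 1" by (simp only: of_real_eq_1_iff)
  have "complex_of_real (sum2 d q) = mtrace (spec U (\<lambda>_. 1) * \<sigma>)"
    unfolding mtrace_spec_spec[OF c(1) c(5)] by (simp add: sum2_def q_def[abs_def] w_def)
  also have "\<dots> = 1" unfolding spec_one[OF U] using c tr_sigma by (simp add: sq_one)
  finally show "sum2 d q = 1" by (simp only: of_real_eq_1_iff)
qed

lemma \<phi>_nonneg: "0 \<le> \<phi> s"
  unfolding \<phi>_def chsum_def by (rule sum2_nonneg) simp

text \<open>The weighted inequality of arithmetic and geometric means, pointwise.\<close>

lemma \<phi>_le_1: assumes "0 < s" "s < 1" shows "\<phi> s \<le> 1"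
proof -
  have "\<phi> s \<le> sum2 d (\<lambda>i j. s * p i j + (1 - s) * q i j)"
    unfolding \<phi>_def chsum_def
  proof (rule sum2_mono)
    fix i j assume "i < d" "j < d"
    then have pq: "0 \<le> p i j" "0 \<le> q i j" using p_nonneg q_nonneg by auto
    then consider "p i j = 0 \<or> q i j = 0" | "0 < p i j" "0 < q i j" by linarith
    then show "p i j powr s * q i j powr (1 - s) \<le> s * p i j + (1 - s) * q i j"
    proof cases
      case 1
      then show ?thesis using pq assms by auto
    next
      case 2
      then show ?thesis using assms by (intro Youngs_inequality_0) auto
    qed
  qed
  also have "\<dots> = 1" unfolding sum2_add sum2_cmult sum_p sum_q by simp
  finally show ?thesis .
qed

lemma overlap: assumes "\<phi> s \<noteq> 0" shows "\<exists>i j. i < d \<and> j < d \<and> 0 < p i j \<and> 0 < q i j"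
proof (rule ccontr)
  assume "\<not> ?thesis"
  then have "p i j = 0 \<or> q i j = 0" if "i < d" "j < d" for i j
    using p_nonneg[OF that] q_nonneg[OF that] that by (auto simp: less_le)
  then have "\<phi> s = sum2 d (\<lambda>i j. 0)"
    unfolding \<phi>_def chsum_def by (intro sum2_cong) auto
  with assms show False by simp
qed

text \<open>Whether \<phi> vanishes depends on the common support alone and not on the
  exponent.\<close>

lemma \<phi>_pos: assumes "\<phi> s \<noteq> 0" shows "0 < \<phi> t"
proof -
  obtain i j where ij: "i < d" "j < d" "0 < p i j" "0 < q i j" using overlap[OF assms] by blast
  then have "0 < p i j powr t * q i j powr (1 - t)" by simp
  also have "\<dots> \<le> \<phi> t" unfolding \<phi>_def chsum_def by (rule sum2_ge_term) (use ij in auto)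
  finally show ?thesis .
qed

section \<open>Tensor powers of the pair\<close>

abbreviation "\<rho>n n \<equiv> tensor_pow \<rho> n"
abbreviation "\<sigma>n n \<equiv> tensor_pow \<sigma> n"
abbreviation "ln' n \<equiv> \<lambda>i. prodfun d (\<lambda>i j. l i) n i i"
abbreviation "mn' n \<equiv> \<lambda>i. prodfun d (\<lambda>i j. m i) n i i"

lemma rhon_eq: "\<rho>n n = spec_mat (d ^ n) (tensor_pow U n) (ln' n)"
  and sigman_eq: "\<sigma>n n = spec_mat (d ^ n) (tensor_pow V n) (mn' n)"
  using unitaryD[OF U] unitaryD[OF V] by (simp_all add: tensor_pow_spec)

lemma ln'_nonneg: "i < d ^ n \<Longrightarrow> 0 \<le> ln' n i" and mn'_nonneg: "i < d ^ n \<Longrightarrow> 0 \<le> mn' n i"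
  using l m by (auto intro!: prodfun_nonneg)

lemma overlap_n: assumes "i < d ^ n" "j < d ^ n"
  shows "(cmod ((adj (tensor_pow U n) * tensor_pow V n) $$ (i, j)))\<^sup>2 = prodfun d w n i j"
proof -
  note c = unitaryD[OF U] unitaryD[OF V]
  have "adj (tensor_pow U n) * tensor_pow V n = tensor_pow (adj U * V) n"
    using c by (simp add: tensor_pow_adj[where d = d] tensor_pow_mult[where d = d])
  then show ?thesis
    using tensor_pow_norm[of "adj U * V" d i n j] c assms by (simp add: w_def[abs_def])
qed

lemma prodfun_p: "prodfun d p n i j = ln' n i * prodfun d w n i j"
  and prodfun_q: "prodfun d q n i j = mn' n j * prodfun d w n i j"
  using prodfun_fst[of d l n i j i] prodfun_snd[of d m n i j]
  by (simp_all add: p_def[abs_def] q_def[abs_def] prodfun_mult)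

lemma chernoff_n:
  "(\<Sum>i<d ^ n. \<Sum>j<d ^ n. ln' n i powr s * mn' n j powr (1 - s) * prodfun d w n i j) = \<phi> s ^ n"
proof -
  have "\<phi> s ^ n = sum2 (d ^ n) (prodfun d (\<lambda>i j. l i powr s * m j powr (1 - s) * w i j) n)"
    unfolding \<phi>_eq sum2_prodfun ..
  also have "\<dots> = sum2 (d ^ n) (\<lambda>i j. ln' n i powr s * mn' n j powr (1 - s) * prodfun d w n i j)"
  proof (rule sum2_cong)
    fix i j assume ij: "i < d ^ n" "j < d ^ n"
    have "prodfun d (\<lambda>i j. l i powr s) n i j = ln' n i powr s"
      using prodfun_powr[of d "\<lambda>i j. l i" i n j s] l ij prodfun_fst[of d l n i j i] by simp
    moreover have "prodfun d (\<lambda>i j. m j powr (1 - s)) n i j = mn' n j powr (1 - s)"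
      using prodfun_powr[of d "\<lambda>i j. m j" i n j "1 - s"] m ij prodfun_snd[of d m n i j] by simp
    ultimately show "prodfun d (\<lambda>i j. l i powr s * m j powr (1 - s) * w i j) n i j =
      ln' n i powr s * mn' n j powr (1 - s) * prodfun d w n i j"
      by (simp add: prodfun_mult)
  qed
  finally show ?thesis by (simp add: sum2_def)
qed

lemma unitary_n: "unitary_mat (d ^ n) (tensor_pow U n)" "unitary_mat (d ^ n) (tensor_pow V n)"
  using U V by (simp_all add: unitary_tensor_pow)

lemma rhon_smult: "spec_mat (d ^ n) (tensor_pow U n) (\<lambda>i. \<theta> * ln' n i) = complex_of_real \<theta> \<cdot>\<^sub>m \<rho>n n"
proof -
  interpret D: sqmat "d ^ n" .
  show ?thesis unfolding rhon_eq using D.unitaryD[OF unitary_n(1)] by (simp add: D.spec_smult)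
qed

lemma trace_rhon_smult:
  assumes "X \<in> carrier_mat (d ^ n) (d ^ n)"
  shows "Re (mtrace (spec_mat (d ^ n) (tensor_pow U n) (\<lambda>i. \<theta> * ln' n i) * X)) = \<theta> * Re (mtrace (\<rho>n n * X))"
proof -
  interpret D: sqmat "d ^ n" .
  have c: "\<rho>n n \<in> D.M" unfolding rhon_eq using D.unitaryD[OF unitary_n(1)] by simp
  have "(complex_of_real \<theta> \<cdot>\<^sub>m \<rho>n n) * X = complex_of_real \<theta> \<cdot>\<^sub>m (\<rho>n n * X)"
    using c assms by (rule mult_smult_assoc_mat)
  then show ?thesis
    unfolding rhon_smult using c assms by (simp add: D.mtrace_smult)
qed

text \<open>The weight is absorbed into the eigenvalues of the first operator and returns as
  \<theta>^s; multiplicativity of the Chernoff sum does the rest.\<close>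

lemma good_test:
  assumes "0 < s" "s < 1" "0 < \<theta>"
  shows "\<exists>T. test_op (d ^ n) T \<and>
    \<theta> * Re (mtrace (\<rho>n n * (1\<^sub>m (d ^ n) - T))) + Re (mtrace (\<sigma>n n * T)) \<le> \<theta> powr s * \<phi> s ^ n"
proof -
  interpret D: sqmat "d ^ n" .
  obtain T where T: "test_op (d ^ n) T"
    "Re (mtrace (spec_mat (d ^ n) (tensor_pow U n) (\<lambda>i. \<theta> * ln' n i) * (1\<^sub>m (d ^ n) - T))) + Re (mtrace (\<sigma>n n * T)) \<le>
    (\<Sum>i<d ^ n. \<Sum>j<d ^ n. (\<theta> * ln' n i) powr s * mn' n j powr (1 - s) *
      (cmod ((adj (tensor_pow U n) * tensor_pow V n) $$ (i, j)))\<^sup>2)"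
    unfolding sigman_eq
    using D.audenaert[OF unitary_n, of "\<lambda>i. \<theta> * ln' n i" "mn' n" s] ln'_nonneg mn'_nonneg assms
    by auto
  note T(2)
  also have "(\<Sum>i<d ^ n. \<Sum>j<d ^ n. (\<theta> * ln' n i) powr s * mn' n j powr (1 - s) *
      (cmod ((adj (tensor_pow U n) * tensor_pow V n) $$ (i, j)))\<^sup>2) =
    (\<Sum>i<d ^ n. \<Sum>j<d ^ n. \<theta> powr s * (ln' n i powr s * mn' n j powr (1 - s) * prodfun d w n i j))"
    using assms ln'_nonneg by (intro sum.cong refl) (simp add: overlap_n powr_mult mult_ac)
  also have "\<dots> = \<theta> powr s * \<phi> s ^ n"
    unfolding sum_distrib_left[symmetric] chernoff_n ..
  finally show ?thesis
    using T(1) trace_rhon_smult[of "1\<^sub>m (d ^ n) - T" n \<theta>] D.psdD[of "1\<^sub>m (d ^ n) - T"]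
    unfolding test_op_def by (intro exI[of _ T]) auto
qed

lemma test_lower:
  assumes "test_op (d ^ n) T" "0 < \<theta>"
  shows "sum2 (d ^ n) (\<lambda>i j. min (\<theta> * prodfun d p n i j) (prodfun d q n i j)) \<le>
    2 * (\<theta> * Re (mtrace (\<rho>n n * (1\<^sub>m (d ^ n) - T))) + Re (mtrace (\<sigma>n n * T)))"
proof -
  interpret D: sqmat "d ^ n" .
  have "sum2 (d ^ n) (\<lambda>i j. min (\<theta> * prodfun d p n i j) (prodfun d q n i j)) =
    (\<Sum>i<d ^ n. \<Sum>j<d ^ n. min (\<theta> * ln' n i * (cmod ((adj (tensor_pow U n) * tensor_pow V n) $$ (i, j)))\<^sup>2)
      (mn' n j * (cmod ((adj (tensor_pow U n) * tensor_pow V n) $$ (i, j)))\<^sup>2))"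
    unfolding sum2_def by (intro sum.cong refl) (simp add: overlap_n prodfun_p prodfun_q mult.assoc)
  also have "\<dots> \<le> 2 * (Re (mtrace (spec_mat (d ^ n) (tensor_pow U n) (\<lambda>i. \<theta> * ln' n i) * (1\<^sub>m (d ^ n) - T)))
      + Re (mtrace (\<sigma>n n * T)))"
    unfolding sigman_eq using assms ln'_nonneg mn'_nonneg
    by (intro D.nussbaum_szkola unitary_n) auto
  finally show ?thesis
    using assms trace_rhon_smult[of "1\<^sub>m (d ^ n) - T" n \<theta>] D.psdD[of "1\<^sub>m (d ^ n) - T"]
    unfolding test_op_def by auto
qed

section \<open>Errors of a test and its Renyi sum\<close>

definition err1 where "err1 n T = Re (mtrace (\<rho>n n * (1\<^sub>m (d ^ n) - T)))"
definition err2 where "err2 n T = Re (mtrace (\<sigma>n n * T))"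

lemma test_probs:
  assumes "test_op (d ^ n) T"
  shows "0 \<le> err1 n T" "0 \<le> err2 n T" "err1 n T \<le> 1" "err2 n T \<le> 1"
    "Re (mtrace (\<rho>n n * T)) = 1 - err1 n T"
    "Re (mtrace (\<sigma>n n * (1\<^sub>m (d ^ n) - T))) = 1 - err2 n T"
proof -
  interpret D: sqmat "d ^ n" .
  have T: "D.psd T" "D.psd (1\<^sub>m (d ^ n) - T)" using assms by (auto simp: test_op_def)
  have R: "D.psd (\<rho>n n)" unfolding rhon_eq
    using D.unitaryD[OF unitary_n(1)] ln'_nonneg by (intro D.psd_spec) auto
  have S: "D.psd (\<sigma>n n)" unfolding sigman_eq
    using D.unitaryD[OF unitary_n(2)] mn'_nonneg by (intro D.psd_spec) auto
  show e: "0 \<le> err1 n T" "0 \<le> err2 n T"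
    unfolding err1_def err2_def by (intro D.psd_trace_mult R S T)+
  have "mtrace (\<rho>n n) = 1" "mtrace (\<sigma>n n) = 1"
    using unitaryD[OF U] unitaryD[OF V] tr_rho tr_sigma by (simp_all add: mtrace_tensor_pow[where d = d])
  then show eq: "Re (mtrace (\<rho>n n * T)) = 1 - err1 n T"
    "Re (mtrace (\<sigma>n n * (1\<^sub>m (d ^ n) - T))) = 1 - err2 n T"
    unfolding err1_def err2_def using D.psdD[OF R] D.psdD[OF S] D.psdD[OF T(1)]
    by (simp_all add: D.sq_distrib D.mtrace_minus D.sq_one)
  show "err1 n T \<le> 1" "err2 n T \<le> 1"
    using D.psd_trace_mult[OF R T(1)] D.psd_trace_mult[OF S T(2)] eq by linarith+
qed

text \<open>The sum inside the two-outcome Renyi divergence. It is small when both errors are near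
  0, but equally when both are near 1, since the outcomes may be relabelled.\<close>

definition Q where
  "Q n T = (1 - err1 n T) powr \<alpha> * err2 n T powr (1 - \<alpha>) + err1 n T powr \<alpha> * (1 - err2 n T) powr (1 - \<alpha>)"

lemma renyi_cl_eq: assumes "test_op (d ^ n) T"
  shows "renyi_cl \<alpha> UNIV (test_distr (d ^ n) T (\<rho>n n)) (test_distr (d ^ n) T (\<sigma>n n)) =
    (if Q n T = 0 then \<infinity> else ereal (ln (Q n T) / (\<alpha> - 1)))"
proof -
  have "(\<Sum>\<omega>\<in>UNIV. test_distr (d ^ n) T (\<rho>n n) \<omega> powr \<alpha> * test_distr (d ^ n) T (\<sigma>n n) \<omega> powr (1 - \<alpha>)) = Q n T"
    using test_probs(5,6)[OF assms] by (simp add: UNIV_bool test_distr_def Q_def err1_def err2_def)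
  then show ?thesis by (simp add: renyi_cl_def)
qed

abbreviation "D n \<equiv> renyi_test (d ^ n) \<alpha> (\<rho>n n) (\<sigma>n n)"

text \<open>As \<alpha> - 1 is negative, one test with small \<open>Q\<close> forces a large
  divergence. A vanishing \<open>Q\<close> is included, the classical divergence being infinite
  there.\<close>

lemma D_ge: assumes "test_op (d ^ n) T" "Q n T \<le> exp (- (1 - \<alpha>) * x)" shows "ereal x \<le> D n"
proof -
  have "0 \<le> Q n T" by (simp add: Q_def)
  have "ln (Q n T) \<le> - (1 - \<alpha>) * x" if "Q n T \<noteq> 0"
    using that \<open>0 \<le> Q n T\<close> assms(2) by (metis less_le ln_exp ln_mono exp_gt_zero)
  then have "x \<le> ln (Q n T) / (\<alpha> - 1)" if "Q n T \<noteq> 0"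
    using that \<alpha> by (simp add: neg_le_divide_eq algebra_simps)
  then have "ereal x \<le> renyi_cl \<alpha> UNIV (test_distr (d ^ n) T (\<rho>n n)) (test_distr (d ^ n) T (\<sigma>n n))"
    unfolding renyi_cl_eq[OF assms(1)] by simp
  also have "\<dots> \<le> D n" unfolding renyi_test_def using assms(1) by (intro SUP_upper) simp
  finally show ?thesis .
qed

lemma D_le: assumes "\<And>T. test_op (d ^ n) T \<Longrightarrow> exp (- (1 - \<alpha>) * x) \<le> Q n T" shows "D n \<le> ereal x"
  unfolding renyi_test_def
proof (rule SUP_least)
  fix T assume "T \<in> {T. test_op (d ^ n) T}"
  then have T: "test_op (d ^ n) T" by simp
  have pos: "0 < Q n T" using assms[OF T] exp_gt_zero less_le_trans by blast
  then have "- (1 - \<alpha>) * x \<le> ln (Q n T)" using assms[OF T] by (simp add: ln_ge_iff)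
  then have "ln (Q n T) / (\<alpha> - 1) \<le> x" using \<alpha> by (simp add: neg_divide_le_eq algebra_simps)
  then show "renyi_cl \<alpha> UNIV (test_distr (d ^ n) T (\<rho>n n)) (test_distr (d ^ n) T (\<sigma>n n)) \<le> ereal x"
    unfolding renyi_cl_eq[OF T] using pos by simp
qed

section \<open>Achievability\<close>

lemma D_infinite: assumes "0 < s" "s < 1" "\<phi> s = 0" "0 < n" shows "D n = \<infinity>"
proof (rule ereal_top)
  fix x
  \<comment> \<open>Weight 1 already suffices: the error bound is 0 ^ n, which vanishes as n is
    positive.\<close>
  obtain T where T: "test_op (d ^ n) T" "err1 n T + err2 n T \<le> 0"
    using good_test[of s 1 n] assms by (auto simp: err1_def err2_def power_0_left)
  then have "err1 n T = 0" "err2 n T = 0" using test_probs[OF T(1)] by linarith+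
  then have "Q n T = 0" by (simp add: Q_def)
  then show "ereal x \<le> D n" by (intro D_ge[OF T(1)]) simp
qed

text \<open>Each of the two summands of \<open>Q\<close> is at most exp (- (1 - \<alpha>) n x);
  their number 2 produces the constant loss ln 2 / (1 - \<alpha>).\<close>

lemma D_achieves: assumes "0 < s" "s < 1" "\<phi> s \<noteq> 0"
  shows "ereal (real n * (- ln (\<phi> s) / k s) - ln 2 / (1 - \<alpha>)) \<le> D n"
proof -
  define x where "x = - ln (\<phi> s) / k s"
  have xk: "x * k s = - ln (\<phi> s)" using k_pos[OF assms(1,2)] by (simp add: x_def)
  \<comment> \<open>Chosen so that c s + ln (\<phi> s) = - x, which makes the weighted error bound
    exp (- n x).\<close>
  define c where "c = x * a - x"
  have pos: "0 < \<phi> s" using \<phi>_pos[OF assms(3)] .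
  obtain T where T: "test_op (d ^ n) T"
    "exp (real n * c) * err1 n T + err2 n T \<le> exp (real n * c) powr s * \<phi> s ^ n"
    using good_test[OF assms(1,2), of "exp (real n * c)" n] by (auto simp: err1_def err2_def)
  have "exp (real n * c) powr s * \<phi> s ^ n = exp (real n * (c * s + ln (\<phi> s)))"
  proof -
    have "\<phi> s ^ n = exp (real n * ln (\<phi> s))" using pos by (simp add: exp_of_nat_mult)
    then show ?thesis by (simp add: exp_powr_real distrib_left exp_add mult.assoc)
  qed
  also have "c * s + ln (\<phi> s) = - x"
    using xk by (simp add: c_def k_def algebra_simps)
  finally have T2: "exp (real n * c) * err1 n T + err2 n T \<le> exp (- (real n * x))" using T(2) by simp
  note e = test_probs[OF T(1)]
  have 2: "err2 n T \<le> exp (- (real n * x))"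
    using T2 e(1) by (smt (verit) exp_gt_zero mult_nonneg_nonneg)
  have "exp (real n * c) * err1 n T \<le> exp (- (real n * x))" using T2 e(2) by linarith
  then have scaled: "exp (- (real n * c)) * (exp (real n * c) * err1 n T) \<le> exp (- (real n * c)) * exp (- (real n * x))"
    by (intro mult_left_mono) auto
  have 1: "err1 n T \<le> exp (- (real n * (x * a)))"
  proof -
    have "exp (- (real n * c)) * (exp (real n * c) * err1 n T) = err1 n T"
      by (simp add: mult.assoc[symmetric] exp_add[symmetric])
    moreover have "exp (- (real n * c)) * exp (- (real n * x)) = exp (- (real n * (x * a)))"
      unfolding exp_add[symmetric] by (simp add: c_def algebra_simps)
    ultimately show ?thesis using scaled by (simp only:)
  qed
  have "(1 - err1 n T) powr \<alpha> * err2 n T powr (1 - \<alpha>) \<le> 1 powr \<alpha> * exp (- (real n * x)) powr (1 - \<alpha>)"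
    using \<alpha> e 2 by (intro mult_mono powr_mono2) auto
  moreover have "err1 n T powr \<alpha> * (1 - err2 n T) powr (1 - \<alpha>) \<le> exp (- (real n * (x * a))) powr \<alpha> * 1 powr (1 - \<alpha>)"
    using \<alpha> e 1 by (intro mult_mono powr_mono2) auto
  moreover have "exp (- (real n * (x * a))) powr \<alpha> = exp (- (1 - \<alpha>) * (real n * x))"
    using \<alpha> by (simp add: exp_powr_real a_def field_simps)
  moreover have "exp (- (real n * x)) powr (1 - \<alpha>) = exp (- (1 - \<alpha>) * (real n * x))"
    by (simp add: exp_powr_real algebra_simps)
  ultimately have "Q n T \<le> 2 * exp (- (1 - \<alpha>) * (real n * x))" unfolding Q_def by simp
  also have "\<dots> = exp (ln 2 + - (1 - \<alpha>) * (real n * x))" by (simp only: exp_add exp_ln zero_less_numeral)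
  also have "ln 2 + - (1 - \<alpha>) * (real n * x) = - (1 - \<alpha>) * (real n * x - ln 2 / (1 - \<alpha>))"
    using \<alpha> by (simp add: field_simps)
  finally show ?thesis unfolding x_def[symmetric] by (rule D_ge[OF T(1)])
qed

section \<open>Converse\<close>

lemma D_converse_aux:
  assumes x: "2 powr (1 / (1 - \<alpha>)) * exp (- x) \<le> 1 / 2"
    and e: "0 \<le> e" "e \<le> 1" "0 \<le> b" "b \<le> 1" and e2: "e \<le> 1 / 2"
    and 1: "(1 - e) powr \<alpha> * b powr (1 - \<alpha>) \<le> exp (- (1 - \<alpha>) * x)"
    and 2: "e powr \<alpha> * (1 - b) powr (1 - \<alpha>) \<le> exp (- (1 - \<alpha>) * x)"
  shows "exp (x * a - x) * e + b \<le> (2 powr (1 / \<alpha>) + 2 powr (1 / (1 - \<alpha>))) * exp (- x)"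
proof -
  have z: "- (1 - \<alpha>) * x = - ((1 - \<alpha>) * x)" by (simp only: mult_minus_left)
  \<comment> \<open>As 1 - e is at least 1/2, the first summand alone controls b.\<close>
  have "b \<le> 2 powr (1 / (1 - \<alpha>)) * exp (- ((1 - \<alpha>) * x) / (1 - \<alpha>))"
    by (rule le_of_powr_product_le[OF _ _ _ _ _ 1[unfolded z]]) (use e e2 \<alpha> in auto)
  then have b: "b \<le> 2 powr (1 / (1 - \<alpha>)) * exp (- x)" using \<alpha> by simp
  \<comment> \<open>The assumption on x now gives 1 - b >= 1/2, so the second summand controls e in
    turn.\<close>
  with x have "b \<le> 1 / 2" by linarith
  then have "e \<le> 2 powr (1 / \<alpha>) * exp (- ((1 - \<alpha>) * x) / \<alpha>)"
    by (intro le_of_powr_product_le[of "1 - b" "1 - \<alpha>"])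
      (use e \<alpha> 2[unfolded z] in \<open>simp_all add: mult.commute\<close>)
  also have "- ((1 - \<alpha>) * x) / \<alpha> = - (x * a)" by (simp add: a_def)
  finally have "exp (x * a - x) * e \<le> exp (x * a - x) * (2 powr (1 / \<alpha>) * exp (- (x * a)))"
    by (intro mult_left_mono) auto
  also have "\<dots> = 2 powr (1 / \<alpha>) * (exp (x * a - x) * exp (- (x * a)))" by (simp add: mult_ac)
  also have "exp (x * a - x) * exp (- (x * a)) = exp (- x)" by (simp flip: exp_add)
  finally show ?thesis using b by (simp add: distrib_right)
qed

text \<open>A test beating the rate R would have weighted error at most K exp (- n R), whereas the
  Chernoff bound forces at least exp (n \<delta> / 2) exp (- n R) / 2. These contradict each other
  for large n.\<close>

lemma D_converse:
  assumes ov: "\<phi> s0 \<noteq> 0" and R0: "0 \<le> R0" "\<And>s. 0 < s \<Longrightarrow> s < 1 \<Longrightarrow> - ln (\<phi> s) / k s \<le> R0" and R: "R0 < R"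
  shows "\<forall>\<^sub>F n in sequentially. D n \<le> ereal (real n * R)"
proof -
  define c where "c = R * a - R"
  \<comment> \<open>The exponent c t + ln (\<phi> t) is at least (R - R0) k t - R;
    \<open>k_ge\<close> makes the gain above - R uniform in t.\<close>
  define \<delta> where "\<delta> = (R - R0) * min 1 a"
  have \<delta>: "0 < \<delta>" using R a_pos by (simp add: \<delta>_def)
  define P where "P i j = exp c * p i j" for i j
  have P: "0 \<le> P i j" if "i < d" "j < d" for i j using p_nonneg[OF that] by (simp add: P_def)
  obtain i0 j0 where ij: "i0 < d" "j0 < d" "0 < p i0 j0" "0 < q i0 j0" using overlap[OF ov] by blast
  obtain s v where s: "0 \<le> s" "s \<le> 1" "0 < chsum d P q s"
    and low: "\<And>n c. 0 < c \<Longrightarrow> real n * v \<le> c\<^sup>2 \<Longrightarrow>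
      chsum d P q s ^ n * exp (- c) \<le> sum2 (d ^ n) (\<lambda>i j. min (prodfun d P n i j) (prodfun d q n i j))"
    using chernoff_lower_bound[of d P q i0 j0] P q_nonneg ij by (auto simp: P_def)
  have interior: "exp (\<delta> - R) \<le> chsum d P q t" if t: "0 < t" "t < 1" for t
  proof -
    have pos: "0 < \<phi> t" using \<phi>_pos[OF ov] .
    have "chsum d P q t = sum2 d (\<lambda>i j. exp (c * t) * (p i j powr t * q i j powr (1 - t)))"
      unfolding chsum_def using p_nonneg
      by (intro sum2_cong) (simp add: P_def powr_mult exp_powr_real mult.assoc)
    also have "\<dots> = exp (c * t) * \<phi> t" unfolding sum2_cmult \<phi>_def chsum_def ..
    also have "\<dots> = exp (c * t + ln (\<phi> t))" using pos by (simp add: exp_add)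
    finally have eq: "chsum d P q t = exp (c * t + ln (\<phi> t))" .
    have "- ln (\<phi> t) \<le> R0 * k t" using R0(2)[OF t] unfolding pos_divide_le_eq[OF k_pos[OF t]] .
    moreover have "\<delta> \<le> (R - R0) * k t" unfolding \<delta>_def using R k_ge[OF t] by (intro mult_left_mono) auto
    moreover have "c * t = R * k t - R" by (simp add: c_def k_def algebra_simps)
    ultimately have "\<delta> - R \<le> c * t + ln (\<phi> t)" by (simp add: algebra_simps)
    then show ?thesis unfolding eq by simp
  qed
  \<comment> \<open>The minimiser s may be 0 or 1, where the hypothesis on R0 is silent. Shifting it
    slightly towards 1/2 gives interior points converging to s.\<close>
  have Z: "exp (\<delta> - R) \<le> chsum d P q s"
  proof -
    define t where "t n = s + (1 / 2 - s) * (1 / real (n + 2))" for n :: nat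
    have "(\<lambda>n. 1 / real (n + 2)) \<longlonglongrightarrow> 0"
      using LIMSEQ_ignore_initial_segment[OF lim_1_over_n, of 2] by simp
    then have "t \<longlonglongrightarrow> s + (1 / 2 - s) * 0" unfolding t_def by (intro tendsto_intros)
    then have "t \<longlonglongrightarrow> s" by simp
    moreover have "isCont (chsum d P q) s"
      by (rule DERIV_isCont[OF chsum_deriv[OF P q_nonneg]])
    ultimately have lim: "(\<lambda>n. chsum d P q (t n)) \<longlonglongrightarrow> chsum d P q s"
      by (rule isCont_tendsto_compose[rotated])
    have "0 < t n" "t n < 1" for n
    proof -
      define u where "u = 1 / real (n + 2)"
      have u: "0 < u" "u < 1" by (simp_all add: u_def)
      have t: "t n = s * (1 - u) + u / 2" unfolding t_def u_def[symmetric] by (simp add: field_simps)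
      have "0 \<le> s * (1 - u)" "s * (1 - u) \<le> 1 - u" using s u by (simp_all add: mult_left_le_one_le)
      with u t show "0 < t n" "t n < 1" by linarith+
    qed
    then show ?thesis using lim interior by (intro LIMSEQ_le_const[OF lim]) auto
  qed
  \<comment> \<open>The loss in \<open>D_converse_aux\<close>. The thresholds on n below ensure, in
    turn, that n is positive, that n v fits into (n \<delta> / 2)^2, that exp (- x) is small enough
    for that lemma, and that exp (n \<delta> / 2) exceeds 2 K.\<close>
  define K where "K = 2 powr (1 / \<alpha>) + 2 powr (1 / (1 - \<alpha>))"
  have K: "0 < K" by (simp add: K_def add_pos_pos)
  have "0 < R" using R0 R by simp
  have "\<forall>\<^sub>F n in sequentially. 0 < real n \<and> 4 * v / \<delta>\<^sup>2 < real n \<and>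
      ln (2 * 2 powr (1 / (1 - \<alpha>))) / R < real n \<and> 2 * ln (2 * K) / \<delta> < real n"
    by (intro eventually_conj eventually_real_gt)
  then show ?thesis
  proof eventually_elim
    case (elim n)
    define x where "x = real n * R"
    have nv: "real n * v \<le> (real n * \<delta> / 2)\<^sup>2"
    proof -
      have "4 * v < real n * \<delta>\<^sup>2" using elim \<delta> by (simp add: pos_divide_less_eq)
      then have "real n * (4 * v) \<le> real n * (real n * \<delta>\<^sup>2)" using elim by (intro mult_left_mono) auto
      then show ?thesis by (simp add: power2_eq_square field_simps)
    qed
    have x: "2 powr (1 / (1 - \<alpha>)) * exp (- x) \<le> 1 / 2"
    proof -
      have "ln (2 * 2 powr (1 / (1 - \<alpha>))) < x" using elim \<open>0 < R\<close> by (simp add: pos_divide_less_eq x_def)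
      then have "exp (ln (2 * 2 powr (1 / (1 - \<alpha>)))) < exp x" by (simp only: exp_less_cancel_iff)
      then have "2 * 2 powr (1 / (1 - \<alpha>)) < exp x" by simp
      then show ?thesis by (simp add: exp_minus field_simps)
    qed
    have big: "2 * K < exp (real n * \<delta> / 2)"
    proof -
      have "2 * ln (2 * K) < real n * \<delta>" using elim \<delta> by (simp add: pos_divide_less_eq)
      then have "exp (ln (2 * K)) < exp (real n * \<delta> / 2)" by simp
      then show ?thesis using K by simp
    qed
    have pfP: "prodfun d P n i j = exp (x * a - x) * prodfun d p n i j" for i j
      unfolding P_def[abs_def] prodfun_cmult exp_of_nat_mult[symmetric]
      by (simp add: c_def x_def algebra_simps)
    have "exp (real n * (\<delta> - R)) * exp (- (real n * \<delta> / 2)) \<le> chsum d P q s ^ n * exp (- (real n * \<delta> / 2))"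
      unfolding exp_of_nat_mult using Z by (intro mult_right_mono power_mono) auto
    also have "\<dots> \<le> sum2 (d ^ n) (\<lambda>i j. min (exp (x * a - x) * prodfun d p n i j) (prodfun d q n i j))"
      using low[OF _ nv] elim \<delta> unfolding pfP by simp
    finally have lower: "exp (real n * \<delta> / 2) * exp (- x) \<le>
        sum2 (d ^ n) (\<lambda>i j. min (exp (x * a - x) * prodfun d p n i j) (prodfun d q n i j))"
      by (simp add: x_def algebra_simps flip: exp_add)
    have no_good: False if T: "test_op (d ^ n) T" "exp (x * a - x) * err1 n T + err2 n T \<le> K * exp (- x)" for T
    proof -
      note lower
      also note test_lower[OF T(1) exp_gt_zero[of "x * a - x"], folded err1_def err2_def]
      also have "2 * (exp (x * a - x) * err1 n T + err2 n T) \<le> 2 * (K * exp (- x))"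
        using T(2) by (rule mult_left_mono) simp
      finally have "exp (real n * \<delta> / 2) * exp (- x) \<le> 2 * K * exp (- x)" by (simp only: mult.assoc)
      moreover have "2 * K * exp (- x) < exp (real n * \<delta> / 2) * exp (- x)"
        by (rule mult_strict_right_mono[OF big exp_gt_zero])
      ultimately show False by (meson not_less)
    qed
    have no_better: False if T: "test_op (d ^ n) T" and Q: "Q n T < exp (- (1 - \<alpha>) * x)" for T
    proof -
      note e = test_probs[OF T]
      have "0 \<le> (1 - err1 n T) powr \<alpha> * err2 n T powr (1 - \<alpha>)" "0 \<le> err1 n T powr \<alpha> * (1 - err2 n T) powr (1 - \<alpha>)"
        by (intro mult_nonneg_nonneg powr_ge_zero)+
      with Q have 1: "(1 - err1 n T) powr \<alpha> * err2 n T powr (1 - \<alpha>) \<le> exp (- (1 - \<alpha>) * x)"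
        and 2: "err1 n T powr \<alpha> * (1 - err2 n T) powr (1 - \<alpha>) \<le> exp (- (1 - \<alpha>) * x)"
        unfolding Q_def by linarith+
      show False
      proof (cases "err1 n T \<le> 1 / 2")
        case True
        show False
          by (rule no_good[OF T D_converse_aux[OF x e(1,3,2,4) True 1 2, folded K_def]])
      next
        case False
        \<comment> \<open>If the first error exceeds 1/2, the complementary test is used: both
          errors become their complements and the two summands trade places.\<close>
        interpret D: sqmat "d ^ n" .
        have cT: "T \<in> D.M" using T D.psdD by (auto simp: test_op_def)
        have T': "1\<^sub>m (d ^ n) - (1\<^sub>m (d ^ n) - T) = T" using cT by (intro eq_matI) auto
        then have test': "test_op (d ^ n) (1\<^sub>m (d ^ n) - T)" using T by (simp add: test_op_def)
        have e': "err1 n (1\<^sub>m (d ^ n) - T) = 1 - err1 n T" "err2 n (1\<^sub>m (d ^ n) - T) = 1 - err2 n T"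
          unfolding err1_def[of n "1\<^sub>m (d ^ n) - T"] err2_def[of n "1\<^sub>m (d ^ n) - T"] T'
          by (rule e(5), rule e(6))
        have "exp (x * a - x) * (1 - err1 n T) + (1 - err2 n T) \<le>
          (2 powr (1 / \<alpha>) + 2 powr (1 / (1 - \<alpha>))) * exp (- x)"
          by (rule D_converse_aux[OF x]) (use e False 1 2 in simp_all)
        then show False unfolding K_def[symmetric] e'[symmetric] by (rule no_good[OF test'])
      qed
    qed
    have "D n \<le> ereal x"
      by (rule D_le) (meson no_better not_less)
    then show "D n \<le> ereal (real n * R)" by (simp only: x_def)
  qed
qed

section \<open>Passage to the limit\<close>

definition R where "R = (SUP s\<in>{0<..<1}. ereal (- ln (\<phi> s) / k s))"

text \<open>From below, the constant loss of \<open>D_achieves\<close> disappears after division by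
  n. From above, the converse applies to every real number beyond R; if R is infinite there is
  nothing to show there.\<close>

lemma limit_finite: assumes ov: "\<phi> s0 \<noteq> 0"
  shows "(\<lambda>n. D n / ereal (real n)) \<longlonglongrightarrow> R"
proof (rule order_tendstoI)
  fix y assume "y < R"
  then obtain s where s: "0 < s" "s < 1" "y < ereal (- ln (\<phi> s) / k s)"
    unfolding R_def less_SUP_iff by auto
  define x where "x = - ln (\<phi> s) / k s"
  obtain z where z: "y < ereal z" "z < x" using ereal_dense2[OF s(3)] x_def by auto
  have "\<forall>\<^sub>F n in sequentially. 0 < real n \<and> ln 2 / (1 - \<alpha>) / (x - z) < real n"
    by (intro eventually_conj eventually_real_gt)
  then show "\<forall>\<^sub>F n in sequentially. y < D n / ereal (real n)"
  proof eventually_elim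
    case (elim n)
    have "ln 2 / (1 - \<alpha>) / (x - z) < real n" using elim by blast
    then have "ln 2 / (1 - \<alpha>) < real n * (x - z)" using z by (subst (asm) pos_divide_less_eq) auto
    then have "real n * z \<le> real n * x - ln 2 / (1 - \<alpha>)" by (simp add: algebra_simps)
    then have "ereal (real n * z) \<le> D n"
      using D_achieves[OF s(1,2) less_imp_neq[OF \<phi>_pos[OF ov], symmetric], of n]
      unfolding x_def[symmetric] by (meson ereal_less_eq(3) order_trans)
    then have "ereal z \<le> D n / ereal (real n)" using elim by (subst ereal_le_divide_pos) auto
    with z show ?case by simp
  qed
next
  fix y assume y: "R < y"
  have nonneg: "0 \<le> - ln (\<phi> s) / k s" if "0 < s" "s < 1" for s
    using \<phi>_le_1[OF that] \<phi>_pos[OF ov, of s] k_pos[OF that] by (intro divide_nonneg_pos) auto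
  have R_ge: "ereal (- ln (\<phi> s) / k s) \<le> R" if "0 < s" "s < 1" for s
    unfolding R_def using that by (intro SUP_upper) auto
  have "0 \<le> ereal (- ln (\<phi> (1 / 2)) / k (1 / 2))" using nonneg[of "1 / 2"] by simp
  also have "\<dots> \<le> R" by (rule R_ge) auto
  finally have "0 \<le> R" .
  \<comment> \<open>A strict upper bound y rules out an infinite R, and nonnegativity rules out
    minus infinity.\<close>
  with y obtain R0 where R0: "R = ereal R0" "0 \<le> R0" by (cases R) auto
  obtain R1 where R1: "R0 < R1" "ereal R1 < y" using ereal_dense2[OF y] R0 by auto
  have "\<forall>\<^sub>F n in sequentially. D n \<le> ereal (real n * R1)"
    by (rule D_converse[OF ov R0(2) R_ge[unfolded R0(1) ereal_less_eq(3)] R1(1)])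
  moreover have "\<forall>\<^sub>F n in sequentially. 0 < real n" by (rule eventually_real_gt)
  ultimately show "\<forall>\<^sub>F n in sequentially. D n / ereal (real n) < y"
  proof eventually_elim
    case (elim n)
    then have "D n / ereal (real n) \<le> ereal R1" by (subst ereal_divide_le_pos) auto
    with R1 show ?case by simp
  qed
qed

lemma hoeffding_finite: assumes ov: "\<phi> s0 \<noteq> 0"
  shows "hoeffding r \<rho> \<sigma> = (SUP s\<in>{0<..<1}. ereal (((s - 1) * r - ln (\<phi> s)) / s))"
  unfolding hoeffding_def
proof (rule SUP_cong[OF refl])
  fix s :: real assume "s \<in> {0<..<1}"
  then have "(s - 1) / s * (r - ln (\<phi> s) / (s - 1)) = ((s - 1) * r - ln (\<phi> s)) / s"
    by (simp add: field_simps)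
  then show "ereal ((s - 1) / s) * (ereal r - renyi_petz s \<rho> \<sigma>) = ereal (((s - 1) * r - ln (\<phi> s)) / s)"
    using \<phi>_pos[OF ov, of s] by (simp add: petz_eq)
qed

lemma SUP_ereal_unbounded: "(SUP r\<in>{0<..}. ereal r) = \<infinity>"
proof (rule ereal_top)
  fix B :: real
  show "ereal B \<le> (SUP r\<in>{0<..}. ereal r)" by (rule SUP_upper2[of "\<bar>B\<bar> + 1"]) auto
qed

theorem test_divergence_limit:
  shows "(\<lambda>n. D n / ereal (real n)) \<longlonglongrightarrow> renyi_test_reg d \<alpha> \<rho> \<sigma>"
    and "renyi_test_reg d \<alpha> \<rho> \<sigma> =
        (SUP r \<in> {0<..}. min (ereal r) (ereal (\<alpha> / (1 - \<alpha>)) * hoeffding r \<rho> \<sigma>))"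
    and "(SUP r \<in> {0<..}. min (ereal r) (ereal (\<alpha> / (1 - \<alpha>)) * hoeffding r \<rho> \<sigma>)) =
        Sup {ereal r | r. 0 \<le> r \<and> ereal ((1 - \<alpha>) / \<alpha> * r) \<le> hoeffding r \<rho> \<sigma>}"
proof -
  \<comment> \<open>Exhibiting one common value L makes the limit superior agree with the limit and
    links all three expressions.\<close>
  have "\<exists>L. ((\<lambda>n. D n / ereal (real n)) \<longlonglongrightarrow> L) \<and>
      (SUP r \<in> {0<..}. min (ereal r) (ereal (\<alpha> / (1 - \<alpha>)) * hoeffding r \<rho> \<sigma>)) = L \<and>
      Sup {ereal r | r. 0 \<le> r \<and> ereal ((1 - \<alpha>) / \<alpha> * r) \<le> hoeffding r \<rho> \<sigma>} = L"
  \<comment> \<open>The order 1/2 stands for all orders, by \<open>\<phi>_pos\<close>.\<close>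
  proof (cases "\<phi> (1 / 2) = 0")
    case False
    have "0 < \<phi> s \<and> \<phi> s \<le> 1" if "0 < s" "s < 1" for s
      using \<phi>_le_1[OF that] \<phi>_pos[OF False, of s] by simp
    note h = hoeffding_level_sup[of \<phi> a "\<alpha> / (1 - \<alpha>)" "\<lambda>r. hoeffding r \<rho> \<sigma>",
        OF this a_pos _ hoeffding_finite[OF False]]
    have "a * (\<alpha> / (1 - \<alpha>)) = 1" using \<alpha> by (simp add: a_def)
    from h[OF _ _ this] limit_finite[OF False] show ?thesis
      unfolding R_def k_def a_def by (intro exI conjI) auto
  next
    case True
    have zero: "\<phi> s = 0" for s using \<phi>_pos[of s "1 / 2"] True by auto
    \<comment> \<open>With orthogonal supports the Petz divergence is infinite, and the negative
      factor (s - 1) / s turns r - \<infinity> into + \<infinity>; a single order suffices.\<close>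
    have h: "hoeffding r \<rho> \<sigma> = \<infinity>" for r
    proof -
      have "ereal ((1 / 2 - 1) / (1 / 2)) * (ereal r - renyi_petz (1 / 2) \<rho> \<sigma>) \<le> hoeffding r \<rho> \<sigma>"
        unfolding hoeffding_def by (intro SUP_upper) auto
      then show ?thesis by (simp add: petz_eq zero)
    qed
    have "\<forall>\<^sub>F n in sequentially. D n / ereal (real n) = \<infinity>"
      using eventually_gt_at_top[of 0]
    proof eventually_elim
      case (elim n)
      then show ?case using D_infinite[of "1 / 2" n] zero by simp
    qed
    then have "(\<lambda>n. D n / ereal (real n)) \<longlonglongrightarrow> \<infinity>" by (rule tendsto_eventually)
    moreover have "(SUP r \<in> {0<..}. min (ereal r) (ereal (\<alpha> / (1 - \<alpha>)) * hoeffding r \<rho> \<sigma>)) = \<infinity>"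
      unfolding h using \<alpha> SUP_ereal_unbounded by simp
    moreover have "Sup {ereal r | r. 0 \<le> r \<and> ereal ((1 - \<alpha>) / \<alpha> * r) \<le> hoeffding r \<rho> \<sigma>} = \<infinity>"
    proof (rule ereal_top)
      fix B :: real
      show "ereal B \<le> Sup {ereal r | r. 0 \<le> r \<and> ereal ((1 - \<alpha>) / \<alpha> * r) \<le> hoeffding r \<rho> \<sigma>}"
        by (rule Sup_upper2[of "ereal \<bar>B\<bar>"]) (auto simp: h)
    qed
    ultimately show ?thesis by blast
  qed
  then obtain L where L: "(\<lambda>n. D n / ereal (real n)) \<longlonglongrightarrow> L"
    "(SUP r \<in> {0<..}. min (ereal r) (ereal (\<alpha> / (1 - \<alpha>)) * hoeffding r \<rho> \<sigma>)) = L"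
    "Sup {ereal r | r. 0 \<le> r \<and> ereal ((1 - \<alpha>) / \<alpha> * r) \<le> hoeffding r \<rho> \<sigma>} = L" by blast
  have "renyi_test_reg d \<alpha> \<rho> \<sigma> = L"
    unfolding renyi_test_reg_def by (rule lim_imp_Limsup[OF _ L(1)]) simp
  with L show "(\<lambda>n. D n / ereal (real n)) \<longlonglongrightarrow> renyi_test_reg d \<alpha> \<rho> \<sigma>"
    "renyi_test_reg d \<alpha> \<rho> \<sigma> =
        (SUP r \<in> {0<..}. min (ereal r) (ereal (\<alpha> / (1 - \<alpha>)) * hoeffding r \<rho> \<sigma>))"
    "(SUP r \<in> {0<..}. min (ereal r) (ereal (\<alpha> / (1 - \<alpha>)) * hoeffding r \<rho> \<sigma>)) =
        Sup {ereal r | r. 0 \<le> r \<and> ereal ((1 - \<alpha>) / \<alpha> * r) \<le> hoeffding r \<rho> \<sigma>}"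
    by simp_all
qed

end

theorem mainTheorem1:
  fixes d :: nat and \<rho> \<sigma> :: "complex mat" and \<alpha> :: real
  assumes "density_op d \<rho>" and "density_op d \<sigma>"
    and "0 < \<alpha>" and "\<alpha> < 1"
  shows "((\<lambda>n. renyi_test (d ^ n) \<alpha> (tensor_pow \<rho> n) (tensor_pow \<sigma> n) / ereal (real n))
            \<longlonglongrightarrow> renyi_test_reg d \<alpha> \<rho> \<sigma>)
    \<and> renyi_test_reg d \<alpha> \<rho> \<sigma> =
        (SUP r \<in> {0<..}. min (ereal r) (ereal (\<alpha> / (1 - \<alpha>)) * hoeffding r \<rho> \<sigma>))
    \<and> (SUP r \<in> {0<..}. min (ereal r) (ereal (\<alpha> / (1 - \<alpha>)) * hoeffding r \<rho> \<sigma>)) =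
        Sup {ereal r | r. 0 \<le> r \<and> ereal ((1 - \<alpha>) / \<alpha> * r) \<le> hoeffding r \<rho> \<sigma>}"
proof -
  interpret S: sqmat d .
  obtain U l where rho: "unitary_mat d U" "\<rho> = spec_mat d U l" "\<forall>i<d. 0 \<le> l i"
    using S.psd_spec_ex assms(1) unfolding density_op_def by blast
  obtain V m where sigma: "unitary_mat d V" "\<sigma> = spec_mat d V m" "\<forall>i<d. 0 \<le> m i"
    using S.psd_spec_ex assms(2) unfolding density_op_def by blast
  have tr: "mtrace (spec_mat d U l) = 1" "mtrace (spec_mat d V m) = 1"
    using assms(1,2) by (simp_all add: density_op_def rho(2) sigma(2))
  interpret state_pair d U V l m \<alpha>
    by (unfold_locales; (rule rho(1) sigma(1) tr assms(3,4) | simp add: rho(3) sigma(3)))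
  show ?thesis
    unfolding rho(2) sigma(2) using test_divergence_limit by (intro conjI)
qed

end
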